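(* If $\lambda\in\mathbb{C}^{\times}$, the map $$\mathcal{A}^{K'}(\Phi_x',\lambda)\longrightarrow\mathbb{C},\qquad f\longmapsto f(c_0')$$ is an isomorphism of $\mathbb{C}$-vector spaces. In particular, $\dim\mathcal{A}^{K'}(\Phi_x',\lambda)=1$.
   Context: Let $q$ be a prime power and $F=\mathbb{F}_q(t)$ the function field of $\mathbb{P}^1$ over $\mathbb{F}_q$; $|\mathbb{P}^1|$ is the set of closed points (equivalently, places of $F$). For $y\in|\mathbb{P}^1|$: $F_y$ is the completion of $F$ at $y$, $\mathcal{O}_y$ its ring of integers, $\pi_y\in F$ a uniformizer, $\kappa(y)=\mathcal{O}_y/(\pi_y)$, the degree of $y$ is $|y|=[\kappa(y):\mathbb{F}_q]$, and $|\cdot|_y$ is the absolute value with $|\pi_y|_y=q^{-|y|}$. $\mathbb{A}$ is the adele ring of $F$, $\mathcal{O}_{\mathbb{A}}=\prod_y\mathcal{O}_y$, $G=\mathrm{GL}_2$, $Z$ is the center of $G(\mathbb{A})$, $K=\mathrm{GL}_2(\mathcal{O}_{\mathbb{A}})$, $K_y=\mathrm{GL}_2(\mathcal{O}_y)$. A matrix in $\mathrm{GL}_2(F_y)$ is viewed in $G(\mathbb{A})$ by putting the identity at all other places. $G(\mathbb{A})$ carries the Haar measure with $\mathrm{vol}(K)=1$. Fix the place $x$ of degree one with uniformizer $\pi_x=t$, and let $K'=K_x'\times\prod_{y\neq x}K_y$ with $K_x'=\{k\in K_x\mid k\equiv\mathrm{id}\bmod(\pi_x)\}$. Let $c_0'$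 be the class of the identity matrix in $G(F)\backslash G(\mathbb{A})/ZK'$. $\Phi_x'$ is the characteristic function of $K'\begin{pmatrix}\pi_x&0\\0&1\end{pmatrix}K'$ divided by the volume of $K'$; it acts on functions by $\Phi_x'(f)(g)=\int_{G(\mathbb{A})}\Phi_x'(h)f(gh)\,dh$. $\mathcal{A}^{K'}$ is the complex vector space of functions $f:G(\mathbb{A})\to\mathbb{C}$ that are left $G(F)$-invariant, $Z$-invariant, right $K'$-invariant (so functions on $G(F)\backslash G(\mathbb{A})/ZK'$), and of moderate growth, i.e. there are constants $C,N$ with $|f(g)|\le C|g|^N$ for all $g\in G(\mathbb{A})$. Here $|g|=\prod_y |g_y|_y$, with $|g_y|_y$ the maximum of the $y$-adic absolute values of the entries of $g_y$ and of $\det(g_y)^{-1}$. $\mathcal{A}^{K'}(\Phi_x',\lambda)=\{f\in\mathcal{A}^{K'}\mid\Phi_x'(f)=\lambda f\}$. *)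

theory Defs
  imports
    "HOL-Analysis.Analysis"
    "HOL-Algebra.QuotRing"
    "HOL-Computational_Algebra.Computational_Algebra"
    "HOL-Library.Function_Algebras"
begin

text \<open>
  Throughout, the finite field with \<open>q\<close> elements is a type \<open>'k :: {field, finite}\<close>, so
  \<open>q = CARD('k)\<close>, and the function field \<open>F\<close> of the projective line is \<open>'k poly fract\<close>.
\<close>

type_synonym 'k ratfun = "'k poly fract"

definition ratfun_t :: "('k::{field,finite}) ratfun" where
  "ratfun_t = Fract [:0, 1:] 1"


section \<open>Closed points of the projective line and their absolute values\<close>

text \<open>
  \<open>Some p\<close> is the closed point of the affine line given by the maximal ideal \<open>(p)\<close> of the
  polynomial ring, and \<open>None\<close> is the point at infinity.
\<close>

typedef (overloaded) ('k::"{field,finite}") place =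
  "insert None (Some ` {p :: 'k poly. irreducible p \<and> lead_coeff p = 1})"
  by blast

setup_lifting type_definition_place

lemma irreducible_X: "irreducible ([:0, 1:] :: ('k::{field,finite}) poly)"
  by (rule irreducible_linear_field_poly) simp

lift_definition place_zero :: "('k::{field,finite}) place" is "Some [:0, 1:]"
  using irreducible_X by auto

text \<open>The degree of the residue field over the field of constants.\<close>

lift_definition place_degree :: "('k::{field,finite}) place \<Rightarrow> nat" is
  "\<lambda>y. case y of None \<Rightarrow> 1 | Some p \<Rightarrow> degree p" .

text \<open>
  The library's \<open>multiplicity\<close> is not available for polynomials over an arbitrary field.
\<close>

definition poly_ord :: "'a::field poly \<Rightarrow> 'a poly \<Rightarrow> nat" where
  "poly_ord p a = Max {n. p ^ n dvd a}"

text \<open>The order of vanishing of a nonzero polynomial; only relevant for nonzero arguments.\<close>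

lift_definition place_ord :: "('k::{field,finite}) place \<Rightarrow> 'k poly \<Rightarrow> int" is
  "\<lambda>y a. case y of None \<Rightarrow> - int (degree a) | Some p \<Rightarrow> int (poly_ord p a)" .

definition poly_abs :: "('k::{field,finite}) place \<Rightarrow> 'k poly \<Rightarrow> real" where
  "poly_abs y a =
     (if a = 0 then 0 else real CARD('k) powi (- (int (place_degree y) * place_ord y a)))"

lemma degree_irreducible_pos:
  fixes p :: "'a::field poly"
  assumes "irreducible p"
  shows "degree p > 0"
  using assms by (auto simp: irreducible_def is_unit_iff_degree)

lemma finite_powers_dvd:
  fixes p a :: "'a::field poly"
  assumes "irreducible p" "a \<noteq> 0"
  shows "finite {n. p ^ n dvd a}"
proof (rule finite_subset)
  show "{n. p ^ n dvd a} \<subseteq> {..degree a}"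
  proof safe
    fix n assume "p ^ n dvd a"
    then have "degree (p ^ n) \<le> degree a" using assms(2) by (rule dvd_imp_degree_le)
    moreover have "p \<noteq> 0" using assms(1) by auto
    ultimately have "n * degree p \<le> degree a" by (simp add: degree_power_eq)
    moreover have "n * 1 \<le> n * degree p"
      using degree_irreducible_pos[OF assms(1)] by (intro mult_le_mono) auto
    ultimately show "n \<le> degree a" by linarith
  qed
qed simp

lemma poly_ord_ge:
  fixes p a :: "'a::field poly"
  assumes "irreducible p" "a \<noteq> 0" "p ^ n dvd a"
  shows "n \<le> poly_ord p a"
  unfolding poly_ord_def using assms finite_powers_dvd[OF assms(1,2)] by (intro Max_ge) auto

lemma poly_ord_dvd:
  fixes p a :: "'a::field poly"
  assumes "irreducible p" "a \<noteq> 0"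
  shows "p ^ poly_ord p a dvd a"
proof -
  have "poly_ord p a \<in> {n. p ^ n dvd a}"
    unfolding poly_ord_def by (rule Max_in[OF finite_powers_dvd[OF assms]]) (auto intro: exI[of _ 0])
  then show ?thesis by simp
qed

lemma poly_ord_decomp:
  fixes p a :: "'a::field poly"
  assumes "irreducible p" "a \<noteq> 0"
  obtains c where "a = p ^ poly_ord p a * c" "\<not> p dvd c"
proof -
  obtain c where c: "a = p ^ poly_ord p a * c" using poly_ord_dvd[OF assms] by (elim dvdE)
  have "\<not> p dvd c"
  proof
    assume "p dvd c"
    then have "p ^ Suc (poly_ord p a) dvd a" by (subst c) (auto simp: mult.commute intro!: mult_dvd_mono)
    from poly_ord_ge[OF assms this] show False by simp
  qed
  with c that show ?thesis by blast
qed

lemma poly_ord_unique: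
  fixes p a :: "'a::field poly"
  assumes p: "irreducible p" and a: "a = p ^ n * c" and c: "\<not> p dvd c"
  shows "poly_ord p a = n"
proof -
  have p0: "p \<noteq> 0" using p by auto
  have a0: "a \<noteq> 0" using a c p0 by auto
  have "n \<le> poly_ord p a" using a by (intro poly_ord_ge[OF p a0]) auto
  moreover have "\<not> n < poly_ord p a"
  proof
    assume "n < poly_ord p a"
    then have "p ^ Suc n dvd p ^ n * c"
      using poly_ord_dvd[OF p a0] a by (meson Suc_leI dvd_trans le_imp_power_dvd)
    then have "p dvd c" using p0 by simp
    with c show False ..
  qed
  ultimately show ?thesis by simp
qed

lemma poly_ord_mult:
  fixes p a b :: "'a::field poly"
  assumes p: "irreducible p" and "a \<noteq> 0" "b \<noteq> 0"
  shows "poly_ord p (a * b) = poly_ord p a + poly_ord p b"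
proof -
  obtain c where c: "a = p ^ poly_ord p a * c" "\<not> p dvd c"
    using poly_ord_decomp[OF p assms(2)] .
  obtain d where d: "b = p ^ poly_ord p b * d" "\<not> p dvd d"
    using poly_ord_decomp[OF p assms(3)] .
  have "prime_elem p" using p by (rule field_poly_irreducible_imp_prime)
  then have "\<not> p dvd c * d" using c(2) d(2) by (simp add: prime_elem_dvd_mult_iff)
  moreover have "a * b = p ^ (poly_ord p a + poly_ord p b) * (c * d)"
    by (subst c(1), subst d(1)) (simp add: power_add mult_ac)
  ultimately show ?thesis using p by (intro poly_ord_unique)
qed

lemma place_cases:
  obtains (fin) p where "Rep_place y = Some p" "irreducible p" "lead_coeff p = 1"
  | (inf) "Rep_place y = None"
  using Rep_place[of y] by auto

lemma place_ord_mult: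
  assumes "a \<noteq> 0" "b \<noteq> 0"
  shows "place_ord y (a * b) = place_ord y a + place_ord y b"
  by (cases y rule: place_cases)
     (use assms in \<open>auto simp: place_ord.rep_eq poly_ord_mult degree_mult_eq\<close>)

lemma place_ord_add:
  assumes "a \<noteq> 0" "b \<noteq> 0" "a + b \<noteq> 0"
  shows "min (place_ord y a) (place_ord y b) \<le> place_ord y (a + b)"
proof (cases y rule: place_cases)
  case (fin p)
  let ?m = "min (poly_ord p a) (poly_ord p b)"
  have "p ^ ?m dvd a" "p ^ ?m dvd b"
    using poly_ord_dvd[OF fin(2)] assms
    by (meson dvd_trans le_imp_power_dvd min.cobounded1 min.cobounded2)+
  then have "p ^ ?m dvd a + b" by simp
  from poly_ord_ge[OF fin(2) assms(3) this] show ?thesis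
    using fin by (auto simp: place_ord.rep_eq)
next
  case inf
  then show ?thesis using degree_add_le_max[of a b] by (auto simp: place_ord.rep_eq)
qed

lemma card_gt_1: "real CARD('k::{field,finite}) > 1"
proof -
  have "card {0, 1::'k} \<le> CARD('k)" by (intro card_mono) auto
  then show ?thesis by simp
qed

lemma place_degree_pos: "place_degree y > 0"
  by (cases y rule: place_cases) (auto simp: place_degree.rep_eq degree_irreducible_pos)

lemma poly_abs_0 [simp]: "poly_abs y 0 = 0"
  by (simp add: poly_abs_def)

lemma poly_abs_pos: "a \<noteq> 0 \<Longrightarrow> poly_abs y a > 0"
  using card_gt_1[where 'k='a] by (auto simp: poly_abs_def)

lemma poly_abs_nonneg [simp]: "poly_abs y a \<ge> 0"
  using poly_abs_pos[of a y] by (cases "a = 0") auto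

lemma poly_abs_mult: "poly_abs y (a * b) = poly_abs y a * poly_abs y b"
  by (auto simp: poly_abs_def place_ord_mult algebra_simps simp flip: power_int_add)

lemma poly_abs_add: "poly_abs y (a + b) \<le> max (poly_abs y a) (poly_abs y b)"
proof (cases "a = 0 \<or> b = 0 \<or> a + b = 0")
  case False
  show ?thesis
  proof (cases "place_ord y a \<le> place_ord y b")
    case True
    then show ?thesis using False place_ord_add[of a b y] card_gt_1[where 'k='a]
      by (auto simp: poly_abs_def le_max_iff_disj intro!: disjI1 power_int_increasing mult_left_mono)
  next
    case f: False
    then show ?thesis using False place_ord_add[of a b y] card_gt_1[where 'k='a]
      by (auto simp: poly_abs_def le_max_iff_disj intro!: disjI2 power_int_increasing mult_left_mono)
  qed
qed (auto simp: le_max_iff_disj)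


definition place_abs :: "('k::{field,finite}) place \<Rightarrow> 'k ratfun \<Rightarrow> real" where
  "place_abs y f =
     (THE r. \<forall>a b. b \<noteq> 0 \<longrightarrow> f = Fract a b \<longrightarrow> r = poly_abs y a / poly_abs y b)"

lemma place_abs_Fract:
  assumes "b \<noteq> 0"
  shows "place_abs y (Fract a b) = poly_abs y a / poly_abs y b"
  unfolding place_abs_def
proof (rule the_equality)
  show "\<forall>a' b'. b' \<noteq> 0 \<longrightarrow> Fract a b = Fract a' b' \<longrightarrow>
          poly_abs y a / poly_abs y b = poly_abs y a' / poly_abs y b'"
  proof (intro allI impI)
    fix a' b' :: "'a poly"
    assume b': "b' \<noteq> 0" and "Fract a b = Fract a' b'"
    then have "a * b' = a' * b" using assms by (simp add: eq_fract)
    then have "poly_abs y a * poly_abs y b' = poly_abs y a' * poly_abs y b"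
      by (metis poly_abs_mult)
    then show "poly_abs y a / poly_abs y b = poly_abs y a' / poly_abs y b'"
      using poly_abs_pos[OF assms, of y] poly_abs_pos[OF b', of y] by (simp add: field_simps)
  qed
qed (use assms in auto)

lemma place_abs_0 [simp]: "place_abs y 0 = 0"
  by (simp add: Zero_fract_def place_abs_Fract)

lemma place_abs_1 [simp]: "place_abs y 1 = 1"
  using poly_abs_pos[of 1 y] by (simp add: One_fract_def place_abs_Fract)

lemma place_abs_nonneg [simp]: "place_abs y f \<ge> 0"
  by (cases f) (simp add: place_abs_Fract)

lemma place_abs_eq_0_iff [simp]: "place_abs y f = 0 \<longleftrightarrow> f = 0"
proof (cases f)
  case (Fract a b)
  then show ?thesis using poly_abs_pos[of a y] poly_abs_pos[of b y]
    by (cases "a = 0") (auto simp: place_abs_Fract Zero_fract_def eq_fract)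
qed

lemma place_abs_mult: "place_abs y (f * g) = place_abs y f * place_abs y g"
  by (cases f; cases g) (simp add: place_abs_Fract poly_abs_mult)

lemma place_abs_uminus [simp]: "place_abs y (- f) = place_abs y f"
proof -
  have "place_abs y (- 1) * place_abs y (- 1) = place_abs y ((- 1) * (- 1))"
    by (simp only: place_abs_mult)
  then have "(place_abs y (- 1) - 1) * (place_abs y (- 1) + 1) = 0" by (simp add: algebra_simps)
  moreover have "place_abs y (- 1) + 1 > 0" using place_abs_nonneg[of y "- 1"] by linarith
  ultimately have "place_abs y (- 1) = 1" by simp
  then show ?thesis using place_abs_mult[of y "- 1" f] by simp
qed

lemma place_abs_add: "place_abs y (f + g) \<le> max (place_abs y f) (place_abs y g)"
proof (cases f; cases g)
  fix a b c d :: "'a poly"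
  assume *: "f = Fract a b" "b \<noteq> 0" "g = Fract c d" "d \<noteq> 0"
  have b: "poly_abs y b > 0" and d: "poly_abs y d > 0" using * by (auto intro: poly_abs_pos)
  have "place_abs y (f + g) = poly_abs y (a * d + c * b) / (poly_abs y b * poly_abs y d)"
    using * by (simp add: place_abs_Fract poly_abs_mult)
  also have "\<dots> \<le> max (poly_abs y (a * d)) (poly_abs y (c * b)) / (poly_abs y b * poly_abs y d)"
    using b d by (intro divide_right_mono poly_abs_add) auto
  also have "\<dots> = max (place_abs y f) (place_abs y g)"
    using * b d by (auto simp: place_abs_Fract poly_abs_mult max_def field_simps)
  finally show ?thesis .
qed

lemma place_abs_triangle: "place_abs y (f + g) \<le> place_abs y f + place_abs y g"
  using place_abs_add[of y f g] place_abs_nonneg[of y f] place_abs_nonneg[of y g] by linarith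

lemma place_abs_diff: "place_abs y (f - g) \<le> max (place_abs y f) (place_abs y g)"
  using place_abs_add[of y f "- g"] by simp

lemma place_abs_minus_commute: "place_abs y (f - g) = place_abs y (g - f)"
  using place_abs_uminus[of y "f - g"] by simp

lemma place_abs_diff_le: "\<bar>place_abs y f - place_abs y g\<bar> \<le> place_abs y (f - g)"
  using place_abs_triangle[of y "f - g" g] place_abs_triangle[of y "g - f" f]
  by (simp add: place_abs_minus_commute[of y g f])


section \<open>Completions\<close>

definition cauchy_at :: "('k::{field,finite}) place \<Rightarrow> (nat \<Rightarrow> 'k ratfun) \<Rightarrow> bool" where
  "cauchy_at y s \<longleftrightarrow> (\<forall>e>0. \<exists>N. \<forall>m\<ge>N. \<forall>n\<ge>N. place_abs y (s m - s n) < e)"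

definition cauchy_ring :: "('k::{field,finite}) place \<Rightarrow> (nat \<Rightarrow> 'k ratfun) ring" where
  "cauchy_ring y =
     \<lparr>carrier = {s. cauchy_at y s}, mult = (\<lambda>s r n. s n * r n), one = (\<lambda>n. 1),
      zero = (\<lambda>n. 0), add = (\<lambda>s r n. s n + r n)\<rparr>"

definition null_seqs :: "('k::{field,finite}) place \<Rightarrow> (nat \<Rightarrow> 'k ratfun) set" where
  "null_seqs y = {s. (\<lambda>n. place_abs y (s n)) \<longlonglongrightarrow> 0}"

definition local_field :: "('k::{field,finite}) place \<Rightarrow> (nat \<Rightarrow> 'k ratfun) set ring" where
  "local_field y = cauchy_ring y Quot null_seqs y"

text \<open>The embedding of \<open>F\<close> into its completion.\<close>

definition to_completion ::
    "('k::{field,finite}) place \<Rightarrow> 'k ratfun \<Rightarrow> (nat \<Rightarrow> 'k ratfun) set" where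
  "to_completion y f = null_seqs y +>\<^bsub>cauchy_ring y\<^esub> (\<lambda>n. f)"

text \<open>The continuous extension of the absolute value to the completion.\<close>

definition local_abs ::
    "('k::{field,finite}) place \<Rightarrow> (nat \<Rightarrow> 'k ratfun) set \<Rightarrow> real" where
  "local_abs y c = (THE r. \<forall>s\<in>c. (\<lambda>n. place_abs y (s n)) \<longlonglongrightarrow> r)"

definition local_integers ::
    "('k::{field,finite}) place \<Rightarrow> (nat \<Rightarrow> 'k ratfun) set set" where
  "local_integers y = {c \<in> carrier (local_field y). local_abs y c \<le> 1}"

definition local_open ::
    "('k::{field,finite}) place \<Rightarrow> (nat \<Rightarrow> 'k ratfun) set set \<Rightarrow> bool" where
  "local_open y U \<longleftrightarrow> U \<subseteq> carrier (local_field y) \<and>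
     (\<forall>a\<in>U. \<exists>e>0. \<forall>b\<in>carrier (local_field y).
        local_abs y (b \<ominus>\<^bsub>local_field y\<^esub> a) < e \<longrightarrow> b \<in> U)"

lemma cauchy_at_const [simp]: "cauchy_at y (\<lambda>n. f)"
  by (simp add: cauchy_at_def)

lemma cauchy_at_add:
  assumes "cauchy_at y s" "cauchy_at y r"
  shows "cauchy_at y (\<lambda>n. s n + r n)"
  unfolding cauchy_at_def
proof (intro allI impI)
  fix e :: real assume e: "e > 0"
  obtain M where M: "\<And>m n. m \<ge> M \<Longrightarrow> n \<ge> M \<Longrightarrow> place_abs y (s m - s n) < e"
    using assms(1) e unfolding cauchy_at_def by blast
  obtain N where N: "\<And>m n. m \<ge> N \<Longrightarrow> n \<ge> N \<Longrightarrow> place_abs y (r m - r n) < e"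
    using assms(2) e unfolding cauchy_at_def by blast
  have "place_abs y ((s m + r m) - (s n + r n)) < e" if "m \<ge> max M N" "n \<ge> max M N" for m n
    using place_abs_add[of y "s m - s n" "r m - r n"] M[of m n] N[of m n] that
    by (simp add: algebra_simps)
  then show "\<exists>N. \<forall>m\<ge>N. \<forall>n\<ge>N. place_abs y ((s m + r m) - (s n + r n)) < e" by blast
qed

lemma cauchy_at_uminus: "cauchy_at y s \<Longrightarrow> cauchy_at y (\<lambda>n. - s n)"
  using place_abs_minus_commute[of y] by (auto simp: cauchy_at_def)

lemma cauchy_at_abs_convergent:
  assumes "cauchy_at y s"
  shows "convergent (\<lambda>n. place_abs y (s n))"
  unfolding Cauchy_convergent_iff [symmetric] Cauchy_def dist_real_def
  using assms le_less_trans[OF place_abs_diff_le] unfolding cauchy_at_def by meson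

lemma cauchy_at_bounded:
  assumes "cauchy_at y s"
  obtains B where "B > 0" "\<And>n. place_abs y (s n) \<le> B"
proof -
  have "Bseq (\<lambda>n. place_abs y (s n))"
    using cauchy_at_abs_convergent[OF assms] by (rule convergent_imp_Bseq)
  then show ?thesis using that unfolding Bseq_def by auto
qed

lemma cauchy_at_mult:
  assumes "cauchy_at y s" "cauchy_at y r"
  shows "cauchy_at y (\<lambda>n. s n * r n)"
  unfolding cauchy_at_def
proof (intro allI impI)
  fix e :: real assume e: "e > 0"
  obtain A where A: "A > 0" "\<And>n. place_abs y (s n) \<le> A" using cauchy_at_bounded[OF assms(1)] by blast
  obtain B where B: "B > 0" "\<And>n. place_abs y (r n) \<le> B" using cauchy_at_bounded[OF assms(2)] by blast
  obtain M where M: "\<And>m n. m \<ge> M \<Longrightarrow> n \<ge> M \<Longrightarrow> place_abs y (s m - s n) < e / B"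
    using assms(1) e B unfolding cauchy_at_def by (meson divide_pos_pos)
  obtain N where N: "\<And>m n. m \<ge> N \<Longrightarrow> n \<ge> N \<Longrightarrow> place_abs y (r m - r n) < e / A"
    using assms(2) e A unfolding cauchy_at_def by (meson divide_pos_pos)
  have "place_abs y (s m * r m - s n * r n) < e" if "m \<ge> max M N" "n \<ge> max M N" for m n
  proof -
    have "place_abs y (s m * r m - s n * r n) =
          place_abs y (s m * (r m - r n) + (s m - s n) * r n)" by (simp add: algebra_simps)
    also have "\<dots> \<le> max (place_abs y (s m) * place_abs y (r m - r n))
                        (place_abs y (s m - s n) * place_abs y (r n))"
      unfolding place_abs_mult [symmetric] by (rule place_abs_add)
    also have "\<dots> \<le> max (A * place_abs y (r m - r n)) (place_abs y (s m - s n) * B)"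
      using A B by (intro max.mono mult_right_mono mult_left_mono) auto
    also have "\<dots> < e"
      using M[of m n] N[of m n] that A(1) B(1) by (auto simp: field_simps)
    finally show ?thesis .
  qed
  then show "\<exists>N. \<forall>m\<ge>N. \<forall>n\<ge>N. place_abs y (s m * r m - s n * r n) < e" by blast
qed

lemma cring_cauchy_ring: "cring (cauchy_ring y)"
proof (rule cringI)
  show "abelian_group (cauchy_ring y)"
  proof (rule abelian_groupI)
    fix s assume "s \<in> carrier (cauchy_ring y)"
    then show "\<exists>r\<in>carrier (cauchy_ring y). r \<oplus>\<^bsub>cauchy_ring y\<^esub> s = \<zero>\<^bsub>cauchy_ring y\<^esub>"
      by (intro bexI[of _ "\<lambda>n. - s n"]) (auto simp: cauchy_ring_def cauchy_at_uminus)
  qed (auto simp: cauchy_ring_def cauchy_at_add add_ac)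
  show "Group.comm_monoid (cauchy_ring y)"
    by (rule comm_monoidI) (auto simp: cauchy_ring_def cauchy_at_mult mult_ac)
qed (auto simp: cauchy_ring_def algebra_simps)

lemma null_seqs_cauchy:
  assumes "s \<in> null_seqs y"
  shows "cauchy_at y s"
  unfolding cauchy_at_def
proof (intro allI impI)
  fix e :: real assume e: "e > 0"
  have "eventually (\<lambda>n. place_abs y (s n) < e) sequentially"
    using assms e unfolding null_seqs_def by (auto intro: order_tendstoD)
  then obtain N where N: "\<And>n. n \<ge> N \<Longrightarrow> place_abs y (s n) < e"
    unfolding eventually_sequentially by blast
  have "place_abs y (s m - s n) < e" if "m \<ge> N" "n \<ge> N" for m n
    using place_abs_diff[of y "s m" "s n"] N[of m] N[of n] that by simp
  then show "\<exists>N. \<forall>m\<ge>N. \<forall>n\<ge>N. place_abs y (s m - s n) < e" by blast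
qed

lemma null_seqs_add:
  assumes "s \<in> null_seqs y" "r \<in> null_seqs y"
  shows "(\<lambda>n. s n + r n) \<in> null_seqs y"
proof -
  have "(\<lambda>n. place_abs y (s n) + place_abs y (r n)) \<longlonglongrightarrow> 0 + 0"
    by (rule tendsto_add) (use assms in \<open>auto simp: null_seqs_def\<close>)
  then have "(\<lambda>n. place_abs y (s n) + place_abs y (r n)) \<longlonglongrightarrow> 0" by simp
  then have "(\<lambda>n. place_abs y (s n + r n)) \<longlonglongrightarrow> 0"
    by (rule Lim_null_comparison[rotated]) (simp add: place_abs_triangle)
  then show ?thesis by (simp add: null_seqs_def)
qed

lemma null_seqs_mult:
  assumes "s \<in> null_seqs y" "cauchy_at y r"
  shows "(\<lambda>n. s n * r n) \<in> null_seqs y"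
proof -
  obtain l where l: "(\<lambda>n. place_abs y (r n)) \<longlonglongrightarrow> l"
    using cauchy_at_abs_convergent[OF assms(2)] unfolding convergent_def by blast
  have "(\<lambda>n. place_abs y (s n) * place_abs y (r n)) \<longlonglongrightarrow> 0 * l"
    by (rule tendsto_mult) (use assms(1) l in \<open>auto simp: null_seqs_def\<close>)
  then show ?thesis by (simp add: null_seqs_def place_abs_mult)
qed

lemma null_seqs_uminus: "s \<in> null_seqs y \<Longrightarrow> (\<lambda>n. - s n) \<in> null_seqs y"
  by (simp add: null_seqs_def)

lemma cauchy_ring_uminus:
  assumes "cauchy_at y s"
  shows "\<ominus>\<^bsub>cauchy_ring y\<^esub> s = (\<lambda>n. - s n)"
proof -
  have "abelian_group (cauchy_ring y)"
    using cring.axioms(1)[OF cring_cauchy_ring] by (rule ring.axioms(1))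
  then show ?thesis
    by (rule abelian_group.minus_equality)
       (use assms in \<open>simp_all add: cauchy_ring_def cauchy_at_uminus\<close>)
qed

lemma ideal_null_seqs: "ideal (null_seqs y) (cauchy_ring y)"
proof (rule idealI)
  show "ring (cauchy_ring y)" by (rule cring.axioms(1)[OF cring_cauchy_ring])
  show "subgroup (null_seqs y) (add_monoid (cauchy_ring y))"
  proof (rule subgroup.intro)
    show "null_seqs y \<subseteq> carrier (add_monoid (cauchy_ring y))"
      by (auto simp: cauchy_ring_def null_seqs_cauchy)
    show "\<one>\<^bsub>add_monoid (cauchy_ring y)\<^esub> \<in> null_seqs y"
      by (simp add: cauchy_ring_def null_seqs_def)
  next
    fix s r assume "s \<in> null_seqs y" "r \<in> null_seqs y"
    then show "s \<otimes>\<^bsub>add_monoid (cauchy_ring y)\<^esub> r \<in> null_seqs y"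
      by (simp add: cauchy_ring_def null_seqs_add)
  next
    fix s assume s: "s \<in> null_seqs y"
    have "\<ominus>\<^bsub>cauchy_ring y\<^esub> s \<in> null_seqs y"
      unfolding cauchy_ring_uminus[OF null_seqs_cauchy[OF s]] by (rule null_seqs_uminus[OF s])
    then show "inv\<^bsub>add_monoid (cauchy_ring y)\<^esub> s \<in> null_seqs y"
      by (simp only: a_inv_def)
  qed
next
  fix s r assume "s \<in> null_seqs y" "r \<in> carrier (cauchy_ring y)"
  then have "(\<lambda>n. s n * r n) \<in> null_seqs y"
    by (intro null_seqs_mult) (simp_all add: cauchy_ring_def)
  then show "r \<otimes>\<^bsub>cauchy_ring y\<^esub> s \<in> null_seqs y" "s \<otimes>\<^bsub>cauchy_ring y\<^esub> r \<in> null_seqs y"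
    by (simp_all add: cauchy_ring_def mult.commute)
qed

lemma cring_completion: "cring (local_field y)"
  unfolding local_field_def
  using ideal.quotient_is_cring[OF ideal_null_seqs cring_cauchy_ring] .

lemma completion_cases:
  assumes "c \<in> carrier (local_field y)"
  obtains s where "cauchy_at y s" "c = null_seqs y +>\<^bsub>cauchy_ring y\<^esub> s"
  using assms unfolding local_field_def FactRing_simps by (auto simp: cauchy_ring_def)

lemma mem_coset_iff:
  "r \<in> null_seqs y +>\<^bsub>cauchy_ring y\<^esub> s \<longleftrightarrow> (\<lambda>n. r n - s n) \<in> null_seqs y"
proof -
  have "r \<in> null_seqs y +>\<^bsub>cauchy_ring y\<^esub> s \<longleftrightarrow> (\<exists>u\<in>null_seqs y. r = (\<lambda>n. u n + s n))"
    by (simp add: a_r_coset_def r_coset_def cauchy_ring_def)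
  also have "\<dots> \<longleftrightarrow> (\<lambda>n. r n - s n) \<in> null_seqs y"
  proof
    assume "(\<lambda>n. r n - s n) \<in> null_seqs y"
    then show "\<exists>u\<in>null_seqs y. r = (\<lambda>n. u n + s n)"
      by (rule bexI[rotated]) simp
  next
    assume "\<exists>u\<in>null_seqs y. r = (\<lambda>n. u n + s n)"
    then obtain u where u: "u \<in> null_seqs y" "r = (\<lambda>n. u n + s n)" ..
    have "(\<lambda>n. r n - s n) = u" by (simp add: u(2))
    then show "(\<lambda>n. r n - s n) \<in> null_seqs y" using u(1) by (simp only:)
  qed
  finally show ?thesis .
qed

lemma coset_in_completion:
  "cauchy_at y s \<Longrightarrow> null_seqs y +>\<^bsub>cauchy_ring y\<^esub> s \<in> carrier (local_field y)"
  unfolding local_field_def FactRing_simps by (auto simp: cauchy_ring_def)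

lemma local_abs_tendsto:
  assumes "cauchy_at y s"
  shows "(\<lambda>n. place_abs y (s n)) \<longlonglongrightarrow> local_abs y (null_seqs y +>\<^bsub>cauchy_ring y\<^esub> s)"
proof -
  let ?c = "null_seqs y +>\<^bsub>cauchy_ring y\<^esub> s"
  obtain l where l: "(\<lambda>n. place_abs y (s n)) \<longlonglongrightarrow> l"
    using cauchy_at_abs_convergent[OF assms] unfolding convergent_def by blast
  have s: "s \<in> ?c" unfolding mem_coset_iff by (simp add: null_seqs_def)
  have "(\<lambda>n. place_abs y (r n)) \<longlonglongrightarrow> l" if "r \<in> ?c" for r
  proof -
    have "(\<lambda>n. place_abs y (r n - s n)) \<longlonglongrightarrow> 0"
      using that unfolding mem_coset_iff by (simp add: null_seqs_def)
    then have "(\<lambda>n. place_abs y (r n) - place_abs y (s n)) \<longlonglongrightarrow> 0"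
      by (rule Lim_null_comparison[rotated]) (auto simp: place_abs_diff_le)
    from tendsto_add[OF this l] show ?thesis by simp
  qed
  then have lim: "\<forall>r\<in>?c. (\<lambda>n. place_abs y (r n)) \<longlonglongrightarrow> l" by blast
  have "local_abs y ?c = l"
    unfolding local_abs_def
  proof (rule the_equality)
    show "\<forall>r\<in>?c. (\<lambda>n. place_abs y (r n)) \<longlonglongrightarrow> l" by (rule lim)
  next
    fix l' assume "\<forall>r\<in>?c. (\<lambda>n. place_abs y (r n)) \<longlonglongrightarrow> l'"
    then have "(\<lambda>n. place_abs y (s n)) \<longlonglongrightarrow> l'" using s by blast
    from this l show "l' = l" by (rule LIMSEQ_unique)
  qed
  with l show ?thesis by simp
qed

lemma completion_hom:
  assumes "cauchy_at y s" "cauchy_at y r"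
  defines "h \<equiv> (\<lambda>s. null_seqs y +>\<^bsub>cauchy_ring y\<^esub> s)"
  shows "h s \<otimes>\<^bsub>local_field y\<^esub> h r = h (\<lambda>n. s n * r n)"
    and "h s \<oplus>\<^bsub>local_field y\<^esub> h r = h (\<lambda>n. s n + r n)"
proof -
  have c: "s \<in> carrier (cauchy_ring y)" "r \<in> carrier (cauchy_ring y)"
    using assms(1,2) by (simp_all add: cauchy_ring_def)
  note hom = ideal.rcos_ring_hom[OF ideal_null_seqs, of y]
  have m: "h (s \<otimes>\<^bsub>cauchy_ring y\<^esub> r) = h s \<otimes>\<^bsub>local_field y\<^esub> h r"
    unfolding h_def local_field_def by (rule ring_hom_mult[OF hom c])
  have p: "h (s \<oplus>\<^bsub>cauchy_ring y\<^esub> r) = h s \<oplus>\<^bsub>local_field y\<^esub> h r"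
    unfolding h_def local_field_def by (rule ring_hom_add[OF hom c])
  have m': "s \<otimes>\<^bsub>cauchy_ring y\<^esub> r = (\<lambda>n. s n * r n)" by (simp add: cauchy_ring_def)
  have p': "s \<oplus>\<^bsub>cauchy_ring y\<^esub> r = (\<lambda>n. s n + r n)" by (simp add: cauchy_ring_def)
  show "h s \<otimes>\<^bsub>local_field y\<^esub> h r = h (\<lambda>n. s n * r n)" by (rule m[unfolded m', symmetric])
  show "h s \<oplus>\<^bsub>local_field y\<^esub> h r = h (\<lambda>n. s n + r n)" by (rule p[unfolded p', symmetric])
qed

lemma completion_one: "\<one>\<^bsub>local_field y\<^esub> = to_completion y 1"
proof -
  have "\<one>\<^bsub>cauchy_ring y\<^esub> = (\<lambda>n. 1)" by (simp add: cauchy_ring_def)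
  moreover have "\<one>\<^bsub>local_field y\<^esub> = null_seqs y +>\<^bsub>cauchy_ring y\<^esub> \<one>\<^bsub>cauchy_ring y\<^esub>"
    by (simp only: local_field_def FactRing_def monoid.simps)
  ultimately show ?thesis by (simp only: to_completion_def)
qed

lemma completion_zero: "\<zero>\<^bsub>local_field y\<^esub> = to_completion y 0"
proof -
  have "\<zero>\<^bsub>local_field y\<^esub> = null_seqs y"
    by (simp only: local_field_def FactRing_def ring.simps)
  moreover have "null_seqs y = to_completion y 0"
    unfolding to_completion_def by (intro equalityI subsetI) (simp_all only: mem_coset_iff diff_0_right)
  ultimately show ?thesis by (simp only:)
qed

lemma to_completion_closed [simp]: "to_completion y f \<in> carrier (local_field y)"
  unfolding to_completion_def by (rule coset_in_completion) simp

lemma to_completion_hom: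
  "to_completion y f \<otimes>\<^bsub>local_field y\<^esub> to_completion y g = to_completion y (f * g)"
  "to_completion y f \<oplus>\<^bsub>local_field y\<^esub> to_completion y g = to_completion y (f + g)"
  unfolding to_completion_def
  by (rule completion_hom[OF cauchy_at_const cauchy_at_const])+

lemma local_abs_to_completion [simp]: "local_abs y (to_completion y f) = place_abs y f"
  using LIMSEQ_unique[OF local_abs_tendsto[OF cauchy_at_const, of y f] tendsto_const]
  by (simp add: to_completion_def)

lemma local_abs_mult:
  assumes "a \<in> carrier (local_field y)" "b \<in> carrier (local_field y)"
  shows "local_abs y (a \<otimes>\<^bsub>local_field y\<^esub> b) = local_abs y a * local_abs y b"
proof -
  obtain s where s: "cauchy_at y s" "a = null_seqs y +>\<^bsub>cauchy_ring y\<^esub> s"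
    using completion_cases[OF assms(1)] .
  obtain r where r: "cauchy_at y r" "b = null_seqs y +>\<^bsub>cauchy_ring y\<^esub> r"
    using completion_cases[OF assms(2)] .
  have "(\<lambda>n. place_abs y (s n) * place_abs y (r n)) \<longlonglongrightarrow> local_abs y a * local_abs y b"
    by (rule tendsto_mult) (simp_all add: local_abs_tendsto s r)
  moreover have "(\<lambda>n. place_abs y (s n * r n)) \<longlonglongrightarrow> local_abs y (a \<otimes>\<^bsub>local_field y\<^esub> b)"
    using local_abs_tendsto[OF cauchy_at_mult[OF s(1) r(1)]] s r by (simp add: completion_hom)
  ultimately show ?thesis unfolding place_abs_mult by (rule LIMSEQ_unique[rotated])
qed

lemma local_abs_add:
  assumes "a \<in> carrier (local_field y)" "b \<in> carrier (local_field y)"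
  shows "local_abs y (a \<oplus>\<^bsub>local_field y\<^esub> b) \<le> max (local_abs y a) (local_abs y b)"
proof -
  obtain s where s: "cauchy_at y s" "a = null_seqs y +>\<^bsub>cauchy_ring y\<^esub> s"
    using completion_cases[OF assms(1)] .
  obtain r where r: "cauchy_at y r" "b = null_seqs y +>\<^bsub>cauchy_ring y\<^esub> r"
    using completion_cases[OF assms(2)] .
  have *: "(\<lambda>n. max (place_abs y (s n)) (place_abs y (r n)))
          \<longlonglongrightarrow> max (local_abs y a) (local_abs y b)"
    by (rule tendsto_max) (simp_all add: local_abs_tendsto s r)
  have "(\<lambda>n. place_abs y (s n + r n)) \<longlonglongrightarrow> local_abs y (a \<oplus>\<^bsub>local_field y\<^esub> b)"
    using local_abs_tendsto[OF cauchy_at_add[OF s(1) r(1)]] s r by (simp add: completion_hom)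
  from LIMSEQ_le[OF this *] show ?thesis by (simp add: place_abs_add)
qed

lemma local_integers_mult:
  "a \<in> local_integers y \<Longrightarrow> b \<in> local_integers y \<Longrightarrow> a \<otimes>\<^bsub>local_field y\<^esub> b \<in> local_integers y"
proof -
  assume *: "a \<in> local_integers y" "b \<in> local_integers y"
  interpret cring "local_field y" by (rule cring_completion)
  have "local_abs y a \<ge> 0"
  proof -
    obtain s where s: "cauchy_at y s" "a = null_seqs y +>\<^bsub>cauchy_ring y\<^esub> s"
      using * completion_cases unfolding local_integers_def by blast
    show ?thesis using LIMSEQ_le_const[OF local_abs_tendsto[OF s(1)], of 0] s(2) by simp
  qed
  moreover have "local_abs y b \<ge> 0"
  proof -
    obtain s where s: "cauchy_at y s" "b = null_seqs y +>\<^bsub>cauchy_ring y\<^esub> s"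
      using * completion_cases unfolding local_integers_def by blast
    show ?thesis using LIMSEQ_le_const[OF local_abs_tendsto[OF s(1)], of 0] s(2) by simp
  qed
  ultimately show ?thesis using * by (auto simp: local_integers_def local_abs_mult mult_le_one)
qed

lemma local_integers_add:
  "a \<in> local_integers y \<Longrightarrow> b \<in> local_integers y \<Longrightarrow> a \<oplus>\<^bsub>local_field y\<^esub> b \<in> local_integers y"
proof -
  assume *: "a \<in> local_integers y" "b \<in> local_integers y"
  interpret cring "local_field y" by (rule cring_completion)
  show ?thesis using * local_abs_add[of a y b] by (auto simp: local_integers_def)
qed

lemma to_completion_in_local_integers [simp]:
  "to_completion y f \<in> local_integers y \<longleftrightarrow> place_abs y f \<le> 1"
  by (simp add: local_integers_def)

lemma completion_uminus:
  assumes "a \<in> carrier (local_field y)"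
  shows "\<ominus>\<^bsub>local_field y\<^esub> a = to_completion y (- 1) \<otimes>\<^bsub>local_field y\<^esub> a"
proof -
  interpret cring "local_field y" by (rule cring_completion)
  have "to_completion y (- 1) \<oplus>\<^bsub>local_field y\<^esub> \<one>\<^bsub>local_field y\<^esub> = \<zero>\<^bsub>local_field y\<^esub>"
    by (simp add: completion_one completion_zero to_completion_hom)
  then have "to_completion y (- 1) = \<ominus>\<^bsub>local_field y\<^esub> \<one>\<^bsub>local_field y\<^esub>"
    by (metis minus_equality one_closed to_completion_closed)
  then show ?thesis using assms by (simp add: l_minus)
qed

lemma local_integers_uminus:
  assumes "a \<in> local_integers y"
  shows "\<ominus>\<^bsub>local_field y\<^esub> a \<in> local_integers y"
proof -
  have "to_completion y (- 1) \<otimes>\<^bsub>local_field y\<^esub> a \<in> local_integers y"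
    using assms by (intro local_integers_mult) auto
  then show ?thesis using assms by (simp add: completion_uminus local_integers_def)
qed


section \<open>The adele ring\<close>

typedef (overloaded) ('k::"{field,finite}") adele =
  "{a :: 'k place \<Rightarrow> (nat \<Rightarrow> 'k ratfun) set.
      (\<forall>y. a y \<in> carrier (local_field y)) \<and> finite {y. a y \<notin> local_integers y}}"
  morphisms adele_at Abs_adele
  by (rule exI[of _ "\<lambda>y. to_completion y 0"]) simp

setup_lifting type_definition_adele

lemma adele_at_closed [simp]: "adele_at a y \<in> carrier (local_field y)"
  using adele_at[of a] by simp

lemma adele_eqI: "(\<And>y. adele_at a y = adele_at b y) \<Longrightarrow> a = b"
  by (simp add: adele_at_inject [symmetric] fun_eq_iff)

instantiation adele :: ("{field,finite}") comm_ring_1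
begin

lift_definition zero_adele :: "'a adele" is "\<lambda>y. \<zero>\<^bsub>local_field y\<^esub>"
  by (simp add: completion_zero)

lift_definition one_adele :: "'a adele" is "\<lambda>y. \<one>\<^bsub>local_field y\<^esub>"
  by (simp add: completion_one)

lift_definition plus_adele :: "'a adele \<Rightarrow> 'a adele \<Rightarrow> 'a adele" is
  "\<lambda>a b y. a y \<oplus>\<^bsub>local_field y\<^esub> b y"
proof -
  fix a b :: "'a place \<Rightarrow> (nat \<Rightarrow> 'a ratfun) set"
  assume *: "(\<forall>y. a y \<in> carrier (local_field y)) \<and> finite {y. a y \<notin> local_integers y}"
    "(\<forall>y. b y \<in> carrier (local_field y)) \<and> finite {y. b y \<notin> local_integers y}"
  have "finite {y. a y \<oplus>\<^bsub>local_field y\<^esub> b y \<notin> local_integers y}"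
    by (rule finite_subset[of _ "{y. a y \<notin> local_integers y} \<union> {y. b y \<notin> local_integers y}"])
       (use * local_integers_add in auto)
  then show "(\<forall>y. a y \<oplus>\<^bsub>local_field y\<^esub> b y \<in> carrier (local_field y)) \<and>
      finite {y. a y \<oplus>\<^bsub>local_field y\<^esub> b y \<notin> local_integers y}"
    using * cring.cring_simprules(1)[OF cring_completion] by blast
qed

lift_definition times_adele :: "'a adele \<Rightarrow> 'a adele \<Rightarrow> 'a adele" is
  "\<lambda>a b y. a y \<otimes>\<^bsub>local_field y\<^esub> b y"
proof -
  fix a b :: "'a place \<Rightarrow> (nat \<Rightarrow> 'a ratfun) set"
  assume *: "(\<forall>y. a y \<in> carrier (local_field y)) \<and> finite {y. a y \<notin> local_integers y}"
    "(\<forall>y. b y \<in> carrier (local_field y)) \<and> finite {y. b y \<notin> local_integers y}"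
  have "finite {y. a y \<otimes>\<^bsub>local_field y\<^esub> b y \<notin> local_integers y}"
    by (rule finite_subset[of _ "{y. a y \<notin> local_integers y} \<union> {y. b y \<notin> local_integers y}"])
       (use * local_integers_mult in auto)
  then show "(\<forall>y. a y \<otimes>\<^bsub>local_field y\<^esub> b y \<in> carrier (local_field y)) \<and>
      finite {y. a y \<otimes>\<^bsub>local_field y\<^esub> b y \<notin> local_integers y}"
    using * cring.cring_simprules(5)[OF cring_completion] by blast
qed

lift_definition uminus_adele :: "'a adele \<Rightarrow> 'a adele" is "\<lambda>a y. \<ominus>\<^bsub>local_field y\<^esub> a y"
proof -
  fix a :: "'a place \<Rightarrow> (nat \<Rightarrow> 'a ratfun) set"
  assume *: "(\<forall>y. a y \<in> carrier (local_field y)) \<and> finite {y. a y \<notin> local_integers y}"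
  have "finite {y. \<ominus>\<^bsub>local_field y\<^esub> a y \<notin> local_integers y}"
    by (rule finite_subset[of _ "{y. a y \<notin> local_integers y}"])
       (use * local_integers_uminus in auto)
  then show "(\<forall>y. \<ominus>\<^bsub>local_field y\<^esub> a y \<in> carrier (local_field y)) \<and>
      finite {y. \<ominus>\<^bsub>local_field y\<^esub> a y \<notin> local_integers y}"
    using * cring.cring_simprules(3)[OF cring_completion] by blast
qed

definition minus_adele :: "'a adele \<Rightarrow> 'a adele \<Rightarrow> 'a adele" where
  "minus_adele a b = a + (- b)"

instance
proof
  fix a b c :: "'a adele"
  note R = cring.cring_simprules[OF cring_completion]
  note ops = plus_adele.rep_eq times_adele.rep_eq one_adele.rep_eq zero_adele.rep_eq
    uminus_adele.rep_eq
  show "a * b * c = a * (b * c)" by (rule adele_eqI) (simp add: ops R(11))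
  show "a * b = b * a" by (rule adele_eqI) (simp add: ops R(14))
  show "1 * a = a" by (rule adele_eqI) (simp add: ops R(12))
  show "a + b + c = a + (b + c)" by (rule adele_eqI) (simp add: ops R(7))
  show "a + b = b + a" by (rule adele_eqI) (simp add: ops R(10))
  show "0 + a = a" by (rule adele_eqI) (simp add: ops R(8))
  show "- a + a = 0" by (rule adele_eqI) (simp add: ops R(9))
  show "a - b = a + - b" by (rule minus_adele_def)
  show "(a + b) * c = a * c + b * c" by (rule adele_eqI) (simp add: ops R(13))
  show "(0 :: 'a adele) \<noteq> 1"
  proof
    assume "(0 :: 'a adele) = 1"
    then have "adele_at (0 :: 'a adele) place_zero = adele_at 1 place_zero" by simp
    then have "to_completion (place_zero :: 'a place) 0 = to_completion place_zero 1"
      by (simp add: ops completion_zero completion_one)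
    then have "local_abs (place_zero :: 'a place) (to_completion place_zero 0) =
        local_abs place_zero (to_completion (place_zero :: 'a place) 1)" by (rule arg_cong)
    then show False by simp
  qed
qed

end

text \<open>The restricted product topology.\<close>

instantiation adele :: ("{field,finite}") topological_space
begin

definition open_adele :: "'a adele set \<Rightarrow> bool" where
  "open_adele = generate_topology
     {{a. \<forall>y. adele_at a y \<in> U y} | U.
        (\<forall>y. local_open y (U y)) \<and> finite {y. U y \<noteq> local_integers y}}"

instance
  by standard (auto simp: open_adele_def intro: generate_topology.intros)

end

lemma finite_degree_le: "finite {p :: ('k::{field,finite}) poly. degree p \<le> n}"
proof (rule finite_subset)
  show "{p :: 'k poly. degree p \<le> n} \<subseteq> Poly ` {xs. set xs \<subseteq> UNIV \<and> length xs \<le> Suc n}"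
  proof
    fix p :: "'k poly" assume "p \<in> {p. degree p \<le> n}"
    then have "length (coeffs p) \<le> Suc n" by (cases "p = 0") (simp_all add: length_coeffs)
    then show "p \<in> Poly ` {xs. set xs \<subseteq> UNIV \<and> length xs \<le> Suc n}"
      by (intro image_eqI[of _ _ "coeffs p"]) simp_all
  qed
qed (intro finite_imageI finite_lists_length_le finite)

lemma finite_place_abs_gt_1: "finite {y. place_abs y f > 1}"
proof (cases f)
  case (Fract a b)
  let ?D = "{p. degree p \<le> degree b}"
  have "y \<in> Abs_place ` (insert None (Some ` ?D))" if y: "place_abs y f > 1" for y
  proof -
    have q: "real CARD('a) > 1" by (rule card_gt_1)
    have "Rep_place y \<in> insert None (Some ` ?D)"
    proof (cases y rule: place_cases)
      case (fin p)
      have "poly_abs y a \<le> 1"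
      proof (cases "a = 0")
        case False
        have "real CARD('a) powi (- (int (place_degree y) * place_ord y a)) \<le>
            real CARD('a) powi 0"
          using q fin by (intro power_int_increasing) (auto simp: place_ord.rep_eq)
        then show ?thesis using False by (simp add: poly_abs_def)
      qed simp
      then have "poly_abs y b < 1"
        using y Fract poly_abs_pos[of b y] by (simp add: place_abs_Fract)
      then have "place_ord y b \<noteq> 0" using Fract by (auto simp: poly_abs_def)
      then have "poly_ord p b > 0" using fin by (simp add: place_ord.rep_eq)
      then have "p dvd b"
        using poly_ord_dvd[OF fin(2) Fract(2)] by (meson dvd_power dvd_trans)
      then have "degree p \<le> degree b" using Fract(2) by (rule dvd_imp_degree_le)
      then show ?thesis using fin by simp
    qed simp
    then have "Abs_place (Rep_place y) \<in> Abs_place ` (insert None (Some ` ?D))" by (rule imageI)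
    then show ?thesis by (simp only: Rep_place_inverse)
  qed
  then have "{y. place_abs y f > 1} \<subseteq> Abs_place ` (insert None (Some ` ?D))" by blast
  then show ?thesis by (rule finite_subset) (intro finite_imageI finite.insertI finite_degree_le)
qed

text \<open>The diagonal embedding of \<open>F\<close>.\<close>

lift_definition principal_adele :: "('k::{field,finite}) ratfun \<Rightarrow> 'k adele" is
  "\<lambda>f y. to_completion y f"
  using finite_place_abs_gt_1 by (simp add: not_le)

definition integral_adeles :: "('k::{field,finite}) adele set" where
  "integral_adeles = {a. \<forall>y. adele_at a y \<in> local_integers y}"


section \<open>The adelic group\<close>

type_synonym 'k adele_mat = "'k adele ^ 2 ^ 2"

definition GL2_adeles :: "('k::{field,finite}) adele_mat set" where
  "GL2_adeles = {g. invertible g}"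

definition center_GL2 :: "('k::{field,finite}) adele_mat set" where
  "center_GL2 = {z \<in> GL2_adeles. \<forall>g\<in>GL2_adeles. z ** g = g ** z}"

definition principal_mat :: "('k::{field,finite}) ratfun ^ 2 ^ 2 \<Rightarrow> 'k adele_mat" where
  "principal_mat m = (\<chi> i j. principal_adele (m $ i $ j))"

text \<open>\<open>K\<close>: the matrices that are invertible over the ring of integral adeles.\<close>

definition K_max :: "('k::{field,finite}) adele_mat set" where
  "K_max = {g. (\<forall>i j. g $ i $ j \<in> integral_adeles) \<and>
     (\<exists>h. (\<forall>i j. h $ i $ j \<in> integral_adeles) \<and> g ** h = mat 1 \<and> h ** g = mat 1)}"

text \<open>\<open>K'\<close>: congruent to the identity modulo the uniformizer \<open>t\<close> at the place \<open>place_zero\<close>.\<close>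

definition K_prime :: "('k::{field,finite}) adele_mat set" where
  "K_prime = {k \<in> K_max. \<forall>i j. \<exists>c\<in>local_integers place_zero.
     adele_at ((k - mat 1) $ i $ j) place_zero =
       to_completion place_zero ratfun_t \<otimes>\<^bsub>local_field place_zero\<^esub> c}"

text \<open>
  A matrix over the completion at \<open>x\<close>, viewed as an adelic matrix with the identity at all
  other places.
\<close>

definition at_place ::
    "('k::{field,finite}) place \<Rightarrow> (nat \<Rightarrow> 'k ratfun) set ^ 2 ^ 2 \<Rightarrow> 'k adele_mat" where
  "at_place x m = (\<chi> i j. Abs_adele (\<lambda>y. if y = x then m $ i $ j
     else adele_at ((mat 1 :: 'k adele_mat) $ i $ j) y))"

text \<open>Coarsest topology making \<open>g\<close> and its inverse depend continuously on \<open>g\<close>.\<close>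

definition GL2_topology :: "('k::{field,finite}) adele_mat topology" where
  "GL2_topology = pullback_topology GL2_adeles (\<lambda>g. (g, matrix_inv g)) euclidean"

definition haar_measure_GL2 :: "('k::{field,finite}) adele_mat measure \<Rightarrow> bool" where
  "haar_measure_GL2 \<mu> \<longleftrightarrow>
     sets \<mu> = sets (sigma GL2_adeles {U. openin GL2_topology U}) \<and>
     (\<forall>g\<in>GL2_adeles. \<forall>A\<in>sets \<mu>. emeasure \<mu> ((\<lambda>h. g ** h) ` A) = emeasure \<mu> A) \<and>
     (\<exists>A\<in>sets \<mu>. emeasure \<mu> A \<noteq> 0) \<and>
     (\<forall>C. compactin GL2_topology C \<longrightarrow> emeasure \<mu> C < \<infinity>) \<and>
     (\<forall>A\<in>sets \<mu>. emeasure \<mu> A = (INF U\<in>{U. openin GL2_topology U \<and> A \<subseteq> U}. emeasure \<mu> U)) \<and>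
     (\<forall>U. openin GL2_topology U \<longrightarrow>
        emeasure \<mu> U = (SUP C\<in>{C. compactin GL2_topology C \<and> C \<subseteq> U}. emeasure \<mu> C))"

definition local_height :: "('k::{field,finite}) place \<Rightarrow> 'k adele_mat \<Rightarrow> real" where
  "local_height y g = Max (insert (local_abs y (inv\<^bsub>local_field y\<^esub> (adele_at (det g) y)))
     {local_abs y (adele_at (g $ i $ j) y) | i j. True})"

text \<open>All but finitely many local factors are \<open>1\<close>.\<close>

definition height :: "('k::{field,finite}) adele_mat \<Rightarrow> real" where
  "height g = (\<Prod>y\<in>{y. local_height y g \<noteq> 1}. local_height y g)"


section \<open>Automorphic functions and the Hecke operator\<close>

text \<open>
  Functions on the adelic group are functions on all adelic matrices that vanish outside
  \<open>GL2_adeles\<close>.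
\<close>

definition automorphic_K_prime :: "(('k::{field,finite}) adele_mat \<Rightarrow> complex) set" where
  "automorphic_K_prime = {f.
     (\<forall>g. g \<notin> GL2_adeles \<longrightarrow> f g = 0) \<and>
     (\<forall>m. invertible m \<longrightarrow> (\<forall>g\<in>GL2_adeles. f (principal_mat m ** g) = f g)) \<and>
     (\<forall>z\<in>center_GL2. \<forall>g\<in>GL2_adeles. f (z ** g) = f g) \<and>
     (\<forall>k\<in>K_prime. \<forall>g\<in>GL2_adeles. f (g ** k) = f g) \<and>
     (\<exists>C N :: real. \<forall>g\<in>GL2_adeles. cmod (f g) \<le> C * height g powr N)}"

definition hecke_double_coset :: "('k::{field,finite}) adele_mat set" where
  "hecke_double_coset = {k1 ** at_place place_zero
     (vector [vector [to_completion place_zero ratfun_t, to_completion place_zero 0],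
              vector [to_completion place_zero 0, to_completion place_zero 1]]) ** k2 |
     k1 k2. k1 \<in> K_prime \<and> k2 \<in> K_prime}"

definition hecke_kernel ::
    "('k::{field,finite}) adele_mat measure \<Rightarrow> 'k adele_mat \<Rightarrow> complex" where
  "hecke_kernel \<mu> h =
     of_real (indicat_real hecke_double_coset h / measure \<mu> K_prime)"

definition hecke_operator ::
    "('k::{field,finite}) adele_mat measure \<Rightarrow> ('k adele_mat \<Rightarrow> complex) \<Rightarrow>
     'k adele_mat \<Rightarrow> complex" where
  "hecke_operator \<mu> f g =
     (if g \<in> GL2_adeles then LINT h|\<mu>. hecke_kernel \<mu> h * f (g ** h) else 0)"

definition fun_scale :: "complex \<Rightarrow> ('a \<Rightarrow> complex) \<Rightarrow> 'a \<Rightarrow> complex" where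
  "fun_scale c f = (\<lambda>g. c * f g)"

lemma vector_space_fun_scale: "vector_space fun_scale"
  by unfold_locales (auto simp: fun_scale_def algebra_simps)

definition hecke_eigenspace ::
    "('k::{field,finite}) adele_mat measure \<Rightarrow> complex \<Rightarrow> ('k adele_mat \<Rightarrow> complex) set" where
  "hecke_eigenspace \<mu> l = {f \<in> automorphic_K_prime. hecke_operator \<mu> f = fun_scale l f}"

end

theory Submission
  imports Defs "HOL-Library.Groups_Big_Fun"
begin

text \<open>
  The double cosets on which automorphic functions live classify rank two vector bundles on the projective
  line, up to twists by line bundles, with a trivialization of the fibre at the place \<open>x\<close> of
  \<open>t\<close> up to scalars. Each bundle is \<open>O + O(n)\<close> up to a twist, for a unique \<open>n
  \<ge> 0\<close>. For \<open>n > 0\<close> its subbundle of maximal degree marks a line in the fibre at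
  \<open>x\<close>, that is, a point of the projective line over the field with \<open>q\<close> elements; for
  \<open>n = 0\<close> there is only the class of the identity.

  All this is expressed by vectors: \<open>destabilizes n v g\<close> says that \<open>v\<close> spans such a
  subbundle, and \<open>flagged v g\<close> that the marked point is \<open>(1 : 0)\<close>. Such a vector
  exists by the reduction theory of \<open>GL\<^sub>2\<close> (\<open>reduction\<close>, from class number one
  and strong approximation), and \<open>n\<close> is determined because two independent rows \<open>v
  g\<close> and \<open>w g\<close> cannot both be short (\<open>destabilizes_unique\<close>, a consequence of
  the product formula).

  The Hecke operator is \<open>f \<mapsto> (\<Sum>b. f (g ** hecke_rep b))\<close> with \<open>q\<close>
  summands (\<open>hecke_operator_eq_sum\<close>). From an unflagged vertex with invariant \<open>n >
  0\<close> all summands lead to vertices with invariant \<open>n - 1\<close>, unflagged if \<open>n >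
  1\<close>. From a flagged vertex with invariant \<open>n\<close>, and from the class of the identity with
  \<open>n = 0\<close>, one summand leads to a flagged vertex and \<open>q - 1\<close> summands lead to
  unflagged vertices, all with invariant \<open>n + 1\<close>. Writing \<open>A n\<close> and \<open>B
  n\<close> for the values of an eigenfunction at unflagged and flagged vertices, the eigenvalue equation
  becomes \<open>l A (n + 1) = q A n\<close> and \<open>l B n = B (n + 1) + (q - 1) A (n + 1)\<close> with
  \<open>A 0 = B 0\<close>. For \<open>l \<noteq> 0\<close> this determines all values from the one at the
  identity, and conversely defines an eigenfunction for each value. It has moderate growth since its values
  are at most exponential in \<open>n\<close>, while \<open>q ^ n\<close> is at most the third power of the
  height (\<open>destabilizes_le_height\<close>).
\<close>


section \<open>Absolute values on the adele ring\<close>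

lemma place_abs_inverse: "place_abs y (inverse f) = inverse (place_abs y f)"
proof (cases "f = 0")
  case False
  then have "place_abs y f * place_abs y (inverse f) = 1"
    by (simp flip: place_abs_mult)
  then show ?thesis by (simp add: inverse_unique)
qed simp

lemma place_abs_divide: "place_abs y (f / g) = place_abs y f / place_abs y g"
  by (simp add: divide_inverse place_abs_mult place_abs_inverse)

lemma place_abs_power: "place_abs y (f ^ n) = place_abs y f ^ n"
  by (induction n) (simp_all add: place_abs_mult)

lemma place_abs_pos: "f \<noteq> 0 \<Longrightarrow> place_abs y f > 0"
  by (simp add: less_le)

lemma coset_eqI:
  assumes "(\<lambda>n. s n - r n) \<in> null_seqs y"
  shows "null_seqs y +>\<^bsub>cauchy_ring y\<^esub> s = null_seqs y +>\<^bsub>cauchy_ring y\<^esub> r"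
proof (rule Set.set_eqI)
  fix u
  show "u \<in> null_seqs y +>\<^bsub>cauchy_ring y\<^esub> s \<longleftrightarrow> u \<in> null_seqs y +>\<^bsub>cauchy_ring y\<^esub> r"
    unfolding mem_coset_iff
    using null_seqs_add[OF _ assms, of "\<lambda>n. u n - s n"]
      null_seqs_add[OF _ null_seqs_uminus[OF assms], of "\<lambda>n. u n - r n"]
    by auto
qed

lemma null_seqs_eventually_0:
  assumes "eventually (\<lambda>n. s n = 0) sequentially"
  shows "s \<in> null_seqs y"
proof -
  have "eventually (\<lambda>n. place_abs y (s n) = 0) sequentially"
    using assms by eventually_elim simp
  then show ?thesis unfolding null_seqs_def by (simp add: tendsto_eventually)
qed

lemma local_abs_nonneg: "c \<in> carrier (local_field y) \<Longrightarrow> local_abs y c \<ge> 0"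
  by (metis completion_cases LIMSEQ_le_const local_abs_tendsto place_abs_nonneg)

text \<open>
  The termwise inverse of a Cauchy sequence with nonzero limit norm is again Cauchy, because its terms are
  eventually bounded away from zero. So the completion is a field.
\<close>

lemma local_field_inverse:
  assumes "c \<in> carrier (local_field y)" "local_abs y c \<noteq> 0"
  obtains d where "d \<in> carrier (local_field y)" "c \<otimes>\<^bsub>local_field y\<^esub> d = \<one>\<^bsub>local_field y\<^esub>"
proof -
  obtain s where s: "cauchy_at y s" "c = null_seqs y +>\<^bsub>cauchy_ring y\<^esub> s"
    using completion_cases[OF assms(1)] .
  define l where "l = local_abs y c"
  have l: "l > 0" using assms local_abs_nonneg[of c y] by (simp add: l_def)
  have "eventually (\<lambda>n. place_abs y (s n) > l / 2) sequentially"
    using local_abs_tendsto[OF s(1)] l s(2) l_def by (intro order_tendstoD(1)) auto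
  then obtain N where N: "\<And>n. n \<ge> N \<Longrightarrow> place_abs y (s n) > l / 2"
    unfolding eventually_sequentially by blast
  have s0: "s n \<noteq> 0" if "n \<ge> N" for n using N[OF that] l by auto
  have r: "cauchy_at y (\<lambda>n. inverse (s n))"
    unfolding cauchy_at_def
  proof (intro allI impI)
    fix e :: real assume e: "e > 0"
    then have "e * (l / 2 * (l / 2)) > 0" using l by simp
    then obtain M where M: "\<And>m n. m \<ge> M \<Longrightarrow> n \<ge> M \<Longrightarrow> place_abs y (s m - s n) < e * (l / 2 * (l / 2))"
      using s(1) unfolding cauchy_at_def by blast
    have "place_abs y (inverse (s m) - inverse (s n)) < e" if mn: "m \<ge> max M N" "n \<ge> max M N" for m n
    proof -
      have "inverse (s m) - inverse (s n) = (s n - s m) / (s m * s n)"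
        using s0[of m] s0[of n] mn by (simp add: field_simps)
      then have "place_abs y (inverse (s m) - inverse (s n)) =
          place_abs y (s n - s m) / (place_abs y (s m) * place_abs y (s n))"
        by (simp add: place_abs_divide place_abs_mult)
      also have "\<dots> \<le> place_abs y (s n - s m) / (l / 2 * (l / 2))"
        using N[of m] N[of n] mn l by (intro divide_left_mono mult_mono) (auto intro!: mult_pos_pos)
      also have "\<dots> < e" using M[of n m] mn l by (simp add: field_simps)
      finally show ?thesis .
    qed
    then show "\<exists>N. \<forall>m\<ge>N. \<forall>n\<ge>N. place_abs y (inverse (s m) - inverse (s n)) < e" by blast
  qed
  have "eventually (\<lambda>n. s n * inverse (s n) - 1 = 0) sequentially"
    unfolding eventually_sequentially using s0 by (auto intro!: exI[of _ N])
  then have "null_seqs y +>\<^bsub>cauchy_ring y\<^esub> (\<lambda>n. s n * inverse (s n)) = \<one>\<^bsub>local_field y\<^esub>"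
    unfolding completion_one to_completion_def by (intro coset_eqI null_seqs_eventually_0)
  then show ?thesis
    using that[OF coset_in_completion[OF r]] s completion_hom(1)[OF s(1) r] by simp
qed

text \<open>
  Working with the family of norms \<open>adele_norm y\<close> on the commutative ring of adeles replaces all
  arithmetic in the individual completions.
\<close>

definition adele_norm :: "('k::{field,finite}) place \<Rightarrow> 'k adele \<Rightarrow> real" where
  "adele_norm y a = local_abs y (adele_at a y)"

lemma adele_norm_nonneg [simp]: "adele_norm y a \<ge> 0"
  by (simp add: adele_norm_def local_abs_nonneg)

lemma adele_norm_principal [simp]: "adele_norm y (principal_adele f) = place_abs y f"
  by (simp add: adele_norm_def principal_adele.rep_eq)

lemma principal_adele_simps [simp]:
  "principal_adele 0 = 0" "principal_adele 1 = 1"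
  "principal_adele (f + g) = principal_adele f + principal_adele g"
  "principal_adele (f * g) = principal_adele f * principal_adele g"
  by (auto intro!: adele_eqI simp: principal_adele.rep_eq zero_adele.rep_eq one_adele.rep_eq
      plus_adele.rep_eq times_adele.rep_eq completion_zero completion_one to_completion_hom)

lemma principal_adele_uminus [simp]: "principal_adele (- f) = - principal_adele f"
  using principal_adele_simps(3)[of "- f" f] by (simp add: eq_neg_iff_add_eq_0 del: principal_adele_simps(3))

lemma principal_adele_diff [simp]: "principal_adele (f - g) = principal_adele f - principal_adele g"
  using principal_adele_simps(3)[of f "- g"] by simp

lemma adele_norm_mult: "adele_norm y (a * b) = adele_norm y a * adele_norm y b"
  by (simp add: adele_norm_def times_adele.rep_eq local_abs_mult)

lemma adele_norm_add: "adele_norm y (a + b) \<le> max (adele_norm y a) (adele_norm y b)"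
  by (simp add: adele_norm_def plus_adele.rep_eq local_abs_add)

lemma adele_norm_0 [simp]: "adele_norm y 0 = 0"
  using adele_norm_principal[of y 0] by simp

lemma adele_norm_1 [simp]: "adele_norm y 1 = 1"
  using adele_norm_principal[of y 1] by simp

lemma adele_norm_uminus [simp]: "adele_norm y (- a) = adele_norm y a"
  using adele_norm_mult[of y "principal_adele (- 1)" a] adele_norm_principal[of y "- 1"] by simp

lemma adele_norm_diff: "adele_norm y (a - b) \<le> max (adele_norm y a) (adele_norm y b)"
  using adele_norm_add[of y a "- b"] by simp

lemma adele_norm_diff_commute: "adele_norm y (a - b) = adele_norm y (b - a)"
  using adele_norm_uminus[of y "a - b"] by simp

lemma adele_norm_add_le: "adele_norm y a \<le> r \<Longrightarrow> adele_norm y b \<le> r \<Longrightarrow> adele_norm y (a + b) \<le> r"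
  using adele_norm_add[of y a b] by linarith

lemma adele_norm_diff_le: "adele_norm y a \<le> r \<Longrightarrow> adele_norm y b \<le> r \<Longrightarrow> adele_norm y (a - b) \<le> r"
  using adele_norm_diff[of y a b] by linarith

lemma adele_norm_add_less: "adele_norm y a < r \<Longrightarrow> adele_norm y b < r \<Longrightarrow> adele_norm y (a + b) < r"
  using adele_norm_add[of y a b] by linarith

lemma adele_norm_diff_less: "adele_norm y a < r \<Longrightarrow> adele_norm y b < r \<Longrightarrow> adele_norm y (a - b) < r"
  using adele_norm_diff[of y a b] by linarith

lemma adele_norm_mult_le: "adele_norm y a \<le> 1 \<Longrightarrow> adele_norm y b \<le> 1 \<Longrightarrow> adele_norm y (a * b) \<le> 1"
  by (simp add: adele_norm_mult mult_le_one)

text \<open>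
  Otherwise \<open>a = (a + b) - b\<close> would have a norm below that of \<open>a\<close>.
\<close>

lemma adele_norm_add_dominant:
  assumes "adele_norm y b < adele_norm y a"
  shows "adele_norm y (a + b) = adele_norm y a"
  using assms adele_norm_add[of y a b] adele_norm_diff[of y "a + b" b] by simp

lemma adele_norm_eqI_close:
  assumes "adele_norm y (a - b) < adele_norm y b"
  shows "adele_norm y a = adele_norm y b"
  using adele_norm_add_dominant[OF assms] by simp

lemma integral_adeles_iff: "a \<in> integral_adeles \<longleftrightarrow> (\<forall>y. adele_norm y a \<le> 1)"
  by (simp add: integral_adeles_def local_integers_def adele_norm_def)

lemma finite_adele_norm_gt_1: "finite {y. adele_norm y a > 1}"
proof -
  have "{y. adele_norm y a > 1} = {y. adele_at a y \<notin> local_integers y}"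
    by (auto simp: local_integers_def adele_norm_def)
  then show ?thesis using adele_at[of a] by simp
qed

lemma adele_dense:
  assumes "e > 0"
  obtains f where "adele_norm y (a - principal_adele f) < e"
proof -
  obtain s where s: "cauchy_at y s" "adele_at a y = null_seqs y +>\<^bsub>cauchy_ring y\<^esub> s"
    using completion_cases[OF adele_at_closed[of a y]] .
  obtain N where N: "\<And>m n. m \<ge> N \<Longrightarrow> n \<ge> N \<Longrightarrow> place_abs y (s m - s n) < e / 2"
    using s(1) assms unfolding cauchy_at_def by (meson half_gt_zero)
  let ?r = "\<lambda>n. s n + - s N"
  have r: "cauchy_at y ?r" using s(1) by (rule cauchy_at_add) simp
  have "adele_at (a + principal_adele (- s N)) y = null_seqs y +>\<^bsub>cauchy_ring y\<^esub> ?r"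
    unfolding plus_adele.rep_eq principal_adele.rep_eq s(2) to_completion_def
    by (rule completion_hom(2)[OF s(1) cauchy_at_const])
  then have "adele_norm y (a - principal_adele (s N)) = local_abs y (null_seqs y +>\<^bsub>cauchy_ring y\<^esub> ?r)"
    by (simp add: adele_norm_def)
  also have "\<dots> \<le> e / 2"
    by (rule LIMSEQ_le_const2[OF local_abs_tendsto[OF r]])
       (use N in \<open>auto intro!: exI[of _ N] less_imp_le\<close>)
  finally show ?thesis using assms by (intro that[of "s N"]) simp
qed

text \<open>
  Completing does not enlarge the value group: an element of \<open>F\<close> that is closer to
  \<open>a\<close> than the size of \<open>a\<close> has the norm of \<open>a\<close>.
\<close>

lemma adele_norm_value:
  assumes "adele_norm y a \<noteq> 0"
  obtains f where "f \<noteq> 0" "adele_norm y a = place_abs y f"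
proof -
  have "adele_norm y a > 0" using assms by (simp add: less_le)
  then obtain f where f: "adele_norm y (a - principal_adele f) < adele_norm y a"
    by (rule adele_dense)
  then have "adele_norm y (principal_adele f) = adele_norm y a"
    by (intro adele_norm_eqI_close) (simp add: adele_norm_diff_commute)
  then show ?thesis using assms by (intro that[of f]) auto
qed

text \<open>
  Gluing along a set of places allows choices that depend on the place, such as which entry of a row to divide
  by, without leaving the ring of adeles.
\<close>

definition mix_adele :: "('k::{field,finite}) place set \<Rightarrow> 'k adele \<Rightarrow> 'k adele \<Rightarrow> 'k adele" where
  "mix_adele S a b = Abs_adele (\<lambda>y. if y \<in> S then adele_at a y else adele_at b y)"

lemma adele_at_mix: "adele_at (mix_adele S a b) = (\<lambda>y. if y \<in> S then adele_at a y else adele_at b y)"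
proof -
  have "finite {y. (if y \<in> S then adele_at a y else adele_at b y) \<notin> local_integers y}"
    by (rule finite_subset[of _ "{y. adele_at a y \<notin> local_integers y} \<union> {y. adele_at b y \<notin> local_integers y}"])
       (use adele_at[of a] adele_at[of b] in auto)
  then show ?thesis unfolding mix_adele_def by (intro Abs_adele_inverse) auto
qed

lemma adele_norm_mix:
  "adele_norm y (mix_adele S a b) = (if y \<in> S then adele_norm y a else adele_norm y b)"
  by (simp add: adele_norm_def adele_at_mix)

lemma mix_adele_mult: "mix_adele S a b * mix_adele S c d = mix_adele S (a * c) (b * d)"
  by (rule adele_eqI) (simp add: adele_at_mix times_adele.rep_eq)

lemma mix_adele_add: "mix_adele S a b + mix_adele S c d = mix_adele S (a + c) (b + d)"
  by (rule adele_eqI) (simp add: adele_at_mix plus_adele.rep_eq)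

lemma mix_adele_uminus: "- mix_adele S a b = mix_adele S (- a) (- b)"
  by (rule adele_eqI) (simp add: adele_at_mix uminus_adele.rep_eq)

lemma mix_adele_diff: "mix_adele S a b - mix_adele S c d = mix_adele S (a - c) (b - d)"
  using mix_adele_add[of S a b "- c" "- d"] by (simp flip: mix_adele_uminus)

lemma mix_adele_same [simp]: "mix_adele S a a = a"
  by (rule adele_eqI) (simp add: adele_at_mix)

text \<open>
  The local inverses form an adele because they are integral wherever \<open>a\<close> has norm
  \<open>1\<close>.
\<close>

lemma adele_inverse:
  assumes "\<And>y. adele_norm y a \<noteq> 0" "finite {y. adele_norm y a \<noteq> 1}"
  obtains b where "a * b = 1"
proof -
  have "\<exists>d. d \<in> carrier (local_field y) \<and> adele_at a y \<otimes>\<^bsub>local_field y\<^esub> d = \<one>\<^bsub>local_field y\<^esub>" for y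
    using assms(1)[of y] local_field_inverse[OF adele_at_closed[of a y]] unfolding adele_norm_def by metis
  then obtain d where d: "\<And>y. d y \<in> carrier (local_field y)"
      "\<And>y. adele_at a y \<otimes>\<^bsub>local_field y\<^esub> d y = \<one>\<^bsub>local_field y\<^esub>" by metis
  have n: "adele_norm y a * local_abs y (d y) = 1" for y
    using local_abs_mult[OF adele_at_closed[of a y] d(1)] d(2)[of y]
    by (simp add: adele_norm_def completion_one)
  have "{y. d y \<notin> local_integers y} \<subseteq> {y. adele_norm y a \<noteq> 1}"
  proof safe
    fix y assume "d y \<notin> local_integers y" "adele_norm y a = 1"
    then show False using n[of y] d(1)[of y] by (simp add: local_integers_def)
  qed
  then have "finite {y. d y \<notin> local_integers y}" using assms(2) by (rule finite_subset)
  then have *: "adele_at (Abs_adele d) = d" using d(1) by (intro Abs_adele_inverse) auto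
  have "a * Abs_adele d = 1"
    by (rule adele_eqI) (simp add: times_adele.rep_eq one_adele.rep_eq * d(2))
  then show ?thesis by (rule that)
qed

lemma adele_unit_norm:
  assumes "a dvd 1"
  shows "adele_norm y a > 0" "finite {y. adele_norm y a \<noteq> 1}"
proof -
  obtain b where "a * b = 1" using assms by (auto elim: dvdE)
  then have n: "adele_norm y a * adele_norm y b = 1" for y
    by (simp flip: adele_norm_mult)
  have "adele_norm y a \<noteq> 0" using n[of y] by auto
  then show "adele_norm y a > 0" by (simp add: less_le)
  have "y \<in> {y. adele_norm y a > 1} \<union> {y. adele_norm y b > 1}" if "adele_norm y a \<noteq> 1" for y
  proof (rule ccontr)
    assume "\<not> ?thesis"
    then have *: "adele_norm y a < 1" "adele_norm y b \<le> 1" using that by auto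
    have "adele_norm y a * adele_norm y b \<le> adele_norm y a * 1"
      using * by (intro mult_left_mono) auto
    then show False using n[of y] * by linarith
  qed
  then have "{y. adele_norm y a \<noteq> 1} \<subseteq> {y. adele_norm y a > 1} \<union> {y. adele_norm y b > 1}" by blast
  then show "finite {y. adele_norm y a \<noteq> 1}"
    by (rule finite_subset) (simp add: finite_adele_norm_gt_1)
qed

lemma adele_unit_iff: "a dvd 1 \<longleftrightarrow> (\<forall>y. adele_norm y a \<noteq> 0) \<and> finite {y. adele_norm y a \<noteq> 1}"
  by (metis adele_inverse adele_unit_norm dvd_triv_left less_irrefl)


section \<open>The product formula for the projective line\<close>

lemma monic_irreducible_factor:
  fixes a :: "'k::field poly"
  assumes "degree a > 0"
  obtains p where "irreducible p" "lead_coeff p = 1" "p dvd a"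
proof -
  let ?P = "\<lambda>p. degree p > 0 \<and> p dvd a"
  obtain r where r: "?P r" and min: "\<And>s. ?P s \<Longrightarrow> degree r \<le> degree s"
    using ex_has_least_nat[of ?P a degree] assms by auto
  define p where "p = smult (inverse (lead_coeff r)) r"
  have u: "inverse (lead_coeff r) \<noteq> 0" using r by auto
  have p: "degree p = degree r" "p dvd a" "lead_coeff p = 1" "p \<noteq> 0"
    using r u by (auto simp: p_def smult_dvd_iff)
  have "irreducible p"
  proof (rule irreducibleI)
    show "p \<noteq> 0" by (rule p)
    show "\<not> p dvd 1" using p r by (auto simp: is_unit_iff_degree)
    fix b c assume bc: "p = b * c"
    then have nz: "b \<noteq> 0" "c \<noteq> 0" using p by auto
    have d: "degree p = degree b + degree c" using bc nz by (simp add: degree_mult_eq)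
    show "b dvd 1 \<or> c dvd 1"
    proof (cases "degree b > 0")
      case True
      have "b dvd a" using p bc by (auto intro: dvd_mult_left)
      with True have "degree p \<le> degree b" unfolding p(1) by (intro min) simp
      with d nz show ?thesis by (simp add: is_unit_iff_degree)
    qed (use nz in \<open>simp add: is_unit_iff_degree\<close>)
  qed
  with p show ?thesis by (intro that)
qed

text \<open>
  A nonzero element of least degree in the ideal \<open>(p, m)\<close> divides both generators, hence is a
  unit.
\<close>

lemma irreducible_bezout:
  fixes p m :: "'k::field poly"
  assumes p: "irreducible p" and m: "\<not> p dvd m"
  obtains u v where "u * p + v * m = 1"
proof -
  let ?P = "\<lambda>d. d \<noteq> 0 \<and> (\<exists>u v. d = u * p + v * m)"
  have "\<exists>u v. p = u * p + v * m" by (rule exI[of _ 1], rule exI[of _ 0]) simp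
  moreover have "p \<noteq> 0" using p by auto
  ultimately have "?P p" by simp
  then obtain d where d: "?P d" and min: "\<And>s. ?P s \<Longrightarrow> degree d \<le> degree s"
    using ex_has_least_nat[of ?P p degree] by auto
  obtain u v where uv: "d = u * p + v * m" using d by auto
  have dvd: "d dvd w" if "w = a * p + b * m" for w a b
  proof -
    have "w mod d = w - w div d * d" by (simp add: minus_div_mult_eq_mod)
    also have "\<dots> = (a - w div d * u) * p + (b - w div d * v) * m"
      unfolding that by (subst (2) uv) (simp add: algebra_simps)
    finally have "w mod d = 0 \<or> ?P (w mod d)" by blast
    moreover have "w mod d = 0 \<or> degree (w mod d) < degree d"
      using degree_mod_less[of d w] d by blast
    ultimately have "w mod d = 0" using min[of "w mod d"] by (meson leD)
    then show ?thesis by (simp add: dvd_eq_mod_eq_0)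
  qed
  have dp: "d dvd p" by (rule dvd[of _ 1 0]) simp
  have dm: "d dvd m" by (rule dvd[of _ 0 1]) simp
  have "d dvd 1"
  proof (rule ccontr)
    assume nu: "\<not> d dvd 1"
    obtain c where c: "p = d * c" using dp by (elim dvdE)
    then have "c dvd 1" using p nu by (auto dest: irreducibleD)
    then obtain c' where "c * c' = 1" by (metis dvdE)
    then have "d = p * c'" using c by (simp add: mult.assoc)
    then show False using dm m by (metis dvd_mult_left)
  qed
  then obtain e where "1 = d * e" by (elim dvdE)
  then have "(e * u) * p + (e * v) * m = 1" unfolding uv by (simp add: algebra_simps)
  then show ?thesis by (rule that)
qed

lemma irreducible_power_bezout:
  fixes p m :: "'k::field poly"
  assumes p: "irreducible p" and m: "\<not> p dvd m"
  shows "\<exists>u v. u * p ^ k + v * m = 1"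
proof (induction k)
  case 0
  show ?case by (rule exI[of _ 1], rule exI[of _ 0]) simp
next
  case (Suc k)
  then obtain u v where uv: "u * p ^ k + v * m = 1" by blast
  obtain u' v' where uv': "u' * p + v' * m = 1" using irreducible_bezout[OF assms] .
  have "1 = (u * p ^ k + v * m) * (u' * p + v' * m)" by (simp add: uv uv')
  also have "\<dots> = (u * u') * p ^ Suc k + (u * p ^ k * v' + v * u' * p + v * m * v') * m"
    by (simp add: algebra_simps)
  finally show ?case by metis
qed

lemma poly_abs_1 [simp]: "poly_abs y 1 = 1"
proof -
  have "poly_abs y 1 * poly_abs y 1 = 1 * poly_abs y 1" by (simp flip: poly_abs_mult)
  then show ?thesis using poly_abs_pos[of 1 y] by simp
qed

lemma place_abs_poly [simp]: "place_abs y (Fract a 1) = poly_abs y a"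
  by (simp add: place_abs_Fract)

lemma poly_abs_infinite:
  assumes "Rep_place y = None" "a \<noteq> 0"
  shows "poly_abs y a = real CARD('k) ^ degree (a :: 'k::{field,finite} poly)"
  using assms by (simp add: poly_abs_def place_ord.rep_eq place_degree.rep_eq)

lemma poly_abs_finite:
  assumes "Rep_place y = Some p" "a \<noteq> 0"
  shows "poly_abs y a = inverse (real CARD('k) ^ (degree p * poly_ord p (a :: 'k::{field,finite} poly)))"
  using assms by (simp add: poly_abs_def place_ord.rep_eq place_degree.rep_eq power_int_minus
      flip: of_nat_mult)

lemma Rep_place_SomeD: "Rep_place y = Some p \<Longrightarrow> irreducible p \<and> lead_coeff p = 1"
  using Rep_place[of y] by auto

lemma poly_abs_finite_le_1:
  assumes "Rep_place y = Some p"
  shows "poly_abs y a \<le> 1"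
proof (cases "a = 0")
  case False
  then show ?thesis using poly_abs_finite[OF assms False] card_gt_1[where 'k='a]
    by (simp add: inverse_le_1_iff)
qed simp

lemma poly_abs_finite_eq_1_iff:
  assumes "Rep_place y = Some p"
  shows "poly_abs y a = 1 \<longleftrightarrow> \<not> p dvd a"
proof (cases "a = 0")
  case False
  note p = Rep_place_SomeD[OF assms]
  have "poly_abs y a = 1 \<longleftrightarrow> degree p * poly_ord p a = 0"
    using poly_abs_finite[OF assms False] card_gt_1[where 'k='a]
    by (metis inverse_1 inverse_inverse_eq less_numeral_extra(4) one_less_power power_0 gr0I)
  also have "\<dots> \<longleftrightarrow> poly_ord p a = 0" using degree_irreducible_pos[of p] p by simp
  also have "\<dots> \<longleftrightarrow> \<not> p dvd a"
  proof
    assume "poly_ord p a = 0"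
    then show "\<not> p dvd a" using poly_ord_ge[of p a 1] p False by auto
  next
    assume "\<not> p dvd a"
    then show "poly_ord p a = 0" using p by (intro poly_ord_unique[of p a 0 a]) auto
  qed
  finally show ?thesis .
qed simp

lemma poly_abs_const:
  assumes "c \<noteq> 0"
  shows "poly_abs y [:c:] = 1"
proof (cases y rule: place_cases)
  case (fin p)
  have "\<not> p dvd [:c:]"
    using dvd_imp_degree_le[of p "[:c:]"] degree_irreducible_pos[of p] fin assms by auto
  then show ?thesis using poly_abs_finite_eq_1_iff[OF fin(1)] by simp
qed (use assms in \<open>simp add: poly_abs_infinite\<close>)

lemma monic_irreducible_dvd_imp_eq:
  fixes p r :: "'k::field poly"
  assumes "irreducible p" "irreducible r" "lead_coeff p = 1" "lead_coeff r = 1" "r dvd p"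
  shows "r = p"
proof -
  obtain c where c: "p = r * c" using assms by (elim dvdE)
  then have "c dvd 1" using assms irreducibleD[OF assms(1) c] by (auto simp: irreducible_def)
  then obtain d where "c = [:d:]" by (metis is_unit_poly_iff)
  then have pd: "p = smult d r" using c by simp
  then have "d \<noteq> 0" using assms(1) by auto
  then have "lead_coeff p = d * lead_coeff r" unfolding pd by simp
  then have "d = 1" using assms(3,4) by simp
  then show ?thesis using pd by simp
qed

lemma poly_abs_irreducible:
  assumes p: "irreducible p" "lead_coeff p = 1"
  shows "poly_abs y p = (case Rep_place y of None \<Rightarrow> real CARD('k) ^ degree p
     | Some r \<Rightarrow> if r = p then inverse (real CARD('k) ^ degree (p :: 'k::{field,finite} poly)) else 1)"
proof (cases y rule: place_cases)
  case (fin r)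
  show ?thesis
  proof (cases "r = p")
    case True
    have "poly_ord p p = 1" using p irreducible_not_unit[of p] by (intro poly_ord_unique[of p p 1 1]) auto
    moreover have "p \<noteq> 0" using p by auto
    ultimately show ?thesis using True fin poly_abs_finite[OF fin(1), of p] by simp
  next
    case False
    then have "\<not> r dvd p" using monic_irreducible_dvd_imp_eq[of p r] p fin by auto
    then show ?thesis using False fin poly_abs_finite_eq_1_iff[OF fin(1)] by auto
  qed
next
  case inf
  moreover have "p \<noteq> 0" using p by auto
  ultimately show ?thesis by (simp add: poly_abs_infinite)
qed

text \<open>
  Only the place of \<open>p\<close> and the infinite place see a monic irreducible \<open>p\<close>, with the
  values \<open>q ^ - degree p\<close> and \<open>q ^ degree p\<close>; the formula follows by factorization.
\<close>

lemma poly_product_formula: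
  assumes "a \<noteq> 0"
  shows "finite {y. poly_abs y a \<noteq> 1} \<and> (\<Prod>y. poly_abs y a) = 1"
  using assms
proof (induction "degree a" arbitrary: a rule: less_induct)
  case less
  show ?case
  proof (cases "degree a = 0")
    case True
    then obtain c where "a = [:c:]" by (rule degree_eq_zeroE)
    then have "poly_abs y a = 1" for y using less.prems by (simp add: poly_abs_const)
    then show ?thesis by simp
  next
    case False
    then have "degree a > 0" by simp
    then obtain p where p: "irreducible p" "lead_coeff p = 1" "p dvd a"
      by (rule monic_irreducible_factor)
    then obtain b where b: "a = p * b" by (elim dvdE)
    have nz: "b \<noteq> 0" "p \<noteq> 0" using b less.prems by auto
    have "degree b < degree a"
      using b nz degree_irreducible_pos[OF p(1)] by (simp add: degree_mult_eq)
    from less.hyps[OF this nz(1)] have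
      IH: "finite {y. poly_abs y b \<noteq> 1}" "(\<Prod>y. poly_abs y b) = 1" by auto
    let ?y = "Abs_place (Some p)" and ?i = "Abs_place None"
    have R: "Rep_place ?y = Some p" "Rep_place ?i = None"
      using p by (auto simp: Abs_place_inverse)
    have ne: "?y \<noteq> ?i" using R by (metis option.distinct(1))
    have sub: "{y. poly_abs y p \<noteq> 1} \<subseteq> {?y, ?i}"
    proof
      fix y assume "y \<in> {y. poly_abs y p \<noteq> 1}"
      then have "Rep_place y = Some p \<or> Rep_place y = None"
        by (auto simp: poly_abs_irreducible[OF p(1,2)] split: option.splits if_splits)
      then show "y \<in> {?y, ?i}" by (metis Rep_place_inverse insertCI)
    qed
    then have fin: "finite {y. poly_abs y p \<noteq> 1}" by (rule finite_subset) simp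
    have "(\<Prod>y. poly_abs y p) = (\<Prod>y\<in>{?y, ?i}. poly_abs y p)"
      using sub by (intro Prod_any.expand_superset) auto
    also have "\<dots> = 1"
      using ne card_gt_1[where 'k='a] by (simp add: poly_abs_irreducible[OF p(1,2)] R)
    finally have "(\<Prod>y. poly_abs y p) = 1" .
    moreover have "{y. poly_abs y a \<noteq> 1} \<subseteq> {y. poly_abs y p \<noteq> 1} \<union> {y. poly_abs y b \<noteq> 1}"
      by (auto simp: b poly_abs_mult)
    then have "finite {y. poly_abs y a \<noteq> 1}" by (rule finite_subset) (use fin IH in auto)
    ultimately show ?thesis using Prod_any.distrib[OF fin IH(1)] IH(2) by (simp add: b poly_abs_mult)
  qed
qed

lemma place_abs_product_formula:
  assumes "f \<noteq> 0"
  shows "finite {y. place_abs y f \<noteq> 1}" and "(\<Prod>y. place_abs y f) = 1"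
proof -
  obtain a b where f: "f = Fract a b" "b \<noteq> 0" by (cases f)
  have a: "a \<noteq> 0" using f assms by (auto simp: Zero_fract_def eq_fract)
  have b: "poly_abs y b > 0" for y using f by (simp add: poly_abs_pos)
  note A = poly_product_formula[OF a] and B = poly_product_formula[OF f(2)]
  have "{y. place_abs y f \<noteq> 1} \<subseteq> {y. poly_abs y a \<noteq> 1} \<union> {y. poly_abs y b \<noteq> 1}"
    by (auto simp: f place_abs_Fract)
  then show fin: "finite {y. place_abs y f \<noteq> 1}" by (rule finite_subset) (use A B in auto)
  have "poly_abs y a = place_abs y f * poly_abs y b" for y
    using b[of y] by (simp add: f place_abs_Fract)
  then have "(\<Prod>y. poly_abs y a) = (\<Prod>y. place_abs y f) * (\<Prod>y. poly_abs y b)"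
    using Prod_any.distrib[OF fin, of "\<lambda>y. poly_abs y b"] B by simp
  then show "(\<Prod>y. place_abs y f) = 1" using A B by simp
qed


section \<open>Class number one and strong approximation away from the place x\<close>

definition ratfun_const :: "'k::{field,finite} \<Rightarrow> 'k ratfun" where
  "ratfun_const c = Fract [:c:] 1"

lemma ratfun_const_simps [simp]:
  "ratfun_const 0 = 0" "ratfun_const 1 = 1"
  "ratfun_const (b + c) = ratfun_const b + ratfun_const c"
  "ratfun_const (b * c) = ratfun_const b * ratfun_const c"
  "ratfun_const (- c) = - ratfun_const c"
  "ratfun_const (b - c) = ratfun_const b - ratfun_const c"
  by (simp_all add: ratfun_const_def Zero_fract_def One_fract_def one_pCons mult.commute)

lemma place_abs_const: "place_abs y (ratfun_const c) = (if c = 0 then 0 else 1)"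
  by (simp add: ratfun_const_def poly_abs_const)

lemma place_abs_value:
  fixes f :: "'k::{field,finite} ratfun"
  assumes "f \<noteq> 0"
  obtains k :: int where "place_abs y f = real CARD('k) powi (int (place_degree y) * k)"
proof -
  obtain a b where f: "f = Fract a b" "b \<noteq> 0" by (cases f)
  have a: "a \<noteq> 0" using f assms by (auto simp: Zero_fract_def eq_fract)
  have q: "real CARD('k) \<noteq> 0" by simp
  have "place_abs y f = real CARD('k) powi (- (int (place_degree y) * place_ord y a)
      - (- (int (place_degree y) * place_ord y b)))"
    using a f by (subst power_int_diff) (simp_all add: place_abs_Fract poly_abs_def)
  also have "(- (int (place_degree y) * place_ord y a) - (- (int (place_degree y) * place_ord y b)))
      = int (place_degree y) * (place_ord y b - place_ord y a)"
    by (simp add: algebra_simps)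
  finally show ?thesis by (rule that)
qed

lemma Rep_place_zero [simp]: "Rep_place place_zero = Some [:0, 1:]"
  by (simp add: place_zero.rep_eq)

lemma place_degree_zero [simp]: "place_degree place_zero = 1"
  by (simp add: place_degree.rep_eq)

lemma place_abs_t:
  "place_abs y (ratfun_t :: 'k::{field,finite} ratfun) = (if y = place_zero then inverse (real CARD('k))
     else if Rep_place y = None then real CARD('k) else 1)"
proof -
  have "lead_coeff [:0, 1:: 'k:] = 1" by simp
  from poly_abs_irreducible[OF irreducible_X this] show ?thesis
    by (auto simp: ratfun_t_def Rep_place_inject [symmetric] split: option.splits)
qed

lemma ratfun_t_nonzero [simp]: "ratfun_t \<noteq> 0"
proof
  assume "(ratfun_t :: 'a ratfun) = 0"
  then show False using place_abs_t[of "place_zero :: 'a place"] by simp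
qed

text \<open>
  Away from the place of \<open>t\<close> every prime is generated by an element that is a unit at all other
  places but that one: \<open>p / t ^ degree p\<close> for the place of \<open>p\<close>, and \<open>1 /
  t\<close> for infinity.
\<close>

lemma place_generator:
  fixes y :: "'k::{field,finite} place"
  assumes y: "y \<noteq> place_zero"
  obtains f :: "'k ratfun" where "place_abs y f = inverse (real CARD('k) ^ place_degree y)"
    "\<And>w. w \<noteq> y \<Longrightarrow> w \<noteq> place_zero \<Longrightarrow> place_abs w f = 1"
proof (cases y rule: place_cases)
  case (fin p)
  define f where "f = Fract p 1 / (ratfun_t ^ degree p :: 'k ratfun)"
  have f: "place_abs w f = poly_abs w p / place_abs w (ratfun_t :: 'k ratfun) ^ degree p" for w
    by (simp add: f_def place_abs_divide place_abs_power)
  show ?thesis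
  proof (rule that[of f])
    show "place_abs y f = inverse (real CARD('k) ^ place_degree y)"
      using fin y by (simp add: f poly_abs_irreducible place_abs_t place_degree.rep_eq)
    fix w assume "w \<noteq> y" "w \<noteq> place_zero"
    then show "place_abs w f = 1" using fin
      by (cases w rule: place_cases)
         (auto simp: f poly_abs_irreducible place_abs_t Rep_place_inject [symmetric])
  qed
next
  case inf
  show ?thesis
  proof (rule that[of "inverse ratfun_t"])
    show "place_abs y (inverse ratfun_t :: 'k ratfun) = inverse (real CARD('k) ^ place_degree y)"
      using inf y by (simp add: place_abs_inverse place_abs_t place_degree.rep_eq)
    fix w assume "w \<noteq> y" "w \<noteq> place_zero"
    then show "place_abs w (inverse ratfun_t :: 'k ratfun) = 1" using inf
      by (auto simp: place_abs_inverse place_abs_t Rep_place_inject [symmetric])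
  qed
qed

lemma place_abs_power_int: "place_abs y (f powi k) = place_abs y f powi k"
  by (cases "k \<ge> 0") (simp_all add: power_int_def place_abs_power place_abs_inverse)

text \<open>
  Powers of the generators of the finitely many places where \<open>a\<close> is not a unit remove its norm
  there; the correction accumulates at the place of \<open>t\<close>. So the affine line obtained by removing
  that place has class number one.
\<close>

lemma idele_class_number_one:
  assumes "finite {y. y \<noteq> place_zero \<and> adele_norm y a \<noteq> 1}" "\<And>y. adele_norm y a \<noteq> 0"
  shows "\<exists>\<alpha>. \<alpha> \<noteq> 0 \<and> (\<forall>y. y \<noteq> place_zero \<longrightarrow> adele_norm y (principal_adele \<alpha> * a) = 1)"
  using assms
proof (induction "{y. y \<noteq> place_zero \<and> adele_norm y a \<noteq> 1}" arbitrary: a rule: finite_psubset_induct)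
  case psubset
  let ?S = "\<lambda>a. {y. y \<noteq> place_zero \<and> adele_norm y a \<noteq> 1}"
  show ?case
  proof (cases "?S a = {}")
    case True
    then show ?thesis by (intro exI[of _ 1]) auto
  next
    case False
    then obtain y where y: "y \<noteq> place_zero" "adele_norm y a \<noteq> 1" by auto
    obtain f where f: "place_abs y f = inverse (real CARD('a) ^ place_degree y)"
      "\<And>w. w \<noteq> y \<Longrightarrow> w \<noteq> place_zero \<Longrightarrow> place_abs w f = 1"
      using place_generator[OF y(1)] by blast
    have f0: "f \<noteq> 0" using f(1) by auto
    obtain g where g: "g \<noteq> 0" "adele_norm y a = place_abs y g"
      using adele_norm_value psubset.prems by blast
    obtain k where k: "place_abs y g = real CARD('a) powi (int (place_degree y) * k)"
      using place_abs_value[OF g(1)] .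
    define b where "b = principal_adele (f powi k) * a"
    have norm: "adele_norm w b = place_abs w f powi k * adele_norm w a" for w
      by (simp add: b_def adele_norm_mult place_abs_power_int)
    have "adele_norm y b = 1"
      unfolding norm g(2) k f(1) power_int_mult power_int_of_nat power_int_inverse by simp
    moreover have "adele_norm w b = adele_norm w a" if "w \<noteq> y" "w \<noteq> place_zero" for w
      using f(2)[OF that] by (simp add: norm)
    ultimately have "w \<noteq> y \<and> adele_norm w a \<noteq> 1" if "w \<noteq> place_zero" "adele_norm w b \<noteq> 1" for w
      using that by (cases "w = y") auto
    then have "?S b \<subset> ?S a" using y by blast
    moreover have "adele_norm w b \<noteq> 0" for w
      using f0 psubset.prems by (simp add: norm)
    ultimately obtain \<alpha> where \<alpha>: "\<alpha> \<noteq> 0"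
      "\<And>y. y \<noteq> place_zero \<Longrightarrow> adele_norm y (principal_adele \<alpha> * b) = 1"
      using psubset.hyps(2)[of b] by metis
    have "adele_norm w (principal_adele (\<alpha> * f powi k) * a) = 1" if "w \<noteq> place_zero" for w
      using \<alpha>(2)[OF that] by (simp add: b_def mult.assoc)
    moreover have "\<alpha> * f powi k \<noteq> 0" using \<alpha>(1) f0 by simp
    ultimately show ?thesis by blast
  qed
qed

text \<open>
  Partial fractions: a Bezout relation between \<open>p ^ k\<close> and the prime-to-\<open>p\<close> part
  \<open>m\<close> of the denominator splits off a fraction \<open>r / p ^ k\<close>, and reducing
  \<open>r\<close> modulo \<open>p ^ k\<close> makes it integral at infinity. At infinity itself the
  polynomial quotient does the job.
\<close>

lemma polar_part:
  fixes f :: "'k::{field,finite} ratfun"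
  obtains g where "place_abs y (f - g) \<le> 1" "\<And>w. w \<noteq> y \<Longrightarrow> place_abs w g \<le> 1"
proof (cases f)
  case (Fract a b)
  show ?thesis
  proof (cases y rule: place_cases)
    case (fin p)
    obtain m where m: "b = p ^ poly_ord p b * m" "\<not> p dvd m"
      using poly_ord_decomp[OF fin(2) Fract(2)] .
    define k where "k = poly_ord p b"
    have b: "b = p ^ k * m" using m(1) by (simp add: k_def)
    obtain u v where uv: "u * p ^ k + v * m = 1" using irreducible_power_bezout[OF fin(2) m(2)] by blast
    define r where "r = (a * v) mod p ^ k"
    define g where "g = Fract r (p ^ k)"
    have nz: "p \<noteq> 0" "m \<noteq> 0" using m Fract fin(2) not_irreducible_zero by auto
    have "f - g = Fract (a * u + (a * v) div p ^ k * m) m"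
    proof -
      have r: "r = a * v - (a * v) div p ^ k * p ^ k"
        unfolding r_def by (rule minus_div_mult_eq_mod [symmetric])
      have "a - r * m = a * (u * p ^ k + v * m) - r * m" by (simp add: uv)
      also have "\<dots> = (a * u + (a * v) div p ^ k * m) * p ^ k"
        unfolding r by (simp add: algebra_simps)
      finally have *: "a - r * m = (a * u + (a * v) div p ^ k * m) * p ^ k" .
      have "f - g = Fract (a * p ^ k - r * b) (b * p ^ k)"
        using Fract nz by (simp add: g_def)
      also have "a * p ^ k - r * b = (a - r * m) * p ^ k"
        unfolding b by (simp add: algebra_simps)
      finally show ?thesis using nz unfolding * b
        by (simp add: eq_fract algebra_simps)
    qed
    then have "place_abs y (f - g) \<le> 1"
      using poly_abs_finite_eq_1_iff[OF fin(1), of m] m nz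
      by (simp add: place_abs_Fract poly_abs_finite_le_1[OF fin(1)])
    moreover have "place_abs w g \<le> 1" if w: "w \<noteq> y" for w
    proof (cases w rule: place_cases)
      case fin': (fin s)
      have "s \<noteq> p"
      proof
        assume "s = p"
        then have "w = y" by (intro Rep_place_inject [THEN iffD1]) (simp add: fin fin')
        with w show False by simp
      qed
      then have "poly_abs w p = 1" using fin fin' by (simp add: poly_abs_irreducible)
      then have "poly_abs w (p ^ k) = 1" by (induction k) (simp_all add: poly_abs_mult)
      then show ?thesis using nz
        by (simp add: g_def place_abs_Fract poly_abs_finite_le_1[OF fin'(1)])
    next
      case inf
      show ?thesis
      proof (cases "r = 0")
        case False
        have "degree r \<le> degree (p ^ k)"
          using degree_mod_less[of "p ^ k" "a * v"] nz by (auto simp: r_def)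
        then show ?thesis using False nz card_gt_1[where 'k='k]
          by (simp add: g_def place_abs_Fract poly_abs_infinite[OF inf] power_increasing)
      qed (simp add: g_def place_abs_Fract nz)
    qed
    ultimately show ?thesis by (rule that)
  next
    case inf
    define g where "g = Fract (a div b) 1"
    have "f - g = Fract (a mod b) b"
      using Fract by (simp add: g_def minus_div_mult_eq_mod)
    moreover have "poly_abs y (a mod b) \<le> poly_abs y b"
    proof (cases "a mod b = 0")
      case False
      then show ?thesis using degree_mod_less[of b a] Fract card_gt_1[where 'k='k]
        by (simp add: poly_abs_infinite[OF inf] power_increasing)
    qed simp
    ultimately have "place_abs y (f - g) \<le> 1"
      using poly_abs_pos[OF Fract(2), of y] by (simp add: place_abs_Fract Fract)
    moreover have "place_abs w g \<le> 1" if "w \<noteq> y" for w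
    proof (cases w rule: place_cases)
      case (fin s)
      then show ?thesis by (simp add: g_def poly_abs_finite_le_1)
    next
      case inf': inf
      have "w = y" by (rule Rep_place_inject [THEN iffD1]) (simp add: inf inf')
      with that show ?thesis by simp
    qed
    ultimately show ?thesis by (rule that)
  qed
qed

text \<open>
  Subtracting polar parts place by place makes an adele integral, since no step creates a new pole.
  Cohomologically, \<open>O\<close> on the projective line has no \<open>H\<^sup>1\<close>.
\<close>

lemma adele_principal_plus_integral:
  "\<exists>f. \<forall>y. adele_norm y (a - principal_adele f) \<le> 1"
  using finite_adele_norm_gt_1[of a]
proof (induction "{y. adele_norm y a > 1}" arbitrary: a rule: finite_psubset_induct)
  case psubset
  show ?case
  proof (cases "{y. adele_norm y a > 1} = {}")
    case True
    then show ?thesis by (intro exI[of _ 0]) (auto simp: not_less)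
  next
    case False
    then obtain y where y: "adele_norm y a > 1" by auto
    obtain f where f: "adele_norm y (a - principal_adele f) < 1" using adele_dense[of 1] by auto
    obtain g where g: "place_abs y (f - g) \<le> 1" "\<And>w. w \<noteq> y \<Longrightarrow> place_abs w g \<le> 1"
      using polar_part[of y f] by blast
    let ?b = "a - principal_adele g"
    have "?b = (a - principal_adele f) + principal_adele (f - g)" by simp
    then have "adele_norm y ?b \<le> 1"
      using f g(1) by (metis adele_norm_add_le adele_norm_principal less_imp_le)
    moreover have "adele_norm w ?b \<le> 1" if "w \<noteq> y" "\<not> adele_norm w a > 1" for w
      using that g(2) by (intro adele_norm_diff_le) auto
    ultimately have "{w. adele_norm w ?b > 1} \<subset> {y. adele_norm y a > 1}" using y by force
    then obtain h where "\<forall>y. adele_norm y (?b - principal_adele h) \<le> 1" using psubset.hyps(2)[of ?b] by blast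
    then show ?thesis by (intro exI[of _ "g + h"]) (simp add: algebra_simps)
  qed
qed

text \<open>
  The residue field at \<open>x\<close> is the field of constants: a fraction that is integral at
  \<open>x\<close> has, in lowest terms, a value at \<open>0\<close>.
\<close>

lemma residue_exists:
  assumes "adele_norm place_zero a \<le> 1"
  obtains c where "adele_norm place_zero (a - principal_adele (ratfun_const c)) < 1"
proof -
  obtain f where f: "adele_norm place_zero (a - principal_adele f) < 1" using adele_dense[of 1] by auto
  have "adele_norm place_zero (principal_adele f) \<le> 1"
    using adele_norm_diff_le[OF assms less_imp_le[OF f]] by simp
  then have f1: "place_abs place_zero f \<le> 1" by simp
  let ?X = "[:0, 1::'a:]"
  have X: "Rep_place place_zero = Some ?X" by simp
  have "\<exists>n d. \<not> ?X dvd d \<and> f = Fract n d"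
  proof (cases "f = 0")
    case True
    then show ?thesis by (intro exI[of _ 0] exI[of _ 1]) (simp add: Zero_fract_def is_unit_iff_degree)
  next
    case False
    obtain a b where ab: "f = Fract a b" "b \<noteq> 0" by (cases f)
    have a0: "a \<noteq> 0" using ab False by (auto simp: Zero_fract_def eq_fract)
    obtain m where m: "b = ?X ^ poly_ord ?X b * m" "\<not> ?X dvd m"
      using poly_ord_decomp[OF irreducible_X ab(2)] .
    have "poly_abs place_zero a \<le> poly_abs place_zero b"
      using f1 ab poly_abs_pos[OF ab(2), of place_zero] by (simp add: place_abs_Fract)
    then have "poly_ord ?X b \<le> poly_ord ?X a"
      using card_gt_1[where 'k='a] by (simp add: poly_abs_finite[OF X] a0 ab(2))
    then have "?X ^ poly_ord ?X b dvd a"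
      using poly_ord_dvd[OF irreducible_X a0] by (meson dvd_trans le_imp_power_dvd)
    then obtain n where n: "a = ?X ^ poly_ord ?X b * n" by (elim dvdE)
    have "?X ^ poly_ord ?X b \<noteq> 0" "m \<noteq> 0" using m ab by auto
    then have "f = Fract n m" using ab by (subst ab(1), subst m(1), subst n) (simp add: eq_fract)
    with m show ?thesis by blast
  qed
  then obtain n d where nd: "\<not> ?X dvd d" "f = Fract n d" by blast
  have d0: "d \<noteq> 0" using nd by auto
  have pd: "poly d 0 \<noteq> 0" using nd(1) poly_eq_0_iff_dvd[of d 0] by simp
  define c where "c = poly n 0 / poly d 0"
  have "f - ratfun_const c = Fract (n - smult c d) d"
    using d0 nd by (simp add: ratfun_const_def)
  moreover have "?X dvd n - smult c d"
    using pd poly_eq_0_iff_dvd[of "n - smult c d" 0] by (simp add: c_def)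
  ultimately have "place_abs place_zero (f - ratfun_const c) < 1"
    using poly_abs_finite_eq_1_iff[OF X, of d] poly_abs_finite_eq_1_iff[OF X, of "n - smult c d"]
      poly_abs_finite_le_1[OF X, of "n - smult c d"] nd d0 by (simp add: place_abs_Fract)
  then have "adele_norm place_zero ((a - principal_adele f) + principal_adele (f - ratfun_const c)) < 1"
    using f by (intro adele_norm_add_less) (simp_all only: adele_norm_principal)
  then show ?thesis by (intro that[of c]) simp
qed

text \<open>
  After making the adele integral, a constant kills its residue at \<open>x\<close>. The strict inequality at
  \<open>x\<close>, which says that \<open>O(-1)\<close> has no \<open>H\<^sup>1\<close> either, drives the
  reduction of matrices below.
\<close>

lemma strong_approximation:
  obtains f where "\<And>y. adele_norm y (a - principal_adele f) \<le> 1"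
    "adele_norm place_zero (a - principal_adele f) < 1"
proof -
  obtain f where f: "\<And>y. adele_norm y (a - principal_adele f) \<le> 1"
    using adele_principal_plus_integral by blast
  obtain c where c: "adele_norm place_zero (a - principal_adele f - principal_adele (ratfun_const c)) < 1"
    using residue_exists[OF f] .
  have "adele_norm y (a - principal_adele f - principal_adele (ratfun_const c)) \<le> 1" for y
    by (rule adele_norm_diff_le[OF f]) (simp add: place_abs_const)
  with c show ?thesis by (intro that[of "f + ratfun_const c"]) (simp_all add: algebra_simps)
qed

lemma adele_norm_zero_value:
  fixes a :: "'k::{field,finite} adele"
  assumes "adele_norm place_zero a \<noteq> 0"
  obtains k :: int where "adele_norm place_zero a = real CARD('k) powi k"
proof -
  obtain f where f: "f \<noteq> 0" "adele_norm place_zero a = place_abs (place_zero :: 'k place) f"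
    using adele_norm_value[OF assms] .
  obtain k where "place_abs (place_zero :: 'k place) f = real CARD('k) powi (int (place_degree (place_zero :: 'k place)) * k)"
    using place_abs_value[OF f(1)] .
  then show ?thesis by (intro that[of k]) (simp add: f(2))
qed

text \<open>
  The norm at \<open>x\<close> takes values in the powers of \<open>q\<close> because \<open>x\<close> has
  degree one.
\<close>

lemma adele_norm_zero_less:
  fixes a b :: "'k::{field,finite} adele"
  assumes "adele_norm place_zero a < adele_norm place_zero b"
  shows "adele_norm place_zero a \<le> adele_norm place_zero b / real CARD('k)"
proof (cases "adele_norm place_zero a = 0")
  case False
  have q: "real CARD('k) > 1" by (rule card_gt_1)
  have "adele_norm place_zero b \<noteq> 0" using assms adele_norm_nonneg[of place_zero a] by linarith
  then obtain k where k: "adele_norm place_zero b = real CARD('k) powi k" by (rule adele_norm_zero_value)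
  obtain j where j: "adele_norm place_zero a = real CARD('k) powi j" using False by (rule adele_norm_zero_value)
  have "j < k"
  proof (rule ccontr)
    assume "\<not> j < k"
    then have "real CARD('k) powi k \<le> real CARD('k) powi j" using q by (intro power_int_increasing) auto
    with assms show False unfolding j k by simp
  qed
  then have "real CARD('k) powi j \<le> real CARD('k) powi (k - 1)" using q by (intro power_int_increasing) auto
  also have "\<dots> = real CARD('k) powi k / real CARD('k)" using q by (simp add: power_int_diff)
  finally show ?thesis unfolding j k .
qed simp


section \<open>Adelic two by two matrices and sizes of rows\<close>

(* The dollar sign is also the coefficient notation of power series, which makes iterated matrix
   indices ambiguous. *)
no_notation fps_nth (infixl "$" 75)

definition mat2 :: "'a::zero \<Rightarrow> 'a \<Rightarrow> 'a \<Rightarrow> 'a \<Rightarrow> 'a ^ 2 ^ 2" where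
  "mat2 a b c d = vector [vector [a, b], vector [c, d]]"

lemma mat2_nth [simp]:
  "mat2 a b c d $ 1 $ 1 = a" "mat2 a b c d $ 1 $ 2 = b"
  "mat2 a b c d $ 2 $ 1 = c" "mat2 a b c d $ 2 $ 2 = d"
  by (simp_all add: mat2_def)

lemma mat2_eqI:
  fixes g h :: "'a ^ 2 ^ 2"
  assumes "g $ 1 $ 1 = h $ 1 $ 1" "g $ 1 $ 2 = h $ 1 $ 2" "g $ 2 $ 1 = h $ 2 $ 1" "g $ 2 $ 2 = h $ 2 $ 2"
  shows "g = h"
  using assms
  by (simp add: vec_eq_iff forall_2)

lemma mat2_cases:
  fixes g :: "'a::zero ^ 2 ^ 2"
  obtains a b c d where "g = mat2 a b c d"
  by (rule that[of "g $ 1 $ 1" "g $ 1 $ 2" "g $ 2 $ 1" "g $ 2 $ 2"]) (rule mat2_eqI; simp)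

lemma mat2_mult: "mat2 a b c d ** mat2 a' b' c' d' =
    mat2 (a * a' + b * c') (a * b' + b * d') (c * a' + d * c') (c * b' + d * (d' :: 'a::semiring_1))"
  by (rule mat2_eqI) (simp_all add: matrix_matrix_mult_def sum_2)

lemma mat2_1: "mat 1 = mat2 1 0 0 (1 :: 'a::semiring_1)"
  by (rule mat2_eqI) (simp_all add: mat_def)

lemma det_mat2 [simp]: "det (mat2 a b c d) = a * d - b * (c :: 'a::comm_ring_1)"
  by (simp add: det_2)

lemma mat2_diff: "mat2 a b c d - mat2 a' b' c' d' = mat2 (a - a') (b - b') (c - c') (d - (d' :: 'a::comm_ring_1))"
  by (rule mat2_eqI) simp_all

lemma mat2_eq_iff [simp]: "mat2 a b c d = mat2 a' b' c' d' \<longleftrightarrow> a = a' \<and> b = b' \<and> c = c' \<and> d = d'"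
  by (metis mat2_nth)

lemma row_mult_nth:
  fixes g :: "'a::comm_ring_1 ^ 2 ^ 2"
  shows "(v v* g) $ j = v $ 1 * g $ 1 $ j + v $ 2 * g $ 2 $ j"
  by (simp add: vector_matrix_mult_def sum_2 mult.commute)

lemma mat2_adjugate:
  fixes g :: "'a::comm_ring_1 ^ 2 ^ 2"
  assumes "det g * e = 1"
  defines "h \<equiv> mat2 (g $ 2 $ 2 * e) (- g $ 1 $ 2 * e) (- g $ 2 $ 1 * e) (g $ 1 $ 1 * e)"
  shows "g ** h = mat 1" "h ** g = mat 1"
proof -
  obtain a b c d where g: "g = mat2 a b c d" by (rule mat2_cases)
  have 1: "(a * d - b * c) * e = 1" using assms(1) by (simp add: g)
  have "a * (d * e) + b * (- c * e) = 1" "c * (- b * e) + d * (a * e) = 1"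
     "d * e * a + - b * e * c = 1" "- c * e * b + a * e * d = 1"
    using 1 by (simp_all add: algebra_simps)
  then show "g ** h = mat 1" "h ** g = mat 1"
    by (simp_all add: g h_def mat2_mult mat2_1 algebra_simps)
qed

lemma matrix_inverse_unique:
  assumes "g ** h = mat 1" "h' ** g = mat 1"
  shows "h = (h' :: 'a::semiring_1 ^ 'n ^ 'n)"
  by (metis assms matrix_mul_assoc matrix_mul_lid matrix_mul_rid)

lemma invertible_iff_det_unit:
  fixes g :: "'a::comm_ring_1 ^ 2 ^ 2"
  shows "invertible g \<longleftrightarrow> det g dvd 1"
proof
  assume "invertible g"
  then obtain h where "g ** h = mat 1" unfolding invertible_def by blast
  then have "det g * det h = 1" by (metis det_mul det_I)
  then show "det g dvd 1" by (metis dvd_triv_left)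
next
  assume "det g dvd 1"
  then obtain e where "det g * e = 1" by (metis dvdE)
  from mat2_adjugate[OF this] show "invertible g" unfolding invertible_def by blast
qed

lemma GL2_adeles_iff: "g \<in> GL2_adeles \<longleftrightarrow> det g dvd 1"
  by (simp add: GL2_adeles_def invertible_iff_det_unit)

lemma GL2_adeles_mult: "g \<in> GL2_adeles \<Longrightarrow> h \<in> GL2_adeles \<Longrightarrow> g ** h \<in> GL2_adeles"
  by (simp add: GL2_adeles_def invertible_mult)

lemma GL2_adeles_one: "mat 1 \<in> GL2_adeles"
  by (simp add: GL2_adeles_iff)

lemma GL2_adeles_inverse:
  assumes "g \<in> GL2_adeles"
  obtains h where "h \<in> GL2_adeles" "g ** h = mat 1" "h ** g = mat 1"
  using assms unfolding GL2_adeles_def invertible_def by blast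

text \<open>
  Integral entries and a determinant of norm \<open>1\<close> everywhere suffice, by the adjugate formula; so
  membership in \<open>K\<close> becomes a family of inequalities between norms.
\<close>

lemma K_max_iff: "k \<in> K_max \<longleftrightarrow> (\<forall>i j y. adele_norm y (k $ i $ j) \<le> 1) \<and> (\<forall>y. adele_norm y (det k) = 1)"
proof safe
  assume k: "k \<in> K_max"
  then obtain h where h: "\<And>i j y. adele_norm y (h $ i $ j) \<le> 1" "k ** h = mat 1"
    by (auto simp: K_max_def integral_adeles_iff)
  show k1: "adele_norm y (k $ i $ j) \<le> 1" for i j y
    using k by (auto simp: K_max_def integral_adeles_iff)
  have le: "adele_norm y (det k) \<le> 1" "adele_norm y (det h) \<le> 1" for y
    unfolding det_2 by (intro adele_norm_diff_le adele_norm_mult_le k1 h)+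
  have "det k * det h = 1" using h by (metis det_mul det_I)
  then have p: "adele_norm y (det k) * adele_norm y (det h) = 1" for y
    by (metis adele_norm_mult adele_norm_1)
  show "adele_norm y (det k) = 1" for y
  proof (rule antisym)
    have "adele_norm y (det k) * adele_norm y (det h) \<le> adele_norm y (det k) * 1"
      using le by (intro mult_left_mono) auto
    then show "1 \<le> adele_norm y (det k)" using p by simp
  qed (rule le)
next
  assume k: "\<forall>i j y. adele_norm y (k $ i $ j) \<le> 1" "\<forall>y. adele_norm y (det k) = 1"
  have "det k dvd 1" using k by (simp add: adele_unit_iff)
  then obtain e where e: "det k * e = 1" by (metis dvdE)
  have "adele_norm y (det k) * adele_norm y e = 1" for y using e by (metis adele_norm_mult adele_norm_1)
  then have "adele_norm y e = 1" for y using k by simp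
  then have "adele_norm y (mat2 (k $ 2 $ 2 * e) (- k $ 1 $ 2 * e) (- k $ 2 $ 1 * e) (k $ 1 $ 1 * e) $ i $ j) \<le> 1" for i j y
    using k exhaust_2[of i] exhaust_2[of j] by (auto simp: adele_norm_mult)
  then show "k \<in> K_max"
    unfolding K_max_def integral_adeles_iff using mat2_adjugate[OF e] k by blast
qed

lemma K_max_subset_GL2: "K_max \<subseteq> GL2_adeles"
  by (auto simp: K_max_iff GL2_adeles_iff adele_unit_iff)

lemma K_max_one: "mat 1 \<in> K_max"
proof -
  have "adele_norm y ((mat 1 :: 'a adele_mat) $ i $ j) \<le> 1" for y i j by (simp add: mat_def)
  then show ?thesis by (simp add: K_max_iff det_I)
qed

lemma K_max_mult:
  assumes "g \<in> K_max" "h \<in> K_max"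
  shows "g ** h \<in> K_max"
proof -
  have "adele_norm y ((g ** h) $ i $ j) \<le> 1" for y i j
    using assms unfolding K_max_iff
    by (auto simp: matrix_matrix_mult_def sum_2 intro!: adele_norm_add_le adele_norm_mult_le)
  then show ?thesis using assms by (simp add: K_max_iff det_mul adele_norm_mult)
qed

lemma K_max_inverse:
  assumes "k \<in> K_max" "k ** h = mat 1"
  shows "h \<in> K_max"
proof -
  obtain h' where "h' \<in> K_max" "h' ** k = mat 1" using assms(1) unfolding K_max_def by blast
  with matrix_inverse_unique[OF assms(2), of h'] show ?thesis by simp
qed

text \<open>
  Being divisible by \<open>t\<close> at \<open>x\<close> is the same as having norm below \<open>1\<close>,
  since the norm is discrete.
\<close>

lemma K_prime_iff:
  "k \<in> K_prime \<longleftrightarrow> k \<in> K_max \<and> (\<forall>i j. adele_norm place_zero ((k - mat 1) $ i $ j) < 1)"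
proof -
  have "(\<exists>c\<in>local_integers place_zero. adele_at (a :: 'a adele) place_zero =
       to_completion place_zero ratfun_t \<otimes>\<^bsub>local_field place_zero\<^esub> c) \<longleftrightarrow> adele_norm place_zero a < 1" for a
  proof
    assume "\<exists>c\<in>local_integers place_zero. adele_at a place_zero =
       to_completion place_zero ratfun_t \<otimes>\<^bsub>local_field place_zero\<^esub> c"
    then obtain c where c: "c \<in> carrier (local_field (place_zero :: 'a place))" "local_abs place_zero c \<le> 1"
       "adele_at a place_zero = to_completion place_zero ratfun_t \<otimes>\<^bsub>local_field place_zero\<^esub> c"
      by (auto simp: local_integers_def)
    then have "adele_norm place_zero a = local_abs place_zero c / real CARD('a)"
      by (simp add: adele_norm_def local_abs_mult place_abs_t divide_inverse mult.commute)
    also have "\<dots> \<le> 1 / real CARD('a)" using c by (intro divide_right_mono) auto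
    also have "\<dots> < 1" using card_gt_1[where 'k='a] by simp
    finally show "adele_norm place_zero a < 1" .
  next
    assume "adele_norm place_zero a < 1"
    then have le: "adele_norm place_zero a \<le> 1 / real CARD('a)"
      using adele_norm_zero_less[of a 1] by simp
    let ?c = "principal_adele (inverse ratfun_t) * a"
    have "adele_norm place_zero ?c = real CARD('a) * adele_norm place_zero a"
      by (simp add: adele_norm_mult place_abs_inverse place_abs_t)
    also have "\<dots> \<le> 1" using le card_gt_1[where 'k='a] by (simp add: field_simps)
    finally have "adele_at ?c place_zero \<in> local_integers place_zero"
      by (simp add: local_integers_def adele_norm_def)
    moreover have "a = principal_adele ratfun_t * ?c"
      by (simp flip: mult.assoc principal_adele_simps(4))
    then have "adele_at a place_zero =
       to_completion place_zero ratfun_t \<otimes>\<^bsub>local_field place_zero\<^esub> adele_at ?c place_zero"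
      by (metis times_adele.rep_eq principal_adele.rep_eq)
    ultimately show "\<exists>c\<in>local_integers place_zero. adele_at a place_zero =
       to_completion place_zero ratfun_t \<otimes>\<^bsub>local_field place_zero\<^esub> c" by blast
  qed
  then show ?thesis by (simp add: K_prime_def)
qed

lemma K_prime_subset_K_max: "K_prime \<subseteq> K_max"
  by (auto simp: K_prime_iff)

text \<open>
  Commuting with the two elementary unipotent matrices already forces a matrix to be scalar.
\<close>

lemma center_GL2_iff: "z \<in> center_GL2 \<longleftrightarrow> (\<exists>u. u dvd 1 \<and> z = mat2 u 0 0 u)"
proof safe
  assume z: "z \<in> center_GL2"
  obtain a b c d where g: "z = mat2 a b c d" by (rule mat2_cases)
  have "z ** mat2 1 1 0 1 = mat2 1 1 0 1 ** z" "z ** mat2 1 0 1 1 = mat2 1 0 1 1 ** z"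
    using z by (auto simp: center_GL2_def GL2_adeles_iff)
  then have "c = 0" "b = 0" "d = a" by (auto simp: g mat2_mult)
  moreover have "det z dvd 1" using z by (simp add: center_GL2_def GL2_adeles_iff)
  ultimately show "\<exists>u. u dvd 1 \<and> z = mat2 u 0 0 u" by (auto simp: g dest: dvd_mult_left)
next
  fix u :: "'a adele" assume u: "u dvd 1"
  show "mat2 u 0 0 u \<in> center_GL2"
    unfolding center_GL2_def GL2_adeles_iff
  proof safe
    show "det (mat2 u 0 0 u) dvd 1" using mult_dvd_mono[OF u u] by simp
    fix g :: "'a adele_mat"
    obtain a b c d where "g = mat2 a b c d" by (rule mat2_cases)
    then show "mat2 u 0 0 u ** g = g ** mat2 u 0 0 u" by (simp add: mat2_mult mult.commute)
  qed
qed

lemma principal_mat_mult: "principal_mat (m ** n) = principal_mat m ** principal_mat (n :: 'k::{field,finite} ratfun ^ 2 ^ 2)"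
  by (rule mat2_eqI) (simp_all add: principal_mat_def matrix_matrix_mult_def sum_2)

lemma principal_mat_mat2: "principal_mat (mat2 a b c d) =
   mat2 (principal_adele a) (principal_adele b) (principal_adele c) (principal_adele d)"
  by (rule mat2_eqI) (simp_all add: principal_mat_def)

lemma principal_mat_one [simp]: "principal_mat (mat 1) = mat 1"
  by (simp add: mat2_1 principal_mat_mat2)

lemma det_principal_mat: "det (principal_mat m) = principal_adele (det m)"
  by (simp add: det_2 principal_mat_def)

lemma principal_mat_GL2:
  assumes "invertible m"
  shows "principal_mat m \<in> GL2_adeles"
proof -
  have "invertible (principal_mat m)" using assms unfolding invertible_def
    by (metis principal_mat_mult principal_mat_one)
  then show ?thesis by (simp add: GL2_adeles_def)
qed

definition principal_vec :: "('k::{field,finite}) ratfun ^ 2 \<Rightarrow> 'k adele ^ 2" where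
  "principal_vec v = (\<chi> i. principal_adele (v $ i))"

lemma principal_vec_mult: "principal_vec (v v* m) = principal_vec v v* principal_mat m"
  by (simp add: vec_eq_iff principal_vec_def row_mult_nth principal_mat_def)

text \<open>
  A vector \<open>v\<close> over \<open>F\<close> spans a line subbundle of the rank two bundle attached to
  \<open>g\<close>, and the row \<open>v g\<close> consists of its coordinates in the local trivializations.
  The product of the local maximum norms of this row is \<open>q ^ - d\<close> for the degree \<open>d\<close>
  of that subbundle.
\<close>

definition row_norm :: "('k::{field,finite}) place \<Rightarrow> 'k adele ^ 2 \<Rightarrow> real" where
  "row_norm y w = max (adele_norm y (w $ 1)) (adele_norm y (w $ 2))"

lemma row_norm_nonneg [simp]: "row_norm y w \<ge> 0"
  by (simp add: row_norm_def le_max_iff_disj)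

lemma row_norm_mult_le:
  assumes "\<And>i j. adele_norm y (g $ i $ j) \<le> B"
  shows "row_norm y (w v* g) \<le> row_norm y w * B"
proof -
  have "adele_norm y (w $ i * g $ i $ j) \<le> row_norm y w * B" for i j
    unfolding adele_norm_mult using assms[of i j] exhaust_2[of i]
    by (intro mult_mono) (auto simp: row_norm_def le_max_iff_disj)
  then show ?thesis
    unfolding row_norm_def[of y "w v* g"] row_mult_nth by (intro max.boundedI adele_norm_add_le)
qed

text \<open>
  Both \<open>k\<close> and its inverse are integral, so neither of them can increase the norm.
\<close>

lemma row_norm_K:
  assumes "k \<in> K_max"
  shows "row_norm y (w v* k) = row_norm y w"
proof (rule antisym)
  obtain h where h: "h \<in> K_max" "k ** h = mat 1"
    using assms GL2_adeles_inverse K_max_inverse K_max_subset_GL2 by (metis subsetD)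
  show "row_norm y (w v* k) \<le> row_norm y w"
    using row_norm_mult_le[of y k 1 w] assms by (simp add: K_max_iff)
  show "row_norm y w \<le> row_norm y (w v* k)"
    using row_norm_mult_le[of y h 1 "w v* k"] h by (simp add: K_max_iff vector_matrix_mul_assoc)
qed

lemma row_norm_scalar: "row_norm y (w v* mat2 u 0 0 u) = row_norm y w * adele_norm y u"
  by (simp add: row_norm_def row_mult_nth adele_norm_mult max_mult_distrib_right)

lemma row_norm_principal_vec:
  assumes "v \<noteq> 0"
  shows "finite {y. row_norm y (principal_vec v) \<noteq> 1}" and "row_norm y (principal_vec v) > 0"
proof -
  obtain i where i: "v $ i \<noteq> 0" using assms by (auto simp: vec_eq_iff)
  have le: "place_abs y (v $ i) \<le> row_norm y (principal_vec v)" for y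
    using exhaust_2[of i] by (auto simp: row_norm_def principal_vec_def)
  have "{y. row_norm y (principal_vec v) \<noteq> 1} \<subseteq>
     {y. place_abs y (v $ i) \<noteq> 1} \<union> {y. place_abs y (v $ 1) > 1} \<union> {y. place_abs y (v $ 2) > 1}"
  proof
    fix y assume "y \<in> {y. row_norm y (principal_vec v) \<noteq> 1}"
    then have "row_norm y (principal_vec v) > 1 \<or> row_norm y (principal_vec v) < 1" by auto
    then show "y \<in> {y. place_abs y (v $ i) \<noteq> 1} \<union> {y. place_abs y (v $ 1) > 1} \<union> {y. place_abs y (v $ 2) > 1}"
      using le[of y] by (auto simp: row_norm_def principal_vec_def less_max_iff_disj)
  qed
  then show "finite {y. row_norm y (principal_vec v) \<noteq> 1}"
    by (rule finite_subset) (use place_abs_product_formula(1)[OF i] finite_place_abs_gt_1 in auto)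
  show "row_norm y (principal_vec v) > 0"
    using le[of y] place_abs_pos[OF i, of y] by linarith
qed

text \<open>
  The row \<open>v g\<close> is comparable to \<open>v\<close> at each place, with constant \<open>1\<close>
  where \<open>g\<close> and its inverse are integral. Hence the infinite product \<open>row_size\<close> is
  meaningful.
\<close>

lemma row_norm_GL2:
  assumes "v \<noteq> 0" "g \<in> GL2_adeles"
  shows "finite {y. row_norm y (principal_vec v v* g) \<noteq> 1}" and "row_norm y (principal_vec v v* g) > 0"
proof -
  obtain h where h: "g ** h = mat 1" using GL2_adeles_inverse[OF assms(2)] by blast
  let ?w = "principal_vec v v* g"
  have w: "?w v* h = principal_vec v" by (simp add: vector_matrix_mul_assoc h)
  show "row_norm y ?w > 0"
  proof (rule ccontr)
    assume "\<not> ?thesis"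
    then have 0: "row_norm y ?w = 0" using row_norm_nonneg[of y ?w] by linarith
    have "adele_norm y (h $ i $ j) \<le> Max (range (\<lambda>(i, j). adele_norm y (h $ i $ j)))" for i j
      by (rule Max_ge) auto
    from row_norm_mult_le[OF this, of ?w] show False
      using 0 row_norm_principal_vec(2)[OF assms(1), of y] by (simp add: w)
  qed
  let ?S = "{y. row_norm y (principal_vec v) \<noteq> 1} \<union> (\<Union>i. \<Union>j. {y. adele_norm y (g $ i $ j) > 1} \<union> {y. adele_norm y (h $ i $ j) > 1})"
  have "{y. row_norm y ?w \<noteq> 1} \<subseteq> ?S"
  proof (rule subsetI, rule ccontr)
    fix y assume y: "y \<in> {y. row_norm y ?w \<noteq> 1}" "y \<notin> ?S"
    then have "adele_norm y (g $ i $ j) \<le> 1" "adele_norm y (h $ i $ j) \<le> 1" for i j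
      by (auto simp: not_less)
    then have "row_norm y ?w \<le> 1" "1 \<le> row_norm y ?w"
      using row_norm_mult_le[of y g 1 "principal_vec v"] row_norm_mult_le[of y h 1 ?w] y(2) by (auto simp: w)
    with y show False by simp
  qed
  then show "finite {y. row_norm y ?w \<noteq> 1}"
    by (rule finite_subset) (use row_norm_principal_vec(1)[OF assms(1)] finite_adele_norm_gt_1 in auto)
qed

lemma Prod_any_mono:
  fixes f g :: "'a \<Rightarrow> real"
  assumes "finite {a. f a \<noteq> 1}" "finite {a. g a \<noteq> 1}" "\<And>a. 0 \<le> f a" "\<And>a. f a \<le> g a"
  shows "(\<Prod>a. f a) \<le> (\<Prod>a. g a)"
proof -
  let ?A = "{a. f a \<noteq> 1} \<union> {a. g a \<noteq> 1}"
  have "(\<Prod>a. f a) = (\<Prod>a\<in>?A. f a)" "(\<Prod>a. g a) = (\<Prod>a\<in>?A. g a)"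
    by (rule Prod_any.expand_superset; use assms in auto)+
  then show ?thesis using assms by (simp add: prod_mono)
qed

lemma Prod_any_pos:
  fixes f :: "'a \<Rightarrow> real"
  assumes "\<And>a. 0 < f a"
  shows "0 < (\<Prod>a. f a)"
  unfolding Prod_any.expand_set using assms by (intro prod_pos) auto

definition idele_size :: "('k::{field,finite}) adele \<Rightarrow> real" where
  "idele_size a = (\<Prod>y. adele_norm y a)"

definition row_size :: "('k::{field,finite}) adele ^ 2 \<Rightarrow> real" where
  "row_size w = (\<Prod>y. row_norm y w)"

lemma idele_size_mult:
  assumes "a dvd 1" "b dvd 1"
  shows "idele_size (a * b) = idele_size a * idele_size b"
  unfolding idele_size_def adele_norm_mult
  by (rule Prod_any.distrib) (use assms adele_unit_norm in auto)

lemma idele_size_pos: "a dvd 1 \<Longrightarrow> idele_size a > 0"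
  unfolding idele_size_def by (intro Prod_any_pos adele_unit_norm)

lemma idele_size_principal: "f \<noteq> 0 \<Longrightarrow> idele_size (principal_adele f) = 1"
  by (simp add: idele_size_def place_abs_product_formula)

lemma row_size_pos: "v \<noteq> 0 \<Longrightarrow> g \<in> GL2_adeles \<Longrightarrow> row_size (principal_vec v v* g) > 0"
  unfolding row_size_def by (intro Prod_any_pos row_norm_GL2)


section \<open>Reduction theory\<close>

lemma mat2_mult_diff_right:
  fixes g h k :: "'a::comm_ring_1 ^ 2 ^ 2"
  shows "g ** (h - k) = g ** h - g ** k"
  by (rule mat2_eqI) (simp_all add: matrix_matrix_mult_def sum_2 algebra_simps)

lemma K_max_mult_small:
  assumes "h \<in> K_max" "\<And>i j. adele_norm y (m $ i $ j) < 1"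
  shows "adele_norm y ((h ** m) $ i $ j) < 1"
proof -
  have "adele_norm y (h $ i $ l * m $ l $ j) < 1" for l
  proof -
    have "adele_norm y (h $ i $ l) * adele_norm y (m $ l $ j) \<le> 1 * adele_norm y (m $ l $ j)"
      using assms(1) by (intro mult_right_mono) (auto simp: K_max_iff)
    then show ?thesis using assms(2)[of l j] by (simp add: adele_norm_mult)
  qed
  then show ?thesis by (simp add: matrix_matrix_mult_def sum_2 adele_norm_add_less)
qed

text \<open>
  Multiplying the difference \<open>g - h\<close> by the integral inverse of \<open>h\<close> keeps its entries small at \<open>x\<close>.
\<close>

lemma K_prime_coset:
  assumes "g \<in> K_max" "h \<in> K_max" "\<And>i j. adele_norm place_zero ((g - h) $ i $ j) < 1"
  obtains k where "k \<in> K_prime" "g = h ** k"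
proof -
  obtain h' where h': "h' \<in> GL2_adeles" "h ** h' = mat 1" "h' ** h = mat 1"
    using GL2_adeles_inverse assms(2) K_max_subset_GL2 by blast
  have h'K: "h' \<in> K_max" using K_max_inverse[OF assms(2) h'(2)] .
  have "h' ** g - mat 1 = h' ** (g - h)"
    using h'(3) by (simp add: mat2_mult_diff_right)
  moreover have "adele_norm place_zero ((h' ** (g - h)) $ i $ j) < 1" for i j
    by (rule K_max_mult_small[OF h'K assms(3)])
  ultimately have "h' ** g \<in> K_prime"
    using K_max_mult[OF h'K assms(1)] by (simp add: K_prime_iff)
  moreover have "g = h ** (h' ** g)" by (simp add: matrix_mul_assoc h')
  ultimately show ?thesis by (rule that)
qed

lemma K_prime_coset_close:
  assumes "h \<in> K_max" "k \<in> K_prime"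
  shows "adele_norm place_zero ((h ** k - h) $ i $ j) < 1"
proof -
  have "h ** k - h = h ** (k - mat 1)" by (simp add: mat2_mult_diff_right)
  moreover have "adele_norm place_zero ((h ** (k - mat 1)) $ i $ j) < 1"
    using assms(2) by (intro K_max_mult_small[OF assms(1)]) (simp add: K_prime_iff)
  ultimately show ?thesis by simp
qed

abbreviation scalar2 :: "'a::zero \<Rightarrow> 'a ^ 2 ^ 2" where
  "scalar2 u \<equiv> mat2 u 0 0 u"

lemma scalar2_commute:
  fixes g :: "'a::comm_ring_1 ^ 2 ^ 2"
  shows "scalar2 u ** g = g ** scalar2 u"
proof -
  obtain a b c d where "g = mat2 a b c d" by (rule mat2_cases)
  then show ?thesis by (simp add: mat2_mult mult.commute)
qed

text \<open>
  At each place divide the bottom row by its larger entry: the row becomes primitive, and completing it by a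
  suitable unit vector gives the matrix \<open>\<kappa>\<close>. The places where the second entry is the
  larger one form the set \<open>S\<close> along which the two choices are glued.
\<close>

lemma iwasawa:
  fixes g :: "'k::{field,finite} adele_mat"
  assumes "g \<in> GL2_adeles"
  obtains a b z \<kappa> where "a dvd 1" "z dvd 1" "\<kappa> \<in> K_max"
    "g = mat2 a b 0 1 ** \<kappa> ** scalar2 z"
    "\<And>y. adele_norm y z = max (adele_norm y (g $ 2 $ 1)) (adele_norm y (g $ 2 $ 2))"
proof -
  define c d where "c = g $ 2 $ 1" and "d = g $ 2 $ 2"
  let ?v = "vector [0, 1] :: 'k ratfun ^ 2"
  have v: "?v \<noteq> 0" by (metis vector_2(2) zero_index zero_neq_one)
  have row: "row_norm y (principal_vec ?v v* g) = max (adele_norm y c) (adele_norm y d)" for y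
    by (simp add: row_norm_def row_mult_nth principal_vec_def c_def d_def)
  define S where "S = {y. adele_norm y c \<le> adele_norm y d}"
  define z where "z = mix_adele S d c"
  have z: "adele_norm y z = max (adele_norm y c) (adele_norm y d)" for y
    by (auto simp: z_def adele_norm_mix S_def)
  have zu: "z dvd 1"
    unfolding adele_unit_iff z using row_norm_GL2[OF v assms] unfolding row by (metis less_irrefl)
  then obtain zi where zi: "z * zi = 1" by (metis dvdE)
  have zin: "adele_norm y z * adele_norm y zi = 1" for y using zi by (metis adele_norm_mult adele_norm_1)
  have le: "adele_norm y (c * zi) \<le> 1" "adele_norm y (d * zi) \<le> 1" for y
    unfolding zin[of y, symmetric] adele_norm_mult by (simp_all add: mult_right_mono z)
  define \<kappa> where "\<kappa> = mat2 (mix_adele S 1 0) (mix_adele S 0 1) (c * zi) (d * zi)"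
  have "mix_adele S 1 0 * u = mix_adele S u 0" "mix_adele S 0 1 * u = mix_adele S 0 u" for u
    using mix_adele_mult[of S 1 0 u u] mix_adele_mult[of S 0 1 u u] by simp_all
  then have "det \<kappa> = mix_adele S (d * zi) (- (c * zi))" by (simp add: \<kappa>_def mix_adele_diff)
  moreover have "adele_norm y (mix_adele S (d * zi) (- (c * zi))) = 1" for y
    using zin[of y] by (auto simp: adele_norm_mix adele_norm_mult z S_def max_def split: if_splits)
  ultimately have "adele_norm y (det \<kappa>) = 1" for y by simp
  moreover have "adele_norm y (\<kappa> $ i $ j) \<le> 1" for y i j
    using exhaust_2[of i] exhaust_2[of j] le by (auto simp: \<kappa>_def adele_norm_mix)
  ultimately have \<kappa>: "\<kappa> \<in> K_max" by (simp add: K_max_iff)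
  then obtain h where h: "\<kappa> ** h = mat 1" "h ** \<kappa> = mat 1"
    using GL2_adeles_inverse K_max_subset_GL2 by blast
  have "(g ** h) $ 2 $ j = z * (\<kappa> ** h) $ 2 $ j" for j
  proof -
    have "z * (c * zi) = c" "z * (d * zi) = d" using zi by (simp_all add: mult.left_commute)
    then show ?thesis
      by (simp add: matrix_matrix_mult_def sum_2 \<kappa>_def c_def d_def distrib_left flip: mult.assoc)
  qed
  then have "(g ** h) $ 2 $ 1 = 0" "(g ** h) $ 2 $ 2 = z" by (simp_all add: h mat_def)
  then obtain p r where pr: "g ** h = mat2 p r 0 z" by (metis mat2_cases mat2_nth(3,4))
  have "g = g ** h ** \<kappa>" by (simp add: h flip: matrix_mul_assoc)
  also have "g ** h = mat2 (p * zi) (r * zi) 0 1 ** scalar2 z"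
    using zi by (simp add: pr mat2_mult mult.assoc mult.commute[of zi])
  finally have g: "g = mat2 (p * zi) (r * zi) 0 1 ** \<kappa> ** scalar2 z"
    by (simp add: scalar2_commute flip: matrix_mul_assoc)
  have "det g dvd 1" using assms by (simp add: GL2_adeles_iff)
  then have "p * zi dvd 1" unfolding g by (auto simp: det_mul dest: dvd_mult_left)
  then show ?thesis using that zu \<kappa> g z by (simp add: c_def d_def)
qed

lemma mat2_upper_invertible [simp]:
  "invertible (mat2 a b 0 1) \<longleftrightarrow> (a :: 'a::field) \<noteq> 0"
  by (simp add: invertible_iff_det_unit dvd_field_iff)

text \<open>
  If \<open>a\<close> has norm at least \<open>1\<close> at \<open>x\<close>, the entry \<open>b\<close> is
  absorbed into \<open>K\<close>. Otherwise both entries of the first row are smaller than \<open>1\<close> at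
  \<open>x\<close>; exchanging the rows and triangularizing again divides the norm of \<open>a\<close> at
  \<open>x\<close> by the square of the norm of that row, which makes it larger. This is the splitting of
  vector bundles on the projective line in matrix form.
\<close>

lemma triangular_reduction:
  fixes a b :: "'k::{field,finite} adele"
  assumes "a dvd 1" "\<And>y. y \<noteq> place_zero \<Longrightarrow> adele_norm y a = 1"
    "adele_norm place_zero a \<ge> inverse (real CARD('k) ^ m)"
    "\<And>y. adele_norm y b \<le> 1" "adele_norm place_zero b < 1"
  shows "\<exists>\<gamma> a' \<kappa> z. invertible \<gamma> \<and> \<kappa> \<in> K_max \<and> z dvd 1 \<and>
    principal_mat \<gamma> ** mat2 a b 0 1 = mat2 a' 0 0 1 ** \<kappa> ** scalar2 z \<and>
    a' dvd 1 \<and> (\<forall>y. y \<noteq> place_zero \<longrightarrow> adele_norm y a' = 1) \<and> adele_norm place_zero a' \<ge> 1"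
  using assms
proof (induction m arbitrary: a b)
  have big: "\<exists>\<gamma> a' \<kappa> z. invertible \<gamma> \<and> \<kappa> \<in> K_max \<and> z dvd 1 \<and>
    principal_mat \<gamma> ** mat2 a b 0 1 = mat2 a' 0 0 1 ** \<kappa> ** scalar2 z \<and>
    a' dvd 1 \<and> (\<forall>y. y \<noteq> place_zero \<longrightarrow> adele_norm y a' = 1) \<and> adele_norm place_zero a' \<ge> 1"
    if a: "a dvd 1" "\<And>y. y \<noteq> place_zero \<Longrightarrow> adele_norm y a = 1" "adele_norm place_zero a \<ge> 1"
      and b: "\<And>y. adele_norm y b \<le> 1" for a b :: "'k adele"
  proof -
    obtain c where c: "a * c = 1" using a(1) by (metis dvdE)
    have n: "adele_norm y a * adele_norm y c = 1" for y using c by (metis adele_norm_mult adele_norm_1)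
    have "adele_norm y c \<le> 1" for y
    proof (cases "y = place_zero")
      case True
      have "1 * adele_norm y c \<le> adele_norm y a * adele_norm y c"
        using a(3) True by (intro mult_right_mono) auto
      then show ?thesis using n[of y] by simp
    qed (use n[of y] a(2)[of y] in simp)
    then have "adele_norm y (mat2 1 (c * b) 0 1 $ i $ j) \<le> 1" for y i j
      using exhaust_2[of i] exhaust_2[of j] b by (auto simp: adele_norm_mult_le)
    then have "mat2 1 (c * b) 0 1 \<in> K_max" by (simp add: K_max_iff)
    moreover have "principal_mat (mat 1) ** mat2 a b 0 1 = mat2 a 0 0 1 ** mat2 1 (c * b) 0 1 ** scalar2 1"
      using c by (simp add: mat2_mult flip: mult.assoc)
    moreover have "invertible (mat 1 :: 'k ratfun ^ 2 ^ 2)" by (simp add: invertible_iff_det_unit)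
    ultimately show ?thesis using a by (metis dvd_refl)
  qed
  {
    case 0
    then show ?case by (intro big) auto
  next
    case (Suc m)
    show ?case
    proof (cases "adele_norm place_zero a \<ge> 1")
      case True
      then show ?thesis using Suc.prems by (intro big) auto
    next
      case False
      let ?w = "mat2 0 1 1 0 :: 'k ratfun ^ 2 ^ 2"
      have w: "principal_mat ?w ** mat2 a b 0 1 = mat2 0 1 a b"
        by (simp add: principal_mat_mat2 mat2_mult)
      have "mat2 0 1 a b \<in> GL2_adeles" using Suc.prems by (simp add: GL2_adeles_iff)
      then obtain a' b' z \<kappa> where 1: "a' dvd 1" "z dvd 1" "\<kappa> \<in> K_max"
          "mat2 0 1 a b = mat2 a' b' 0 1 ** \<kappa> ** scalar2 z"
        and z': "\<And>y. adele_norm y z = max (adele_norm y (mat2 0 1 a b $ 2 $ 1)) (adele_norm y (mat2 0 1 a b $ 2 $ 2))"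
        by (rule iwasawa) (rule that)
      have z: "adele_norm y z = max (adele_norm y a) (adele_norm y b)" for y
        using z'[of y] by simp
      have "adele_norm y (det (mat2 0 1 a b)) = adele_norm y (det (mat2 a' b' 0 1 ** \<kappa> ** scalar2 z))" for y
        by (simp only: 1(4))
      then have det: "adele_norm y a = adele_norm y a' * (adele_norm y z * adele_norm y z)" for y
        using 1(3) by (simp add: det_mul adele_norm_mult K_max_iff)
      have "adele_norm y a' = 1" if "y \<noteq> place_zero" for y
      proof -
        have "adele_norm y z = 1" using z[of y] Suc.prems(2)[OF that] Suc.prems(4)[of y] by simp
        then show ?thesis using det[of y] Suc.prems(2)[OF that] by simp
      qed
      moreover have "adele_norm place_zero a' \<ge> inverse (real CARD('k) ^ m)"
      proof -
        let ?q = "real CARD('k)" and ?z = "adele_norm place_zero z"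
        have q: "?q > 1" by (rule card_gt_1)
        have z0: "?z > 0" using 1(2) by (rule adele_unit_norm)
        have "?z < 1" using z[of place_zero] False Suc.prems(5) by simp
        then have zq: "?z \<le> 1 / ?q" using adele_norm_zero_less[of z 1] by simp
        have "?z * ?z \<le> 1 / ?q * 1" using zq \<open>?z < 1\<close> z0 q by (intro mult_mono) auto
        then have *: "adele_norm place_zero a' * (?z * ?z) \<le> adele_norm place_zero a' * (1 / ?q)"
          by (intro mult_left_mono) auto
        have "inverse (?q ^ m) = inverse (?q ^ Suc m) * ?q" using q by simp
        also have "\<dots> \<le> adele_norm place_zero a * ?q" using Suc.prems(3) q by (intro mult_right_mono) auto
        also have "\<dots> \<le> adele_norm place_zero a'" using * q det[of place_zero] by (simp add: field_simps)
        finally show ?thesis .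
      qed
      moreover obtain f where f: "\<And>y. adele_norm y (b' - principal_adele f) \<le> 1"
        "adele_norm place_zero (b' - principal_adele f) < 1"
        by (rule strong_approximation) blast
      ultimately obtain \<gamma> a'' \<kappa>' z' where 2: "invertible \<gamma>" "\<kappa>' \<in> K_max" "z' dvd 1"
        "principal_mat \<gamma> ** mat2 a' (b' - principal_adele f) 0 1 = mat2 a'' 0 0 1 ** \<kappa>' ** scalar2 z'"
        "a'' dvd 1" "\<forall>y. y \<noteq> place_zero \<longrightarrow> adele_norm y a'' = 1" "adele_norm place_zero a'' \<ge> 1"
        using Suc.IH[of a' "b' - principal_adele f"] 1(1) by blast
      let ?u = "mat2 1 (- f) 0 1 :: 'k ratfun ^ 2 ^ 2"
      have u: "principal_mat ?u ** mat2 a' b' 0 1 = mat2 a' (b' - principal_adele f) 0 1"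
        by (simp add: principal_mat_mat2 mat2_mult)
      have "principal_mat (\<gamma> ** ?u ** ?w) ** mat2 a b 0 1 =
          principal_mat \<gamma> ** (principal_mat ?u ** (principal_mat ?w ** mat2 a b 0 1))"
        by (simp add: principal_mat_mult matrix_mul_assoc)
      also have "\<dots> = principal_mat \<gamma> ** (principal_mat ?u ** (mat2 a' b' 0 1 ** \<kappa> ** scalar2 z))"
        by (simp only: w 1(4))
      also have "\<dots> = principal_mat \<gamma> ** (principal_mat ?u ** mat2 a' b' 0 1) ** \<kappa> ** scalar2 z"
        by (simp only: matrix_mul_assoc)
      also have "\<dots> = mat2 a'' 0 0 1 ** \<kappa>' ** (scalar2 z' ** \<kappa>) ** scalar2 z"
        by (simp only: u 2(4) matrix_mul_assoc)
      also have "\<dots> = mat2 a'' 0 0 1 ** (\<kappa>' ** \<kappa>) ** (scalar2 z' ** scalar2 z)"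
        by (simp only: scalar2_commute[of z' \<kappa>] matrix_mul_assoc)
      also have "scalar2 z' ** scalar2 z = scalar2 (z' * z)" by (simp add: mat2_mult)
      finally have "principal_mat (\<gamma> ** ?u ** ?w) ** mat2 a b 0 1 =
        mat2 a'' 0 0 1 ** (\<kappa>' ** \<kappa>) ** scalar2 (z' * z)" .
      moreover have "invertible (\<gamma> ** ?u ** ?w)"
        using 2(1) by (intro invertible_mult) (simp_all add: invertible_iff_det_unit)
      moreover have "\<kappa>' ** \<kappa> \<in> K_max" using 2 1 by (intro K_max_mult)
      moreover have "z' * z dvd 1" using mult_dvd_mono[OF 2(3) 1(2)] by simp
      ultimately show ?thesis using 2(5-7)
        by (intro exI[of _ "\<gamma> ** ?u ** ?w"] exI[of _ a''] exI[of _ "\<kappa>' ** \<kappa>"] exI[of _ "z' * z"] conjI)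
    qed
  }
qed

text \<open>
  Class number one normalizes the diagonal entry away from \<open>x\<close> and strong approximation makes the
  other entry small, which is the starting position of the preceding reduction. The result corresponds to the
  bundle \<open>O + O(n)\<close>, up to a twist.
\<close>

lemma reduction:
  fixes g :: "'k::{field,finite} adele_mat"
  assumes "g \<in> GL2_adeles"
  obtains \<gamma> a \<kappa> z n where "invertible \<gamma>" "\<kappa> \<in> K_max" "z dvd 1"
    "principal_mat \<gamma> ** g = mat2 a 0 0 1 ** \<kappa> ** scalar2 z"
    "a dvd 1" "\<And>y. y \<noteq> place_zero \<Longrightarrow> adele_norm y a = 1" "adele_norm place_zero a = real CARD('k) ^ n"
proof -
  obtain a b z \<kappa> where 1: "a dvd 1" "z dvd 1" "\<kappa> \<in> K_max" "g = mat2 a b 0 1 ** \<kappa> ** scalar2 z"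
    and "\<And>y. adele_norm y z = max (adele_norm y (g $ 2 $ 1)) (adele_norm y (g $ 2 $ 2))"
    by (rule iwasawa[OF assms]) (rule that)
  have "finite {y. y \<noteq> place_zero \<and> adele_norm y a \<noteq> 1}" "\<And>y. adele_norm y a \<noteq> 0"
    using adele_unit_norm[OF 1(1)] by (auto simp: less_le)
  then obtain \<alpha> where \<alpha>: "\<alpha> \<noteq> 0" "\<And>y. y \<noteq> place_zero \<Longrightarrow> adele_norm y (principal_adele \<alpha> * a) = 1"
    using idele_class_number_one by blast
  define a' where "a' = principal_adele \<alpha> * a"
  have "principal_adele \<alpha> dvd 1"
    using \<alpha>(1) by (metis dvdI principal_adele_simps(2,4) right_inverse)
  then have a'u: "a' dvd 1" using mult_dvd_mono[OF _ 1(1)] by (simp add: a'_def)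
  obtain f where f: "\<And>y. adele_norm y (principal_adele \<alpha> * b - principal_adele f) \<le> 1"
        "adele_norm place_zero (principal_adele \<alpha> * b - principal_adele f) < 1"
    by (rule strong_approximation) blast
  define b' where "b' = principal_adele \<alpha> * b - principal_adele f"
  have q: "real CARD('k) > 1" by (rule card_gt_1)
  obtain m where "inverse (adele_norm place_zero a') < real CARD('k) ^ m"
    using real_arch_pow[OF q] by blast
  then have m: "inverse (real CARD('k) ^ m) \<le> adele_norm place_zero a'"
    using adele_unit_norm(1)[OF a'u, of place_zero] q by (simp add: field_simps)
  have "\<exists>\<gamma> a'' \<kappa> z. invertible \<gamma> \<and> \<kappa> \<in> K_max \<and> z dvd 1 \<and>
    principal_mat \<gamma> ** mat2 a' b' 0 1 = mat2 a'' 0 0 1 ** \<kappa> ** scalar2 z \<and>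
    a'' dvd 1 \<and> (\<forall>y. y \<noteq> place_zero \<longrightarrow> adele_norm y a'' = 1) \<and> adele_norm place_zero a'' \<ge> 1"
    by (rule triangular_reduction[OF a'u _ m]) (use \<alpha> f in \<open>auto simp: a'_def b'_def\<close>)
  then obtain \<gamma> a'' \<kappa>' z' where 2: "invertible \<gamma>" "\<kappa>' \<in> K_max" "z' dvd 1"
    "principal_mat \<gamma> ** mat2 a' b' 0 1 = mat2 a'' 0 0 1 ** \<kappa>' ** scalar2 z'"
    "a'' dvd 1" "\<And>y. y \<noteq> place_zero \<Longrightarrow> adele_norm y a'' = 1" "adele_norm place_zero a'' \<ge> 1" by blast
  let ?u = "mat2 \<alpha> (- f) 0 1 :: 'k ratfun ^ 2 ^ 2"
  have u: "principal_mat ?u ** mat2 a b 0 1 = mat2 a' b' 0 1"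
    by (simp add: principal_mat_mat2 mat2_mult a'_def b'_def)
  have "principal_mat (\<gamma> ** ?u) ** g = principal_mat \<gamma> ** (principal_mat ?u ** mat2 a b 0 1) ** \<kappa> ** scalar2 z"
    by (simp only: principal_mat_mult matrix_mul_assoc 1(4))
  also have "\<dots> = mat2 a'' 0 0 1 ** \<kappa>' ** (scalar2 z' ** \<kappa>) ** scalar2 z"
    by (simp only: u 2(4) matrix_mul_assoc)
  also have "\<dots> = mat2 a'' 0 0 1 ** (\<kappa>' ** \<kappa>) ** (scalar2 z' ** scalar2 z)"
    by (simp only: scalar2_commute[of z' \<kappa>] matrix_mul_assoc)
  also have "scalar2 z' ** scalar2 z = scalar2 (z' * z)" by (simp add: mat2_mult)
  finally have 3: "principal_mat (\<gamma> ** ?u) ** g = mat2 a'' 0 0 1 ** (\<kappa>' ** \<kappa>) ** scalar2 (z' * z)" .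
  have "adele_norm place_zero a'' \<noteq> 0" using 2(7) by linarith
  then obtain k where k: "adele_norm place_zero a'' = real CARD('k) powi k"
    by (rule adele_norm_zero_value)
  have "k \<ge> 0"
  proof (rule ccontr)
    assume "\<not> k \<ge> 0"
    then have "real CARD('k) powi k \<le> real CARD('k) powi (- 1)"
      using q by (intro power_int_increasing) auto
    also have "\<dots> < 1" using q by (simp add: power_int_minus inverse_less_1_iff)
    finally show False using 2(7) k by simp
  qed
  then have "adele_norm place_zero a'' = real CARD('k) ^ nat k" by (simp add: k power_int_def)
  moreover have "invertible (\<gamma> ** ?u)" using 2(1) \<alpha>(1) by (intro invertible_mult) simp_all
  moreover have "\<kappa>' ** \<kappa> \<in> K_max" using 2 1 by (intro K_max_mult)
  moreover have "z' * z dvd 1" using mult_dvd_mono[OF 2(3) 1(2)] by simp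
  ultimately show ?thesis using that[of "\<gamma> ** ?u" "\<kappa>' ** \<kappa>" "z' * z" a'' "nat k"] 3 2(5,6) by simp
qed


section \<open>Destabilizing vectors\<close>

text \<open>
  The entrywise residues of \<open>k\<close> at \<open>x\<close> form an invertible matrix over the field of
  constants: its determinant is the residue of the unit \<open>det k\<close>.
\<close>

lemma residue_matrix:
  assumes "k \<in> K_max"
  obtains c :: "'k::{field,finite} ^ 2 ^ 2" where
    "\<And>i j. adele_norm place_zero ((k - principal_mat (\<chi> i j. ratfun_const (c $ i $ j))) $ i $ j) < 1"
    "invertible (\<chi> i j. ratfun_const (c $ i $ j))" "principal_mat (\<chi> i j. ratfun_const (c $ i $ j)) \<in> K_max"
proof -
  have "\<exists>c. adele_norm place_zero (k $ i $ j - principal_adele (ratfun_const c)) < 1" for i j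
    using residue_exists[of "k $ i $ j"] assms unfolding K_max_iff by metis
  then obtain c where c: "\<And>i j. adele_norm place_zero (k $ i $ j - principal_adele (ratfun_const (c i j))) < 1"
    by metis
  define C where "C = principal_mat (\<chi> i j. ratfun_const (c i j))"
  have C: "C $ i $ j = principal_adele (ratfun_const (c i j))" for i j
    by (simp add: C_def principal_mat_def)
  have k: "adele_norm y (k $ i $ j) \<le> 1" "adele_norm y (C $ i $ j) \<le> 1" for y i j
    using assms by (simp_all add: K_max_iff C place_abs_const)
  define d where "d = c 1 1 * c 2 2 - c 1 2 * c 2 1"
  have dC: "det C = principal_adele (ratfun_const d)"
    by (simp add: det_2 C d_def)
  have small: "adele_norm place_zero (a * b - a' * b') < 1"
    if "adele_norm place_zero (a - a') < 1" "adele_norm place_zero (b - b') < 1"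
       "adele_norm place_zero a \<le> 1" "adele_norm place_zero b' \<le> 1" for a b a' b' :: "'k adele"
  proof -
    have "adele_norm place_zero (a * (b - b')) < 1" "adele_norm place_zero ((a - a') * b') < 1"
      using mult_right_mono[OF that(3), of "adele_norm place_zero (b - b')"]
        mult_left_mono[OF that(4), of "adele_norm place_zero (a - a')"] that
      by (auto simp: adele_norm_mult)
    then have "adele_norm place_zero (a * (b - b') + (a - a') * b') < 1" by (rule adele_norm_add_less)
    then show ?thesis by (simp add: algebra_simps)
  qed
  have "adele_norm place_zero ((k $ 1 $ 1 * k $ 2 $ 2 - C $ 1 $ 1 * C $ 2 $ 2) - (k $ 1 $ 2 * k $ 2 $ 1 - C $ 1 $ 2 * C $ 2 $ 1)) < 1"
    by (rule adele_norm_diff_less; rule small) (use c k in \<open>auto simp: C\<close>)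
  then have "adele_norm place_zero (det k - det C) < 1" by (simp add: det_2 algebra_simps)
  then have "adele_norm place_zero (det C - det k) < adele_norm place_zero (det k)"
    using assms by (simp add: K_max_iff adele_norm_diff_commute)
  then have "adele_norm place_zero (det C) = adele_norm place_zero (det k)" by (rule adele_norm_eqI_close)
  then have "d \<noteq> 0" using assms by (auto simp: K_max_iff dC)
  then have "C \<in> K_max" using k by (simp add: K_max_iff dC place_abs_const)
  moreover have "det ((\<chi> i j. ratfun_const (c i j)) :: 'k ratfun ^ 2 ^ 2) = ratfun_const d"
    by (simp add: det_2 d_def)
  then have "invertible ((\<chi> i j. ratfun_const (c i j)) :: 'k ratfun ^ 2 ^ 2)"
    using \<open>d \<noteq> 0\<close> by (simp add: invertible_iff_det_unit dvd_field_iff) (metis place_abs_0 place_abs_const zero_neq_one)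
  ultimately show ?thesis using c by (intro that[of "\<chi> i j. c i j"]) (simp_all add: C_def[symmetric] C)
qed

text \<open>
  In terms of bundles: the line subbundle spanned by \<open>v\<close> has a degree that exceeds that of the
  quotient by \<open>n\<close>. For \<open>n > 0\<close> this is the Harder-Narasimhan filtration. Since
  \<open>n\<close> is a natural number, the condition on a single \<open>v\<close> determines
  \<open>n\<close>.
\<close>

definition destabilizes :: "nat \<Rightarrow> ('k::{field,finite}) ratfun ^ 2 \<Rightarrow> 'k adele_mat \<Rightarrow> bool" where
  "destabilizes n v g \<longleftrightarrow> v \<noteq> 0 \<and>
     real CARD('k) ^ n * row_size (principal_vec v v* g) ^ 2 = idele_size (det g)"

lemma row_norm_smult: "row_norm y (principal_vec (c *s v) v* g) = place_abs y c * row_norm y (principal_vec v v* g)"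
proof -
  have "(principal_vec (c *s v) v* g) $ j = principal_adele c * (principal_vec v v* g) $ j" for j
    by (simp add: row_mult_nth principal_vec_def algebra_simps)
  then show ?thesis by (simp add: row_norm_def adele_norm_mult max_mult_distrib_left)
qed

lemma row_size_smult:
  assumes "c \<noteq> 0" "v \<noteq> 0" "g \<in> GL2_adeles"
  shows "row_size (principal_vec (c *s v) v* g) = row_size (principal_vec v v* g)"
  unfolding row_size_def row_norm_smult
  using Prod_any.distrib[OF place_abs_product_formula(1)[OF assms(1)] row_norm_GL2(1)[OF assms(2,3)]]
    place_abs_product_formula(2)[OF assms(1)] by simp

lemma proportional_if_det_0:
  fixes v w :: "'a::field ^ 2"
  assumes "v \<noteq> 0" "w \<noteq> 0" "v $ 1 * w $ 2 = v $ 2 * w $ 1"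
  obtains c where "c \<noteq> 0" "w = c *s v"
proof -
  obtain i where i: "v $ i \<noteq> 0" using assms(1) by (auto simp: vec_eq_iff)
  have "w $ j * v $ i = w $ i * v $ j" for j
    using exhaust_2[of i] exhaust_2[of j] assms(3) by (elim disjE) (simp_all add: mult.commute)
  then have "(w $ i / v $ i) * v $ j = w $ j" for j using i by (simp add: field_simps)
  then have "(w $ i / v $ i) *s v = w" by (simp add: vec_eq_iff)
  moreover from this have "w $ i / v $ i \<noteq> 0" using assms(2) by (metis vector_smult_lzero)
  ultimately show ?thesis using that by metis
qed

text \<open>
  The determinant of the two rows \<open>v g\<close> and \<open>w g\<close> is \<open>det g\<close> times a
  nonzero element of \<open>F\<close>, whose size is \<open>1\<close> by the product formula; locally it is at
  most the product of the row norms.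
\<close>

lemma idele_size_det_le:
  assumes g: "g \<in> GL2_adeles" and vw: "v \<noteq> 0" "w \<noteq> 0" and ne: "v $ 1 * w $ 2 \<noteq> v $ 2 * w $ 1"
  shows "idele_size (det g) \<le> row_size (principal_vec v v* g) * row_size (principal_vec w v* g)"
proof -
  define \<delta> where "\<delta> = v $ 1 * w $ 2 - v $ 2 * w $ 1"
  have \<delta>: "\<delta> \<noteq> 0" using ne by (simp add: \<delta>_def)
  let ?v = "principal_vec v v* g" and ?w = "principal_vec w v* g"
  have "principal_adele \<delta> dvd 1" using \<delta> by (metis dvdI principal_adele_simps(2,4) right_inverse)
  then have "idele_size (det g) = idele_size (principal_adele \<delta> * det g)"
    using g \<delta> by (simp add: idele_size_mult idele_size_principal GL2_adeles_iff)
  also have "principal_adele \<delta> * det g = ?v $ 1 * ?w $ 2 - ?v $ 2 * ?w $ 1"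
    by (simp add: row_mult_nth principal_vec_def det_2 \<delta>_def algebra_simps)
  also have "idele_size \<dots> \<le> (\<Prod>y. row_norm y ?v * row_norm y ?w)"
    unfolding idele_size_def
  proof (rule Prod_any_mono)
    have "?v $ 1 * ?w $ 2 - ?v $ 2 * ?w $ 1 = principal_adele \<delta> * det g"
      by (simp add: row_mult_nth principal_vec_def det_2 \<delta>_def algebra_simps)
    moreover have "principal_adele \<delta> * det g dvd 1"
      using \<open>principal_adele \<delta> dvd 1\<close> g mult_dvd_mono[of _ 1 _ 1] by (simp add: GL2_adeles_iff)
    ultimately show "finite {y. adele_norm y (?v $ 1 * ?w $ 2 - ?v $ 2 * ?w $ 1) \<noteq> 1}"
      by (simp add: adele_unit_norm)
    have "finite ({y. row_norm y ?v \<noteq> 1} \<union> {y. row_norm y ?w \<noteq> 1})"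
      using row_norm_GL2(1) g vw by blast
    then show "finite {y. row_norm y ?v * row_norm y ?w \<noteq> 1}" by (rule rev_finite_subset) auto
    show "adele_norm y (?v $ 1 * ?w $ 2 - ?v $ 2 * ?w $ 1) \<le> row_norm y ?v * row_norm y ?w" for y
      by (intro adele_norm_diff_le; unfold adele_norm_mult; intro mult_mono)
         (auto simp: row_norm_def le_max_iff_disj)
  qed simp
  also have "\<dots> = row_size ?v * row_size ?w"
    unfolding row_size_def by (rule Prod_any.distrib) (use row_norm_GL2(1) g vw in blast)+
  finally show ?thesis .
qed

text \<open>
  Two independent destabilizing vectors with invariants \<open>n\<close> and \<open>m\<close> would give
  \<open>q ^ (n + m) \<le> 1\<close> by the preceding inequality, so \<open>n = m = 0\<close>. Proportional
  vectors have rows of the same size.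
\<close>

lemma destabilizes_unique:
  fixes g :: "'k::{field,finite} adele_mat"
  assumes g: "g \<in> GL2_adeles" and d: "destabilizes n v g" "destabilizes m w g"
  shows "n = m" and "n > 0 \<Longrightarrow> \<exists>c. c \<noteq> 0 \<and> w = c *s v"
proof -
  let ?q = "real CARD('k)"
  have q: "?q > 1" by (rule card_gt_1)
  have vw: "v \<noteq> 0" "w \<noteq> 0" using d by (auto simp: destabilizes_def)
  have eq: "?q ^ n * row_size (principal_vec v v* g) ^ 2 = idele_size (det g)"
    "?q ^ m * row_size (principal_vec w v* g) ^ 2 = idele_size (det g)"
    using d by (simp_all add: destabilizes_def)
  have "n = m \<and> (n > 0 \<longrightarrow> (\<exists>c. c \<noteq> 0 \<and> w = c *s v))"
  proof (cases "v $ 1 * w $ 2 = v $ 2 * w $ 1")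
    case True
    obtain c where c: "c \<noteq> 0" "w = c *s v" using proportional_if_det_0[OF vw True] by blast
    then have "row_size (principal_vec w v* g) = row_size (principal_vec v v* g)"
      using row_size_smult vw g by blast
    then have "?q ^ n * row_size (principal_vec v v* g) ^ 2 = ?q ^ m * row_size (principal_vec v v* g) ^ 2"
      using eq by metis
    then have "?q ^ n = ?q ^ m" using row_size_pos[OF vw(1) g] by simp
    then have "n = m" using q by simp
    with c show ?thesis by blast
  next
    case False
    define D where "D = idele_size (det g)"
    define A B where "A = row_size (principal_vec v v* g)" and "B = row_size (principal_vec w v* g)"
    have pos: "D > 0" using g by (simp add: D_def GL2_adeles_iff idele_size_pos)
    have "D \<le> A * B" unfolding D_def A_def B_def by (rule idele_size_det_le[OF g vw False])
    then have "D * D \<le> (A * B) * (A * B)" using pos by (intro mult_mono) auto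
    then have "?q ^ (n + m) * (D * D) \<le> ?q ^ (n + m) * ((A * B) * (A * B))"
      by (intro mult_left_mono) auto
    also have "\<dots> = (?q ^ n * A ^ 2) * (?q ^ m * B ^ 2)" by (simp add: power_add power2_eq_square)
    also have "\<dots> = D * D" using eq by (simp add: A_def B_def D_def)
    finally have "?q ^ (n + m) \<le> 1" using pos by simp
    then have "n + m = 0" using q by (metis one_less_power neq0_conv not_le)
    then show ?thesis by simp
  qed
  then show "n = m" "n > 0 \<Longrightarrow> \<exists>c. c \<noteq> 0 \<and> w = c *s v" by auto
qed

lemma destabilizes_principal:
  assumes "invertible \<gamma>" "g \<in> GL2_adeles"
  shows "destabilizes n v (principal_mat \<gamma> ** g) \<longleftrightarrow> destabilizes n (v v* \<gamma>) g"
proof -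
  have d: "det \<gamma> \<noteq> 0" using assms(1) by (auto simp: invertible_iff_det_unit)
  then have "principal_adele (det \<gamma>) dvd 1" by (metis dvdI principal_adele_simps(2,4) right_inverse)
  then have "idele_size (det (principal_mat \<gamma> ** g)) = idele_size (det g)"
    using assms d by (simp add: det_mul det_principal_mat idele_size_mult idele_size_principal GL2_adeles_iff)
  moreover have "v v* \<gamma> = 0 \<longleftrightarrow> v = 0"
  proof
    obtain h where h: "\<gamma> ** h = mat 1" using assms(1) unfolding invertible_def by blast
    assume "v v* \<gamma> = 0"
    then have "(v v* \<gamma>) v* h = 0" by simp
    then show "v = 0" by (simp add: vector_matrix_mul_assoc h)
  qed simp
  ultimately show ?thesis
    by (simp add: destabilizes_def principal_vec_mult vector_matrix_mul_assoc)
qed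

lemma destabilizes_K:
  assumes "k \<in> K_max" "g \<in> GL2_adeles"
  shows "destabilizes n v (g ** k) \<longleftrightarrow> destabilizes n v g"
proof -
  have "idele_size (det (g ** k)) = idele_size (det g)"
    using assms(1) by (simp add: idele_size_def det_mul adele_norm_mult K_max_iff)
  moreover have "row_size (principal_vec v v* (g ** k)) = row_size (principal_vec v v* g)"
    by (simp add: row_size_def row_norm_K[OF assms(1)] flip: vector_matrix_mul_assoc)
  ultimately show ?thesis by (simp add: destabilizes_def)
qed

lemma destabilizes_scalar:
  assumes "u dvd 1" "g \<in> GL2_adeles"
  shows "destabilizes n v (g ** scalar2 u) \<longleftrightarrow> destabilizes n v g"
proof (cases "v = 0")
  case False
  have uu: "u * u dvd 1" using mult_dvd_mono[OF assms(1) assms(1)] by simp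
  have "idele_size (det (g ** scalar2 u)) = idele_size (det g) * idele_size u ^ 2"
    using assms uu by (simp add: det_mul idele_size_mult GL2_adeles_iff power2_eq_square)
  moreover have "row_size (principal_vec v v* (g ** scalar2 u)) = row_size (principal_vec v v* g) * idele_size u"
    unfolding row_size_def idele_size_def vector_matrix_mul_assoc [symmetric] row_norm_scalar
    by (rule Prod_any.distrib) (use row_norm_GL2[OF False assms(2)] adele_unit_norm[OF assms(1)] in auto)
  moreover have "idele_size u > 0" using assms(1) by (rule idele_size_pos)
  ultimately show ?thesis by (simp add: destabilizes_def power_mult_distrib)
qed (simp add: destabilizes_def)

text \<open>
  The normal form of the reduction theory has invariant \<open>n\<close>; this is how destabilizing vectors
  are found.
\<close>

lemma destabilizes_diagonal:
  assumes a: "\<And>y. y \<noteq> place_zero \<Longrightarrow> adele_norm y a = 1" "adele_norm place_zero a = real CARD('k) ^ n"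
  shows "destabilizes n (vector [0, 1]) (mat2 a 0 0 1 :: 'k::{field,finite} adele_mat)"
proof -
  have "row_norm y (principal_vec (vector [0, 1]) v* (mat2 a 0 0 1)) = 1" for y
    by (simp add: row_norm_def row_mult_nth principal_vec_def)
  moreover have "(vector [0, 1] :: 'k ratfun ^ 2) \<noteq> 0" by (metis vector_2(2) zero_index zero_neq_one)
  moreover have "idele_size a = (\<Prod>y\<in>{place_zero}. adele_norm y a)"
    unfolding idele_size_def by (rule Prod_any.expand_superset) (use a in auto)
  ultimately show ?thesis by (simp add: destabilizes_def row_size_def a)
qed

lemma destabilizes_exists:
  assumes "g \<in> GL2_adeles"
  shows "\<exists>n v. destabilizes n v g"
proof -
  obtain \<gamma> a \<kappa> z n where *: "invertible \<gamma>" "\<kappa> \<in> K_max" "z dvd 1"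
    "principal_mat \<gamma> ** g = mat2 a 0 0 1 ** \<kappa> ** scalar2 z"
    "a dvd 1" "\<And>y. y \<noteq> place_zero \<Longrightarrow> adele_norm y a = 1" "adele_norm place_zero a = real CARD('a) ^ n"
    using reduction[OF assms] by metis
  have "mat2 a 0 0 1 \<in> GL2_adeles" using * by (simp add: GL2_adeles_iff)
  moreover from this have "mat2 a 0 0 1 ** \<kappa> \<in> GL2_adeles" using * K_max_subset_GL2 GL2_adeles_mult by blast
  ultimately have "destabilizes n (vector [0, 1]) (principal_mat \<gamma> ** g)"
    using * by (simp add: destabilizes_scalar destabilizes_K destabilizes_diagonal)
  then show ?thesis using destabilizes_principal[OF *(1) assms] by blast
qed

text \<open>
  For \<open>n = 0\<close> the normal form lies in \<open>K\<close>, and the constant matrices, which are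
  automorphisms of the trivial bundle, act transitively on the cosets of \<open>K'\<close> in
  \<open>K\<close>. So the class of the identity is the only one with invariant \<open>0\<close>.
\<close>

lemma destabilizes_0_reduction:
  assumes g: "g \<in> GL2_adeles" and d: "destabilizes 0 v g"
  obtains \<gamma> k z where "invertible \<gamma>" "k \<in> K_prime" "z dvd 1" "principal_mat \<gamma> ** g = k ** scalar2 z"
proof -
  obtain \<gamma> a \<kappa> z n where *: "invertible \<gamma>" "\<kappa> \<in> K_max" "z dvd 1"
    "principal_mat \<gamma> ** g = mat2 a 0 0 1 ** \<kappa> ** scalar2 z"
    "a dvd 1" "\<And>y. y \<noteq> place_zero \<Longrightarrow> adele_norm y a = 1" "adele_norm place_zero a = real CARD('a) ^ n"
    using reduction[OF g] by metis
  have "mat2 a 0 0 1 \<in> GL2_adeles" using * by (simp add: GL2_adeles_iff)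
  moreover from this have "mat2 a 0 0 1 ** \<kappa> \<in> GL2_adeles" using * K_max_subset_GL2 GL2_adeles_mult by blast
  ultimately have "destabilizes n (vector [0, 1]) (principal_mat \<gamma> ** g)"
    using * by (simp add: destabilizes_scalar destabilizes_K destabilizes_diagonal)
  then have "n = 0"
    using destabilizes_principal[OF *(1) g] destabilizes_unique(1)[OF g d] by metis
  then have "adele_norm y a = 1" for y using *(6)[of y] *(7) by (cases "y = place_zero") auto
  then have "adele_norm y (mat2 a 0 0 1 $ i $ j) \<le> 1" "adele_norm y (det (mat2 a 0 0 1)) = 1" for y i j
    using exhaust_2[of i] exhaust_2[of j] by auto
  then have "mat2 a 0 0 1 \<in> K_max" by (simp add: K_max_iff)
  then have K: "mat2 a 0 0 1 ** \<kappa> \<in> K_max" using * by (intro K_max_mult)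
  obtain c :: "'a ^ 2 ^ 2" where c:
    "\<And>i j. adele_norm place_zero ((mat2 a 0 0 1 ** \<kappa> - principal_mat (\<chi> i j. ratfun_const (c $ i $ j))) $ i $ j) < 1"
    "invertible (\<chi> i j. ratfun_const (c $ i $ j))" "principal_mat (\<chi> i j. ratfun_const (c $ i $ j)) \<in> K_max"
    using residue_matrix[OF K] by blast
  obtain k where k: "k \<in> K_prime" "mat2 a 0 0 1 ** \<kappa> = principal_mat (\<chi> i j. ratfun_const (c $ i $ j)) ** k"
    using K_prime_coset[OF K c(3,1)] by blast
  obtain h where h: "invertible h" "h ** (\<chi> i j. ratfun_const (c $ i $ j)) = mat 1"
    using c(2) unfolding invertible_def by blast
  have "principal_mat (h ** \<gamma>) ** g = principal_mat h ** (principal_mat \<gamma> ** g)"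
    by (simp add: principal_mat_mult matrix_mul_assoc)
  also have "\<dots> = principal_mat (h ** (\<chi> i j. ratfun_const (c $ i $ j))) ** k ** scalar2 z"
    unfolding *(4) k(2) by (simp add: principal_mat_mult matrix_mul_assoc)
  finally have "principal_mat (h ** \<gamma>) ** g = k ** scalar2 z" by (simp add: h)
  then show ?thesis using that[of "h ** \<gamma>"] k(1) *(1,3) h(1) invertible_mult by blast
qed

text \<open>
  The level structure \<open>K'\<close> rigidifies the fibre at \<open>x\<close>, so the line spanned by
  \<open>v\<close> in this fibre is a point of the projective line over the residue field. The predicate says
  that it is the point \<open>(1 : 0)\<close>, which is the special point for the Hecke operator.
\<close>

definition flagged :: "('k::{field,finite}) ratfun ^ 2 \<Rightarrow> 'k adele_mat \<Rightarrow> bool" where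
  "flagged v g \<longleftrightarrow> adele_norm place_zero ((principal_vec v v* g) $ 2) < adele_norm place_zero ((principal_vec v v* g) $ 1)"

lemma flagged_smult:
  assumes "c \<noteq> 0"
  shows "flagged (c *s v) g \<longleftrightarrow> flagged v g"
proof -
  have "(principal_vec (c *s v) v* g) $ j = principal_adele c * (principal_vec v v* g) $ j" for j
    by (simp add: row_mult_nth principal_vec_def algebra_simps)
  then show ?thesis using place_abs_pos[OF assms, of place_zero] by (simp add: flagged_def adele_norm_mult)
qed

lemma flagged_principal: "flagged v (principal_mat \<gamma> ** g) \<longleftrightarrow> flagged (v v* \<gamma>) g"
  by (simp add: flagged_def principal_vec_mult vector_matrix_mul_assoc)

lemma flagged_scalar: "u dvd 1 \<Longrightarrow> flagged v (g ** scalar2 u) \<longleftrightarrow> flagged v g"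
  using adele_unit_norm(1)[of u place_zero]
  by (simp add: flagged_def row_mult_nth adele_norm_mult flip: vector_matrix_mul_assoc)

text \<open>
  A matrix congruent to the identity changes either entry of a row by less than the norm of the whole row.
\<close>

lemma flagged_K_prime:
  assumes "k \<in> K_prime"
  shows "flagged v (g ** k) \<longleftrightarrow> flagged v g"
proof -
  let ?w = "principal_vec v v* g" and ?N = "adele_norm (place_zero :: 'a place)"
  obtain a b c d where k: "k = mat2 a b c d" by (rule mat2_cases)
  have e: "?N (a - 1) < 1" "?N b < 1" "?N c < 1" "?N (d - 1) < 1"
  proof -
    have "\<forall>i j. ?N ((k - mat 1) $ i $ j) < 1" using assms by (simp add: K_prime_iff)
    then show "?N (a - 1) < 1" "?N b < 1" "?N c < 1" "?N (d - 1) < 1"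
      unfolding k mat2_1 mat2_diff by (metis mat2_nth diff_zero)+
  qed
  have n: "?N a = 1" "?N d = 1"
    using adele_norm_eqI_close[of place_zero a 1] adele_norm_eqI_close[of place_zero d 1] e by simp_all
  have w: "(principal_vec v v* (g ** k)) $ 1 = ?w $ 1 * a + ?w $ 2 * c"
    "(principal_vec v v* (g ** k)) $ 2 = ?w $ 2 * d + ?w $ 1 * b"
    by (simp_all add: k row_mult_nth flip: vector_matrix_mul_assoc)
  have small: "?N (u * e) < ?N w" if "?N u \<le> ?N w" "?N e < 1" "?N w > 0" for u e w
  proof -
    have "?N u * ?N e \<le> ?N w * ?N e" using that by (intro mult_right_mono) auto
    also have "\<dots> < ?N w * 1" using that by (intro mult_strict_left_mono) auto
    finally show ?thesis by (simp add: adele_norm_mult)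
  qed
  show ?thesis
  proof (cases "?N (?w $ 2) < ?N (?w $ 1)")
    case True
    then have p: "?N (?w $ 1) > 0" using adele_norm_nonneg[of place_zero "?w $ 2"] by linarith
    have 1: "?N (?w $ 1 * a + ?w $ 2 * c) = ?N (?w $ 1)"
      using adele_norm_add_dominant[of place_zero "?w $ 2 * c" "?w $ 1 * a"] small[of "?w $ 2" "?w $ 1" c] True e n p
      by (simp add: adele_norm_mult)
    have 2: "?N (?w $ 2 * d + ?w $ 1 * b) < ?N (?w $ 1)"
      using True n e small[of "?w $ 1" "?w $ 1" b] p by (intro adele_norm_add_less) (simp_all add: adele_norm_mult)
    show ?thesis using True 1 2 by (simp add: flagged_def w)
  next
    case False
    show ?thesis
    proof (cases "?N (?w $ 2) = 0")
      case True
      with False have "?N (?w $ 1) = 0" using adele_norm_nonneg[of place_zero "?w $ 1"] by linarith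
      with True have "?N (?w $ 1 * a + ?w $ 2 * c) \<le> 0"
        by (intro adele_norm_add_le) (simp_all add: adele_norm_mult)
      moreover have "?N (?w $ 2 * d + ?w $ 1 * b) \<ge> 0" by simp
      ultimately have "\<not> ?N (?w $ 2 * d + ?w $ 1 * b) < ?N (?w $ 1 * a + ?w $ 2 * c)" by linarith
      then show ?thesis using False by (simp add: flagged_def w)
    next
      case nz: False
      then have p: "?N (?w $ 2) > 0" by (simp add: less_le)
      have 2: "?N (?w $ 2 * d + ?w $ 1 * b) = ?N (?w $ 2)"
        using adele_norm_add_dominant[of place_zero "?w $ 1 * b" "?w $ 2 * d"] small[of "?w $ 1" "?w $ 2" b] False e n p
        by (simp add: adele_norm_mult)
      have 1: "?N (?w $ 1 * a + ?w $ 2 * c) \<le> ?N (?w $ 2)"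
        using False n e small[of "?w $ 2" "?w $ 2" c] p
        by (intro adele_norm_add_le) (simp_all add: adele_norm_mult)
      show ?thesis using False 1 2 by (simp add: flagged_def w)
    qed
  qed
qed

text \<open>
  On the trivial bundle every line in the fibre at \<open>x\<close> extends to a subbundle of degree
  \<open>0\<close>.
\<close>

lemma destabilizes_0_flagged:
  assumes g: "g \<in> GL2_adeles" and d: "destabilizes 0 v g"
  obtains w where "destabilizes 0 w g" "flagged w g"
proof -
  obtain \<gamma> k z where *: "invertible \<gamma>" "k \<in> K_prime" "z dvd 1" "principal_mat \<gamma> ** g = k ** scalar2 z"
    using destabilizes_0_reduction[OF assms] .
  let ?e = "vector [1, 0] :: 'a ratfun ^ 2"
  have k: "k \<in> K_max" "k \<in> GL2_adeles" using *(2) K_prime_subset_K_max K_max_subset_GL2 by auto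
  have "row_norm y (principal_vec ?e v* mat 1) = 1" for y
    by (simp add: row_norm_def principal_vec_def)
  moreover have "?e \<noteq> 0" by (metis vector_2(1) zero_index zero_neq_one)
  ultimately have "destabilizes 0 ?e (mat 1)"
    by (simp add: destabilizes_def row_size_def idele_size_def)
  then have "destabilizes 0 ?e (mat 1 ** k ** scalar2 z)"
    using k *(3) by (simp only: destabilizes_scalar destabilizes_K GL2_adeles_one GL2_adeles_mult)
  then have 1: "destabilizes 0 (?e v* \<gamma>) g" using destabilizes_principal[OF *(1) g] *(4) by simp
  have "flagged ?e (mat 1)" by (simp add: flagged_def principal_vec_def)
  then have "flagged ?e (mat 1 ** k ** scalar2 z)" using *(2,3) by (simp only: flagged_scalar flagged_K_prime)
  then have 2: "flagged (?e v* \<gamma>) g" using flagged_principal[of ?e \<gamma> g] *(4) by simp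
  show ?thesis using 1 2 by (rule that)
qed


section \<open>The Hecke operator as a finite sum\<close>

definition tau :: "('k::{field,finite}) adele" where
  "tau = mix_adele {place_zero} (principal_adele ratfun_t) 1"

definition tau_inv :: "('k::{field,finite}) adele" where
  "tau_inv = mix_adele {place_zero} (principal_adele (inverse ratfun_t)) 1"

definition residue_rep :: "'k::{field,finite} \<Rightarrow> 'k adele" where
  "residue_rep b = mix_adele {place_zero} (principal_adele (ratfun_const b)) 0"

text \<open>
  This matrix is \<open>diag(t, 1)\<close> times a unipotent matrix with a constant entry, both at the place
  \<open>x\<close> only. The \<open>q\<close> constants give representatives of the cosets of
  \<open>K'\<close> in the Hecke double coset.
\<close>

definition hecke_rep :: "'k::{field,finite} \<Rightarrow> 'k adele_mat" where
  "hecke_rep b = mat2 tau (tau * residue_rep b) 0 1"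

definition hecke_rep_inv :: "'k::{field,finite} \<Rightarrow> 'k adele_mat" where
  "hecke_rep_inv b = mat2 tau_inv (- residue_rep b) 0 1"

lemma tau_mult_inv [simp]: "tau * tau_inv = 1" "tau_inv * tau = 1"
  by (simp_all add: tau_def tau_inv_def mix_adele_mult mult.commute flip: principal_adele_simps(4))

lemma tau_inv_mult_tau [simp]: "tau_inv * (u * tau) = u"
  by (metis mult.left_commute mult.right_neutral tau_mult_inv(2))

lemma adele_norm_tau: "adele_norm y (tau :: 'k::{field,finite} adele) = (if y = place_zero then 1 / real CARD('k) else 1)"
  by (simp add: tau_def adele_norm_mix place_abs_t inverse_eq_divide)

lemma adele_norm_tau_inv: "adele_norm y (tau_inv :: 'k::{field,finite} adele) = (if y = place_zero then real CARD('k) else 1)"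
  by (simp add: tau_inv_def adele_norm_mix place_abs_t place_abs_inverse)

lemma residue_rep_diff: "residue_rep b - residue_rep c = residue_rep (b - c)"
  by (simp add: residue_rep_def mix_adele_diff)

lemma residue_rep_0 [simp]: "residue_rep 0 = 0"
  by (simp add: residue_rep_def)

lemma adele_norm_residue_rep:
  "adele_norm y (residue_rep b) = (if y = place_zero \<and> b \<noteq> 0 then 1 else 0)"
  by (simp add: residue_rep_def adele_norm_mix place_abs_const)

lemma residue_rep_exists:
  assumes "adele_norm place_zero a \<le> 1"
  obtains b where "adele_norm place_zero (a - residue_rep b) < 1"
proof -
  obtain b where b: "adele_norm place_zero (a - principal_adele (ratfun_const b)) < 1"
    using residue_exists[OF assms] .
  let ?p = "principal_adele (ratfun_const b)"
  have "?p - residue_rep b = mix_adele {place_zero} 0 ?p"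
    using mix_adele_diff[of "{place_zero}" ?p ?p ?p 0] by (simp add: residue_rep_def)
  then have "adele_norm place_zero (?p - residue_rep b) < 1" by (simp add: adele_norm_mix)
  from adele_norm_add_less[OF b this] show ?thesis by (intro that[of b]) simp
qed

lemma residue_rep_unique:
  assumes "adele_norm place_zero (a - residue_rep b) < 1" "adele_norm place_zero (a - residue_rep c) < 1"
  shows "b = c"
proof -
  have "adele_norm place_zero ((a - residue_rep c) - (a - residue_rep b)) < 1"
    using assms(2,1) by (rule adele_norm_diff_less)
  also have "(a - residue_rep c) - (a - residue_rep b) = residue_rep (b - c)"
    by (simp flip: residue_rep_diff)
  finally show ?thesis by (simp add: adele_norm_residue_rep split: if_splits)
qed

lemma hecke_rep_inverse:
  "hecke_rep_inv b ** hecke_rep b = mat 1" "hecke_rep b ** hecke_rep_inv b = mat 1"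
  by (simp_all add: hecke_rep_def hecke_rep_inv_def mat2_mult mat2_1 flip: mult.assoc)

lemma hecke_rep_GL2: "hecke_rep b \<in> GL2_adeles" "hecke_rep_inv b \<in> GL2_adeles"
  using hecke_rep_inverse[of b] unfolding GL2_adeles_def invertible_def by blast+

lemma at_place_hecke_rep:
  "at_place place_zero (vector [vector [to_completion place_zero ratfun_t, to_completion place_zero 0],
     vector [to_completion place_zero 0, to_completion place_zero 1]]) = (hecke_rep 0 :: 'k::{field,finite} adele_mat)"
    (is "at_place _ ?m = _")
proof -
  have *: "Abs_adele (\<lambda>y. if y = place_zero then to_completion place_zero f else adele_at a y) =
      mix_adele {place_zero} (principal_adele f) a" for f :: "'k ratfun" and a
    unfolding mix_adele_def by (intro arg_cong[of _ _ Abs_adele] ext) (simp add: principal_adele.rep_eq)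
  show ?thesis
    by (rule mat2_eqI) (simp_all add: at_place_def hecke_rep_def tau_def mat_def * cong del: if_weak_cong)
qed

lemma K_prime_mult:
  assumes "g \<in> K_prime" "h \<in> K_prime"
  shows "g ** h \<in> K_prime"
proof -
  have K: "g \<in> K_max" "h \<in> K_max" using assms K_prime_subset_K_max by auto
  have "adele_norm place_zero ((g ** h - mat 1) $ i $ j) < 1" for i j
  proof -
    have "adele_norm place_zero ((g ** h - g) $ i $ j + (g - mat 1) $ i $ j) < 1"
      using K_prime_coset_close[OF K(1) assms(2), of i j] assms(1)
      by (intro adele_norm_add_less) (simp_all add: K_prime_iff)
    then show ?thesis by simp
  qed
  then show ?thesis using K by (simp add: K_prime_iff K_max_mult)
qed

lemma K_prime_mat2_iff:
  "mat2 a b c d \<in> K_prime \<longleftrightarrow> (\<forall>y. adele_norm y a \<le> 1 \<and> adele_norm y b \<le> 1 \<and> adele_norm y c \<le> 1 \<and> adele_norm y d \<le> 1 \<and>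
     adele_norm y (a * d - b * c) = 1) \<and> adele_norm place_zero (a - 1) < 1 \<and> adele_norm place_zero b < 1 \<and>
     adele_norm place_zero c < 1 \<and> adele_norm place_zero (d - 1) < 1"
  by (auto simp: K_prime_iff K_max_iff mat2_1 mat2_diff forall_2)

text \<open>
  The upper right entry \<open>e\<close> of \<open>k\<close> is divisible by the uniformizer, and the residue
  of \<open>e / t\<close> is the constant \<open>b\<close> for which the quotient of the two matrices is
  congruent to the identity.
\<close>

lemma K_prime_hecke_rep:
  assumes "k \<in> K_prime"
  obtains b k' where "k' \<in> K_prime" "k ** hecke_rep 0 = hecke_rep b ** k'"
proof -
  obtain a e c d where k: "k = mat2 a e c d" by (rule mat2_cases)
  note K = assms[unfolded k K_prime_mat2_iff]
  have q: "real CARD('a) > 1" by (rule card_gt_1)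
  have "adele_norm place_zero e \<le> 1 / real CARD('a)" using K adele_norm_zero_less[of e 1] by simp
  then have se: "adele_norm place_zero (tau_inv * e) \<le> 1"
    using q by (simp add: adele_norm_mult adele_norm_tau_inv field_simps)
  then obtain b where b: "adele_norm place_zero (tau_inv * e - residue_rep b) < 1" by (rule residue_rep_exists)
  let ?r = "residue_rep b"
  define k' where "k' = mat2 (a - ?r * c * tau) (tau_inv * e - ?r * d) (c * tau) d"
  have k': "k' = hecke_rep_inv b ** (k ** hecke_rep 0)"
    by (simp add: k'_def k hecke_rep_def hecke_rep_inv_def mat2_mult mult.assoc)
  have tau: "adele_norm y (tau :: 'a adele) \<le> 1" for y using q by (simp add: adele_norm_tau)
  have r: "adele_norm y ?r \<le> 1" for y by (simp add: adele_norm_residue_rep)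
  have le: "adele_norm y (a - ?r * c * tau) \<le> 1" "adele_norm y (c * tau) \<le> 1" for y
    using K r tau by (intro adele_norm_diff_le adele_norm_mult_le; simp)+
  have le2: "adele_norm y (tau_inv * e - ?r * d) \<le> 1" for y
  proof (rule adele_norm_diff_le)
    show "adele_norm y (tau_inv * e) \<le> 1" using se K by (cases "y = place_zero") (auto simp: adele_norm_mult adele_norm_tau_inv)
    show "adele_norm y (?r * d) \<le> 1" using K r by (intro adele_norm_mult_le) auto
  qed
  have "det k' = tau_inv * tau * det k"
    unfolding k' by (simp add: det_mul hecke_rep_def hecke_rep_inv_def)
  then have det: "adele_norm y (det k') = 1" for y using K by (simp add: k)
  have c1: "adele_norm place_zero (u * v) < 1" if "adele_norm place_zero u \<le> 1" "adele_norm place_zero v < 1" for u v :: "'a adele"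
    using mult_right_mono[OF that(1), of "adele_norm place_zero v"] that(2) by (simp add: adele_norm_mult)
  have "adele_norm place_zero ((a - 1) - tau * ?r * c) < 1"
    by (rule adele_norm_diff_less, use K in blast, rule c1, rule adele_norm_mult_le) (use K tau r in auto)
  then have s1: "adele_norm place_zero (a - ?r * c * tau - 1) < 1" by (simp add: algebra_simps)
  have "adele_norm place_zero ((tau_inv * e - ?r) - ?r * (d - 1)) < 1"
    by (rule adele_norm_diff_less, rule b, rule c1) (use K r in auto)
  then have s2: "adele_norm place_zero (tau_inv * e - ?r * d) < 1" by (simp add: algebra_simps)
  have s3: "adele_norm place_zero (c * tau) < 1" using c1[of tau c] tau K by (simp add: mult.commute)
  have "k' \<in> K_prime"
    using le le2 det s1 s2 s3 K unfolding k'_def K_prime_mat2_iff by simp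
  moreover have "hecke_rep b ** k' = k ** hecke_rep 0"
    unfolding k' by (simp add: matrix_mul_assoc hecke_rep_inverse)
  ultimately show ?thesis using that by metis
qed

text \<open>
  One inclusion is the preceding lemma; for the other, \<open>hecke_rep b\<close> is the product of a
  unipotent matrix in \<open>K'\<close> and \<open>hecke_rep 0\<close>.
\<close>

lemma hecke_double_coset_eq: "hecke_double_coset = (\<Union>b. (\<lambda>k. hecke_rep b ** k) ` K_prime)"
proof (intro equalityI subsetI)
  fix h :: "'a adele_mat" assume "h \<in> hecke_double_coset"
  then obtain k1 k2 where k: "k1 \<in> K_prime" "k2 \<in> K_prime" "h = k1 ** hecke_rep 0 ** k2"
    unfolding hecke_double_coset_def at_place_hecke_rep by blast
  obtain b k' where b: "k' \<in> K_prime" "k1 ** hecke_rep 0 = hecke_rep b ** k'"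
    using K_prime_hecke_rep[OF k(1)] .
  have "h = hecke_rep b ** (k' ** k2)" by (simp add: k(3) b(2) matrix_mul_assoc)
  then show "h \<in> (\<Union>b. (\<lambda>k. hecke_rep b ** k) ` K_prime)" using K_prime_mult[OF b(1) k(2)] by blast
next
  fix h :: "'a adele_mat" assume "h \<in> (\<Union>b. (\<lambda>k. hecke_rep b ** k) ` K_prime)"
  then obtain b k where k: "k \<in> K_prime" "h = hecke_rep b ** k" by blast
  have "mat2 1 (tau * residue_rep b) 0 1 \<in> K_prime"
    using card_gt_1[where 'k='a]
    by (auto simp: K_prime_mat2_iff adele_norm_mult adele_norm_tau adele_norm_residue_rep)
  moreover have "h = mat2 1 (tau * residue_rep b) 0 1 ** hecke_rep 0 ** k"
    unfolding k(2) by (simp add: hecke_rep_def mat2_mult)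
  ultimately show "h \<in> hecke_double_coset"
    unfolding hecke_double_coset_def at_place_hecke_rep using k(1) by blast
qed

text \<open>
  The quotient of two representatives is unipotent with entry \<open>b - c\<close>, which is a unit at
  \<open>x\<close> unless \<open>b = c\<close>.
\<close>

lemma hecke_cosets_disjoint:
  assumes "hecke_rep b ** k = hecke_rep c ** k'" "k \<in> K_prime" "k' \<in> K_prime"
  shows "b = c"
proof -
  have K: "k \<in> K_max" "k' \<in> K_max" using assms K_prime_subset_K_max by auto
  obtain h where h: "h \<in> K_max" "k ** h = mat 1"
    using K GL2_adeles_inverse K_max_inverse K_max_subset_GL2 by (metis subsetD)
  have hp: "h \<in> K_prime"
  proof -
    have "adele_norm place_zero ((mat 1 - k) $ i $ j) < 1" for i j
      using assms(2) unfolding K_prime_iff by (subst vector_minus_component, subst vector_minus_component,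
        subst adele_norm_diff_commute) simp
    then obtain k'' where "k'' \<in> K_prime" "mat 1 = k ** k''"
      using K_prime_coset[OF K_max_one K(1)] by blast
    moreover have "h ** k = mat 1" using h GL2_adeles_inverse K K_max_subset_GL2 matrix_inverse_unique by (metis subsetD)
    ultimately show ?thesis using matrix_inverse_unique[of k k'' h] by simp
  qed
  have "hecke_rep_inv c ** hecke_rep b = hecke_rep_inv c ** (hecke_rep b ** k) ** h"
    using h(2) by (simp flip: matrix_mul_assoc)
  also have "\<dots> = k' ** h" unfolding assms(1) by (simp add: matrix_mul_assoc hecke_rep_inverse)
  finally have "hecke_rep_inv c ** hecke_rep b \<in> K_prime" using K_prime_mult[OF assms(3) hp] by simp
  moreover have "hecke_rep_inv c ** hecke_rep b = mat2 1 (residue_rep (b - c)) 0 1"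
    by (simp add: hecke_rep_def hecke_rep_inv_def mat2_mult flip: mult.assoc residue_rep_diff)
  ultimately have "adele_norm place_zero (residue_rep (b - c)) < 1" by (simp add: K_prime_mat2_iff)
  then show ?thesis by (simp add: adele_norm_residue_rep split: if_splits)
qed

text \<open>
  This is a box in the restricted product topology; its factors are open by the ultrametric inequality.
\<close>

lemma open_adele_ball: "open {a :: 'k::{field,finite} adele. (\<forall>y. adele_norm y a \<le> 1) \<and> adele_norm place_zero (a - c) < 1}"
proof -
  define B where "B = {u \<in> local_integers (place_zero :: 'k place).
      local_abs place_zero (u \<ominus>\<^bsub>local_field place_zero\<^esub> adele_at c place_zero) < 1}"
  define U where "U = (\<lambda>y :: 'k place. if y = place_zero then B else local_integers y)"
  have near: "v \<in> local_integers y" if "u \<in> local_integers y" "v \<in> carrier (local_field y)"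
    "local_abs y (v \<ominus>\<^bsub>local_field y\<^esub> u) < 1" for u v and y :: "'k place"
  proof -
    interpret cring "local_field y" by (rule cring_completion)
    have u: "u \<in> carrier (local_field y)" "local_abs y u \<le> 1" using that by (auto simp: local_integers_def)
    have "(v \<ominus>\<^bsub>local_field y\<^esub> u) \<oplus>\<^bsub>local_field y\<^esub> u = v"
      using that u by (simp add: a_minus_def a_assoc l_neg)
    then have "local_abs y v \<le> max (local_abs y (v \<ominus>\<^bsub>local_field y\<^esub> u)) (local_abs y u)"
      using local_abs_add[of "v \<ominus>\<^bsub>local_field y\<^esub> u" y u] that u by (metis minus_closed)
    then show ?thesis using that u by (auto simp: local_integers_def)
  qed
  have openI: "local_open y (local_integers y)" for y :: "'k place"
    unfolding local_open_def using near[of _ y] by (auto simp: local_integers_def intro!: exI[of _ 1])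
  have openB: "local_open place_zero B"
    unfolding local_open_def
  proof (intro conjI ballI)
    let ?L = "local_field (place_zero :: 'k place)"
    interpret cring ?L by (rule cring_completion)
    show "B \<subseteq> carrier ?L" by (auto simp: B_def local_integers_def)
    fix u assume u: "u \<in> B"
    show "\<exists>e>0. \<forall>v\<in>carrier ?L. local_abs place_zero (v \<ominus>\<^bsub>?L\<^esub> u) < e \<longrightarrow> v \<in> B"
    proof (intro exI[of _ 1] conjI ballI impI)
      fix v assume v: "v \<in> carrier ?L" "local_abs place_zero (v \<ominus>\<^bsub>?L\<^esub> u) < 1"
      have u': "u \<in> local_integers place_zero" "u \<in> carrier ?L"
        "local_abs place_zero (u \<ominus>\<^bsub>?L\<^esub> adele_at c place_zero) < 1"
        using u by (auto simp: B_def local_integers_def)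
      have c: "adele_at c place_zero \<in> carrier ?L" by simp
      have "v \<ominus>\<^bsub>?L\<^esub> adele_at c place_zero = (v \<ominus>\<^bsub>?L\<^esub> u) \<oplus>\<^bsub>?L\<^esub> (u \<ominus>\<^bsub>?L\<^esub> adele_at c place_zero)"
        using u' v c by algebra
      moreover have "local_abs place_zero ((v \<ominus>\<^bsub>?L\<^esub> u) \<oplus>\<^bsub>?L\<^esub> (u \<ominus>\<^bsub>?L\<^esub> adele_at c place_zero)) < 1"
        using local_abs_add[of "v \<ominus>\<^bsub>?L\<^esub> u" place_zero "u \<ominus>\<^bsub>?L\<^esub> adele_at c place_zero"] u' v c
        by (auto simp: minus_closed)
      ultimately show "v \<in> B" using near[OF u'(1) v] by (simp add: B_def)
    qed simp
  qed
  have "finite {y. U y \<noteq> local_integers y}"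
    by (rule finite_subset[of _ "{place_zero}"]) (auto simp: U_def)
  moreover have "\<forall>y. local_open y (U y)" using openI openB by (simp add: U_def)
  ultimately have "open {a. \<forall>y. adele_at a y \<in> U y}"
    unfolding open_adele_def by (intro generate_topology.Basis) blast
  moreover have "adele_norm place_zero (a - c) =
      local_abs place_zero (adele_at a place_zero \<ominus>\<^bsub>local_field place_zero\<^esub> adele_at c place_zero)" for a
    unfolding adele_norm_def minus_adele_def plus_adele.rep_eq uminus_adele.rep_eq a_minus_def ..
  then have "{a. \<forall>y. adele_at a y \<in> U y} = {a. (\<forall>y. adele_norm y a \<le> 1) \<and> adele_norm place_zero (a - c) < 1}"
    by (auto simp: U_def B_def local_integers_def adele_norm_def split: if_splits)
  ultimately show ?thesis by simp
qed

lemma open_integral_adeles: "open (integral_adeles :: 'k::{field,finite} adele set)"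
proof -
  let ?U = "\<lambda>c. {a :: 'k adele. (\<forall>y. adele_norm y a \<le> 1) \<and> adele_norm place_zero (a - c) < 1}"
  have "integral_adeles = (\<Union>c. ?U c)"
  proof (intro equalityI subsetI)
    fix a :: "'k adele" assume "a \<in> integral_adeles"
    then have "a \<in> ?U a" by (simp add: integral_adeles_iff)
    then show "a \<in> (\<Union>c. ?U c)" by blast
  qed (auto simp: integral_adeles_iff)
  moreover have "open (\<Union>c. ?U c)" by (intro open_UN ballI open_adele_ball)
  ultimately show ?thesis by simp
qed

text \<open>
  These are the cosets of \<open>K'\<close> in \<open>K\<close>, described by inequalities so that they are
  visibly open.
\<close>

definition K_max_ball :: "('k::{field,finite}) adele_mat \<Rightarrow> 'k adele_mat set" where
  "K_max_ball c = {k \<in> K_max. \<forall>i j. adele_norm place_zero ((k - c) $ i $ j) < 1}"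

lemma openin_K_max_ball: "openin GL2_topology (K_max_ball (c :: 'k::{field,finite} adele_mat))"
proof -
  let ?B = "\<lambda>i j. {a :: 'k adele. (\<forall>y. adele_norm y a \<le> 1) \<and> adele_norm place_zero (a - c $ i $ j) < 1}"
  let ?V = "\<lambda>i j. ((\<lambda>g. g $ i $ j) -` ?B i j) \<times> ((\<lambda>g. g $ i $ j) -` (integral_adeles :: 'k adele set))"
  have nth: "open ((\<lambda>g. g $ i $ j) -` S)" if "open S" for i j :: 2 and S :: "'k adele set"
  proof -
    have "(\<lambda>g. g $ i $ j) -` S = (\<lambda>g. g $ i) -` ((\<lambda>w. w $ j) -` S)" by auto
    then show ?thesis using that by (simp add: open_vimage_vec_nth)
  qed
  have "open (\<Inter>i. \<Inter>j. ?V i j)"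
    by (intro open_INT ballI open_Times nth open_adele_ball open_integral_adeles) auto
  moreover have "K_max_ball c = (\<lambda>g. (g, matrix_inv g)) -` (\<Inter>i. \<Inter>j. ?V i j) \<inter> GL2_adeles"
  proof -
    have inv: "g ** matrix_inv g = mat 1 \<and> matrix_inv g ** g = mat 1" if "g \<in> GL2_adeles" for g :: "'k adele_mat"
    proof -
      have "\<exists>h. g ** h = mat 1 \<and> h ** g = mat 1" using that unfolding GL2_adeles_def invertible_def by blast
      then show ?thesis unfolding matrix_inv_def by (rule someI_ex)
    qed
    have Kiff: "g \<in> K_max \<longleftrightarrow> (\<forall>i j. g $ i $ j \<in> integral_adeles) \<and> (\<forall>i j. matrix_inv g $ i $ j \<in> integral_adeles)"
      if "g \<in> GL2_adeles" for g :: "'k adele_mat"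
    proof
      assume g: "g \<in> K_max"
      then have "matrix_inv g \<in> K_max" using inv[OF that] K_max_inverse by blast
      with g show "(\<forall>i j. g $ i $ j \<in> integral_adeles) \<and> (\<forall>i j. matrix_inv g $ i $ j \<in> integral_adeles)"
        by (simp add: K_max_iff integral_adeles_iff)
    next
      assume "(\<forall>i j. g $ i $ j \<in> integral_adeles) \<and> (\<forall>i j. matrix_inv g $ i $ j \<in> integral_adeles)"
      then show "g \<in> K_max" unfolding K_max_def using inv[OF that] by blast
    qed
    show ?thesis
    proof (rule Set.set_eqI)
      fix g :: "'k adele_mat"
      show "g \<in> K_max_ball c \<longleftrightarrow> g \<in> (\<lambda>g. (g, matrix_inv g)) -` (\<Inter>i. \<Inter>j. ?V i j) \<inter> GL2_adeles"
      proof (cases "g \<in> GL2_adeles")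
        case True
        then show ?thesis
          unfolding K_max_ball_def mem_Collect_eq Kiff[OF True] by (simp add: integral_adeles_iff) blast
      next
        case False
        then show ?thesis using K_max_subset_GL2 by (simp add: K_max_ball_def subset_iff) blast
      qed
    qed
  qed
  ultimately show ?thesis
    unfolding GL2_topology_def openin_pullback_topology open_openin [symmetric] by blast
qed

lemma K_prime_eq_ball: "K_prime = K_max_ball (mat 1)"
  by (auto simp: K_max_ball_def K_prime_iff)

lemma K_max_ball_coset:
  assumes "h \<in> K_max_ball c"
  shows "K_max_ball c = (\<lambda>k. h ** k) ` K_prime"
proof (intro equalityI subsetI)
  have h: "h \<in> K_max" "\<And>i j. adele_norm place_zero ((h - c) $ i $ j) < 1"
    using assms by (auto simp: K_max_ball_def)
  {
    fix g assume g: "g \<in> K_max_ball c"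
    have "adele_norm place_zero ((g - h) $ i $ j) < 1" for i j
    proof -
      have "adele_norm place_zero ((g - c) $ i $ j - (h - c) $ i $ j) < 1"
        using g h(2) by (intro adele_norm_diff_less) (auto simp: K_max_ball_def)
      then show ?thesis by simp
    qed
    then obtain k where "k \<in> K_prime" "g = h ** k"
      using K_prime_coset[of g h] g h(1) by (auto simp: K_max_ball_def)
    then show "g \<in> (\<lambda>k. h ** k) ` K_prime" by blast
  next
    fix g assume "g \<in> (\<lambda>k. h ** k) ` K_prime"
    then obtain k where k: "k \<in> K_prime" "g = h ** k" by blast
    have "adele_norm place_zero ((g - c) $ i $ j) < 1" for i j
    proof -
      have "adele_norm place_zero ((h ** k - h) $ i $ j + (h - c) $ i $ j) < 1"
        using K_prime_coset_close[OF h(1) k(1)] h(2) by (intro adele_norm_add_less) auto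
      then show ?thesis by (simp add: k(2))
    qed
    moreover have "g \<in> K_max" using k h(1) K_prime_subset_K_max K_max_mult by blast
    ultimately show "g \<in> K_max_ball c" by (simp add: K_max_ball_def)
  }
qed

text \<open>
  The group \<open>K\<close> of volume \<open>1\<close> is covered by finitely many translates of
  \<open>K'\<close>, one for each matrix of residues, so \<open>K'\<close> has positive volume. A set of
  nonzero measure is measurable, as the measure of a nonmeasurable set is \<open>0\<close> by convention; this
  gives the measurability of the translates of \<open>K'\<close>.
\<close>

lemma haar_K_prime:
  fixes \<mu> :: "('k::{field,finite}) adele_mat measure"
  assumes haar: "haar_measure_GL2 \<mu>" and K: "emeasure \<mu> K_max = 1"
  shows "K_prime \<in> sets \<mu>" "emeasure \<mu> K_prime \<noteq> 0" "emeasure \<mu> K_prime < \<infinity>"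
    "\<And>g. g \<in> GL2_adeles \<Longrightarrow> (\<lambda>k. g ** k) ` K_prime \<in> sets \<mu>"
    "\<And>g. g \<in> GL2_adeles \<Longrightarrow> emeasure \<mu> ((\<lambda>k. g ** k) ` K_prime) = emeasure \<mu> K_prime"
proof -
  have sets: "sets \<mu> = sets (sigma GL2_adeles {U. openin GL2_topology U})"
    and inv: "\<And>g A. g \<in> GL2_adeles \<Longrightarrow> A \<in> sets \<mu> \<Longrightarrow> emeasure \<mu> ((\<lambda>h. g ** h) ` A) = emeasure \<mu> A"
    using haar unfolding haar_measure_GL2_def by blast+
  have "{U. openin GL2_topology U} \<subseteq> Pow (GL2_adeles :: 'k adele_mat set)"
    by (auto simp: GL2_topology_def openin_pullback_topology)
  then have ball: "K_max_ball c \<in> sets \<mu>" for c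
    unfolding sets using openin_K_max_ball by (subst sets_measure_of) (auto intro: sigma_sets.Basic)
  then show K': "K_prime \<in> sets \<mu>" by (simp add: K_prime_eq_ball)
  show eq: "emeasure \<mu> ((\<lambda>k. g ** k) ` K_prime) = emeasure \<mu> K_prime" if "g \<in> GL2_adeles" for g
    using inv[OF that K'] .
  show nz: "emeasure \<mu> K_prime \<noteq> 0"
  proof
    assume 0: "emeasure \<mu> K_prime = 0"
    have 0: "emeasure \<mu> (K_max_ball c) = 0" for c
    proof (cases "K_max_ball c = {}")
      case False
      then obtain h where "h \<in> K_max_ball c" by blast
      then show ?thesis using eq[of h] K_max_ball_coset[of h c] 0 K_max_subset_GL2
        by (auto simp: K_max_ball_def)
    qed simp
    let ?c = "\<lambda>c :: 'k ^ 2 ^ 2. principal_mat (\<chi> i j. ratfun_const (c $ i $ j)) :: 'k adele_mat"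
    have "K_max \<subseteq> (\<Union>c. K_max_ball (?c c))"
    proof
      fix k :: "'k adele_mat" assume k: "k \<in> K_max"
      show "k \<in> (\<Union>c. K_max_ball (?c c))"
        by (rule residue_matrix[OF k]) (use k in \<open>auto simp: K_max_ball_def\<close>)
    qed
    then have "emeasure \<mu> K_max \<le> emeasure \<mu> (\<Union>c. K_max_ball (?c c))"
      by (rule emeasure_mono) (use ball in auto)
    also have "\<dots> \<le> (\<Sum>c\<in>UNIV. emeasure \<mu> (K_max_ball (?c c)))"
      by (rule emeasure_subadditive_finite) (use ball in auto)
    also have "\<dots> = 0" by (simp add: 0)
    finally show False using K by simp
  qed
  show "(\<lambda>k. g ** k) ` K_prime \<in> sets \<mu>" if "g \<in> GL2_adeles" for g
    using eq[OF that] nz emeasure_notin_sets by metis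
  have "K_max \<in> sets \<mu>" using K emeasure_notin_sets by (metis zero_neq_one)
  then have "emeasure \<mu> K_prime \<le> 1" using K K_prime_subset_K_max by (metis emeasure_mono)
  then show "emeasure \<mu> K_prime < \<infinity>" by (rule le_less_trans) simp
qed

text \<open>
  The function is constant on each of the \<open>q\<close> cosets of \<open>K'\<close> in the double coset,
  and each of them has the volume of \<open>K'\<close>.
\<close>

lemma hecke_operator_eq_sum:
  fixes \<mu> :: "('k::{field,finite}) adele_mat measure"
  assumes haar: "haar_measure_GL2 \<mu>" "emeasure \<mu> K_max = 1"
    and f: "\<And>k g. k \<in> K_prime \<Longrightarrow> g \<in> GL2_adeles \<Longrightarrow> f (g ** k) = f g" and g: "g \<in> GL2_adeles"
  shows "hecke_operator \<mu> f g = (\<Sum>b\<in>UNIV. f (g ** hecke_rep b))"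
proof -
  note K = haar_K_prime[OF haar]
  let ?S = "\<lambda>b :: 'k. (\<lambda>k. hecke_rep b ** k) ` K_prime"
  define m where "m = measure \<mu> K_prime"
  have "emeasure \<mu> K_prime \<noteq> \<infinity>" using K(3) by simp
  then have "emeasure \<mu> K_prime = ennreal m"
    unfolding m_def by (intro emeasure_eq_ennreal_measure) simp
  then have "m \<noteq> 0" using K(2) by auto
  moreover have "m \<ge> 0" by (simp add: m_def)
  ultimately have m: "m > 0" by linarith
  have S: "?S b \<in> sets \<mu>" "emeasure \<mu> (?S b) < \<infinity>" "measure \<mu> (?S b) = m" for b
    using K(4)[OF hecke_rep_GL2(1), of b] K(5)[OF hecke_rep_GL2(1), of b] K(3)
    by (simp_all add: m_def measure_def)
  have eq: "hecke_kernel \<mu> h * f (g ** h) = (\<Sum>b\<in>UNIV. indicat_real (?S b) h *\<^sub>R (f (g ** hecke_rep b) / of_real m))" for h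
  proof (cases "h \<in> hecke_double_coset")
    case True
    then obtain b k where k: "k \<in> K_prime" "h = hecke_rep b ** k" unfolding hecke_double_coset_eq by blast
    have "h \<in> ?S b'  \<longleftrightarrow> b' = b" for b'
      using k hecke_cosets_disjoint by blast
    then have "(\<Sum>b\<in>UNIV. indicat_real (?S b) h *\<^sub>R (f (g ** hecke_rep b) / of_real m)) =
        (\<Sum>b'\<in>UNIV. if b' = b then f (g ** hecke_rep b') / of_real m else 0)"
      by (intro sum.cong) (auto simp: indicator_def)
    also have "\<dots> = f (g ** hecke_rep b) / of_real m" by simp
    also have "f (g ** hecke_rep b) = f (g ** h)"
      using f[OF k(1) GL2_adeles_mult[OF g hecke_rep_GL2(1)]] by (simp add: k(2) matrix_mul_assoc)
    finally show ?thesis using True by (simp add: hecke_kernel_def m_def)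
  next
    case False
    then have "indicat_real (?S b) h = 0" for b unfolding hecke_double_coset_eq by (auto simp: indicator_def)
    then show ?thesis using False by (simp add: hecke_kernel_def)
  qed
  have "has_bochner_integral \<mu> (\<lambda>h. \<Sum>b\<in>UNIV. indicat_real (?S b) h *\<^sub>R (f (g ** hecke_rep b) / of_real m))
     (\<Sum>b\<in>UNIV. measure \<mu> (?S b) *\<^sub>R (f (g ** hecke_rep b) / of_real m))"
    using S by (intro has_bochner_integral_sum has_bochner_integral_indicator) auto
  then have "(LINT h|\<mu>. hecke_kernel \<mu> h * f (g ** h)) = (\<Sum>b\<in>UNIV. measure \<mu> (?S b) *\<^sub>R (f (g ** hecke_rep b) / of_real m))"
    unfolding eq by (rule has_bochner_integral_integral_eq)
  also have "\<dots> = (\<Sum>b\<in>UNIV. f (g ** hecke_rep b))"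
    using m by (simp add: S scaleR_conv_of_real)
  finally show ?thesis using g by (simp add: hecke_operator_def)
qed


section \<open>The neighbours of a vertex in the graph of the Hecke operator\<close>

lemma adele_norm_add_null:
  assumes "adele_norm y b = 0"
  shows "adele_norm y (a + b) = adele_norm y a"
proof (cases "adele_norm y a = 0")
  case True
  then have "adele_norm y (a + b) \<le> 0" using assms by (intro adele_norm_add_le) auto
  then show ?thesis using True adele_norm_nonneg[of y "a + b"] by linarith
next
  case False
  then have "adele_norm y b < adele_norm y a" using assms by (simp add: less_le)
  then show ?thesis by (rule adele_norm_add_dominant)
qed

lemma tau_unit: "tau dvd 1" "tau_inv dvd 1"
  by (metis dvd_triv_left tau_mult_inv)+

lemma idele_size_tau:
  "idele_size (tau :: 'k::{field,finite} adele) = 1 / real CARD('k)"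
  "idele_size (tau_inv :: 'k::{field,finite} adele) = real CARD('k)"
proof -
  have "idele_size (tau :: 'k adele) = (\<Prod>y\<in>{place_zero}. adele_norm y (tau :: 'k adele))"
    unfolding idele_size_def by (rule Prod_any.expand_superset) (auto simp: adele_norm_tau)
  then show "idele_size (tau :: 'k::{field,finite} adele) = 1 / real CARD('k)" by (simp add: adele_norm_tau)
  have "idele_size (tau_inv :: 'k adele) = (\<Prod>y\<in>{place_zero}. adele_norm y (tau_inv :: 'k adele))"
    unfolding idele_size_def by (rule Prod_any.expand_superset) (auto simp: adele_norm_tau_inv)
  then show "idele_size (tau_inv :: 'k::{field,finite} adele) = real CARD('k)" by (simp add: adele_norm_tau_inv)
qed

lemma idele_size_hecke_rep:
  fixes g :: "'k::{field,finite} adele_mat"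
  assumes "g \<in> GL2_adeles"
  shows "idele_size (det (g ** hecke_rep b)) = idele_size (det g) / real CARD('k)"
    and "idele_size (det (g ** hecke_rep_inv b)) = idele_size (det g) * real CARD('k)"
  using assms
  by (simp_all add: det_mul hecke_rep_def hecke_rep_inv_def GL2_adeles_iff idele_size_mult tau_unit idele_size_tau)

lemma hecke_row:
  "(w v* hecke_rep b) $ 1 = w $ 1 * tau" "(w v* hecke_rep b) $ 2 = w $ 2 + w $ 1 * (tau * residue_rep b)"
  "(w v* hecke_rep_inv b) $ 1 = w $ 1 * tau_inv" "(w v* hecke_rep_inv b) $ 2 = w $ 2 + w $ 1 * (- residue_rep b)"
  by (simp_all add: row_mult_nth hecke_rep_def hecke_rep_inv_def add.commute)

lemma row_norm_hecke_away:
  assumes "y \<noteq> place_zero"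
  shows "row_norm y (w v* hecke_rep b) = row_norm y w" "row_norm y (w v* hecke_rep_inv b) = row_norm y w"
proof -
  have "adele_norm y (w $ 1 * (tau * residue_rep b)) = 0" "adele_norm y (w $ 1 * (- residue_rep b)) = 0"
    using assms by (simp_all add: adele_norm_mult adele_norm_residue_rep)
  then show "row_norm y (w v* hecke_rep b) = row_norm y w" "row_norm y (w v* hecke_rep_inv b) = row_norm y w"
    using assms unfolding row_norm_def hecke_row
    by (simp_all only: adele_norm_add_null adele_norm_mult adele_norm_tau adele_norm_tau_inv if_False mult_1_right)
qed

text \<open>
  If the line of \<open>v\<close> in the fibre at \<open>x\<close> is \<open>(1 : 0)\<close>, then the
  modification multiplies the whole row by the uniformizer up to units, so the invariant grows by one. The new
  line is \<open>(1 : b - b0)\<close> for a constant \<open>b0\<close> that depends on \<open>g\<close>.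
\<close>

lemma hecke_step_flagged:
  fixes g :: "'k::{field,finite} adele_mat"
  assumes g: "g \<in> GL2_adeles" and d: "destabilizes n v g" and fl: "flagged v g"
  shows "destabilizes (Suc n) v (g ** hecke_rep b)"
    and "\<exists>b0. \<forall>b. flagged v (g ** hecke_rep b) \<longleftrightarrow> b = b0"
proof -
  define w where "w = principal_vec v v* g"
  let ?q = "real CARD('k)" and ?N = "adele_norm (place_zero :: 'k place)"
  have q: "?q > 1" by (rule card_gt_1)
  have v: "v \<noteq> 0" using d by (simp add: destabilizes_def)
  have wD: "principal_vec v v* (g ** hecke_rep b) = w v* hecke_rep b" for b
    by (simp add: w_def vector_matrix_mul_assoc)
  have fl: "?N (w $ 2) < ?N (w $ 1)" using fl by (simp add: flagged_def w_def)
  then have w1: "?N (w $ 1) > 0" using adele_norm_nonneg[of place_zero "w $ 2"] by linarith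
  have w2: "?N (w $ 2) \<le> ?N (w $ 1) / ?q" using adele_norm_zero_less[OF fl] .
  have "row_norm y (w v* hecke_rep b) = row_norm y w * adele_norm y (tau :: 'k adele)" for y b
  proof (cases "y = place_zero")
    case True
    have 1: "?N ((w v* hecke_rep b) $ 1) = ?N (w $ 1) / ?q"
      by (simp add: hecke_row adele_norm_mult adele_norm_tau)
    have "?N (w $ 2 + w $ 1 * (tau * residue_rep b)) \<le> ?N (w $ 1) / ?q"
      using w2 by (intro adele_norm_add_le) (auto simp: adele_norm_mult adele_norm_tau adele_norm_residue_rep)
    then have 2: "?N ((w v* hecke_rep b) $ 2) \<le> ?N (w $ 1) / ?q" by (simp add: hecke_row)
    show ?thesis using True fl 1 2 by (simp add: row_norm_def adele_norm_tau max_absorb1)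
  next
    case False
    then show ?thesis by (simp add: row_norm_hecke_away adele_norm_tau)
  qed
  then have rs: "row_size (w v* hecke_rep b) = row_size w * idele_size (tau :: 'k adele)" for b
    unfolding row_size_def idele_size_def w_def
    using Prod_any.distrib[OF row_norm_GL2(1)[OF v g] adele_unit_norm(2)[OF tau_unit(1)]] by (simp add: w_def)
  then show "destabilizes (Suc n) v (g ** hecke_rep b)"
    using d q unfolding destabilizes_def wD idele_size_hecke_rep(1)[OF g] rs
    by (simp add: idele_size_tau power2_eq_square w_def [symmetric] field_simps)
  \<comment> \<open>The entry \<open>w $ 1\<close> is a unit at \<open>x\<close>, perhaps not elsewhere; so \<open>c\<close> inverts it at \<open>x\<close> only.\<close>
  let ?u = "mix_adele {place_zero} (w $ 1) 1"
  have "?u dvd 1"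
    unfolding adele_unit_iff
  proof
    show "\<forall>y. adele_norm y ?u \<noteq> 0" using w1 by (auto simp: adele_norm_mix)
    show "finite {y. adele_norm y ?u \<noteq> 1}"
      by (rule finite_subset[of _ "{place_zero}"]) (auto simp: adele_norm_mix)
  qed
  then obtain c where c: "?u * c = 1" by (metis dvdE)
  have "?u - w $ 1 = mix_adele {place_zero} 0 (1 - w $ 1)"
    using mix_adele_diff[of "{place_zero}" "w $ 1" 1 "w $ 1" "w $ 1"] by simp
  then have "?N (?u - w $ 1) = 0" by (simp add: adele_norm_mix)
  then have "?N ((?u - w $ 1) * c) = 0" by (simp add: adele_norm_mult)
  then have c0: "?N (1 - w $ 1 * c) = 0" using c by (simp add: left_diff_distrib)
  have "?N ?u * ?N c = 1" using c by (metis adele_norm_mult adele_norm_1)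
  then have Nc: "?N (w $ 1) * ?N c = 1" by (simp add: adele_norm_mix)
  \<comment> \<open>The second entry of the new row is \<open>w $ 1 * tau * (residue_rep b - a)\<close> at \<open>x\<close>.\<close>
  define a where "a = - (tau_inv * (w $ 2 * c))"
  have "?N a = ?q * ?N (w $ 2) * ?N c" by (simp add: a_def adele_norm_mult adele_norm_tau_inv)
  also have "\<dots> \<le> ?N (w $ 1) * ?N c" using w2 q by (intro mult_right_mono) (auto simp: field_simps)
  finally have "?N a \<le> 1" by (simp add: Nc)
  then obtain b0 where b0: "?N (a - residue_rep b0) < 1" by (rule residue_rep_exists)
  have "flagged v (g ** hecke_rep b) \<longleftrightarrow> ?N (a - residue_rep b) < 1" for b
  proof -
    have "tau * a = - (w $ 2 * c)" by (simp add: a_def mult.commute flip: mult.assoc)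
    then have "w $ 2 + w $ 1 * (tau * residue_rep b) =
        w $ 1 * (tau * (residue_rep b - a)) + w $ 2 * (1 - w $ 1 * c)"
      by (simp add: right_diff_distrib algebra_simps)
    moreover have "?N (w $ 2 * (1 - w $ 1 * c)) = 0" by (simp add: adele_norm_mult c0)
    ultimately have "?N (w $ 2 + w $ 1 * (tau * residue_rep b)) = ?N (w $ 1) * (1 / ?q * ?N (residue_rep b - a))"
      by (simp only: adele_norm_add_null adele_norm_mult) (simp add: adele_norm_tau)
    then show ?thesis using w1 q
      unfolding flagged_def wD hecke_row
      by (simp add: adele_norm_mult adele_norm_tau adele_norm_diff_commute[of _ a] field_simps)
  qed
  then show "\<exists>b0. \<forall>b. flagged v (g ** hecke_rep b) \<longleftrightarrow> b = b0"
    using b0 residue_rep_unique by blast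
qed

text \<open>
  If the second entry of the row dominates at \<open>x\<close>, the row keeps its size while the determinant
  gets smaller; and the second entry still dominates.
\<close>

lemma hecke_step_unflagged:
  fixes g :: "'k::{field,finite} adele_mat"
  assumes g: "g \<in> GL2_adeles" and d: "destabilizes (Suc n) v g" and fl: "\<not> flagged v g"
  shows "destabilizes n v (g ** hecke_rep b)" and "\<not> flagged v (g ** hecke_rep b)"
proof -
  define w where "w = principal_vec v v* g"
  let ?q = "real CARD('k)" and ?N = "adele_norm (place_zero :: 'k place)"
  have q: "?q > 1" by (rule card_gt_1)
  have v: "v \<noteq> 0" using d by (simp add: destabilizes_def)
  have wD: "principal_vec v v* (g ** hecke_rep b) = w v* hecke_rep b"
    by (simp add: w_def vector_matrix_mul_assoc)
  have fl: "?N (w $ 1) \<le> ?N (w $ 2)" using fl by (simp add: flagged_def w_def)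
  have w2: "?N (w $ 2) > 0"
    using row_norm_GL2(2)[OF v g, of place_zero] fl by (simp add: row_norm_def w_def [symmetric])
  have "?N (w $ 1) / ?q \<le> ?N (w $ 2) / ?q" using fl q by (intro divide_right_mono) auto
  also have "\<dots> < ?N (w $ 2)" using w2 q by (simp add: field_simps)
  finally have s: "?N (w $ 1 * tau) < ?N (w $ 2)" by (simp add: adele_norm_mult adele_norm_tau)
  have "?N (w $ 1 * (tau * residue_rep b)) \<le> ?N (w $ 1 * tau)"
    by (simp add: adele_norm_mult adele_norm_residue_rep)
  then have e: "?N (w $ 2 + w $ 1 * (tau * residue_rep b)) = ?N (w $ 2)"
    using s by (intro adele_norm_add_dominant) linarith
  have "row_norm y (w v* hecke_rep b) = row_norm y w" for y
  proof (cases "y = place_zero")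
    case True
    then show ?thesis using s e fl by (simp add: row_norm_def hecke_row max_def)
  qed (rule row_norm_hecke_away)
  then have "row_size (w v* hecke_rep b) = row_size w" by (simp add: row_size_def)
  then show "destabilizes n v (g ** hecke_rep b)"
    using d q unfolding destabilizes_def wD idele_size_hecke_rep(1)[OF g]
    by (simp add: w_def [symmetric] field_simps)
  show "\<not> flagged v (g ** hecke_rep b)" using s e by (simp add: flagged_def wD hecke_row)
qed

text \<open>
  The inverse step, which shows that each flagged vertex with positive invariant is a neighbour of a flagged
  vertex whose invariant is one less.
\<close>

lemma hecke_step_back:
  fixes g :: "'k::{field,finite} adele_mat"
  assumes g: "g \<in> GL2_adeles" and d: "destabilizes (Suc n) v g" and fl: "flagged v g"
  shows "destabilizes n v (g ** hecke_rep_inv 0)" and "flagged v (g ** hecke_rep_inv 0)"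
proof -
  define w where "w = principal_vec v v* g"
  let ?q = "real CARD('k)" and ?N = "adele_norm (place_zero :: 'k place)"
  have q: "?q > 1" by (rule card_gt_1)
  have v: "v \<noteq> 0" using d by (simp add: destabilizes_def)
  have wD: "principal_vec v v* (g ** hecke_rep_inv 0) = w v* hecke_rep_inv 0"
    by (simp add: w_def vector_matrix_mul_assoc)
  have fl: "?N (w $ 2) < ?N (w $ 1)" using fl by (simp add: flagged_def w_def)
  have "?N (w $ 1) * 1 \<le> ?N (w $ 1) * ?q" using q by (intro mult_left_mono) auto
  then have s: "?N (w $ 2) < ?N (w $ 1 * tau_inv)" using fl by (simp add: adele_norm_mult adele_norm_tau_inv)
  have "row_norm y (w v* hecke_rep_inv 0) = row_norm y w * adele_norm y (tau_inv :: 'k adele)" for y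
  proof (cases "y = place_zero")
    case True
    then show ?thesis using s fl by (simp add: row_norm_def hecke_row adele_norm_mult max_absorb1)
  next
    case False
    then show ?thesis by (simp add: row_norm_hecke_away adele_norm_tau_inv)
  qed
  then have "row_size (w v* hecke_rep_inv 0) = row_size w * idele_size (tau_inv :: 'k adele)"
    unfolding row_size_def idele_size_def w_def
    using Prod_any.distrib[OF row_norm_GL2(1)[OF v g] adele_unit_norm(2)[OF tau_unit(2)]] by simp
  then show "destabilizes n v (g ** hecke_rep_inv 0)"
    using d q unfolding destabilizes_def wD idele_size_hecke_rep(2)[OF g]
    by (simp add: idele_size_tau power2_eq_square w_def [symmetric] field_simps)
  show "flagged v (g ** hecke_rep_inv 0)" using s by (simp add: flagged_def wD hecke_row)
qed


section \<open>The height bounds the invariant\<close>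

lemma local_height_eq:
  assumes "det g * e = 1"
  shows "local_height y g = Max (insert (adele_norm y e) (range (\<lambda>(i, j). adele_norm y (g $ i $ j))))"
proof -
  interpret cring "local_field y" by (rule cring_completion)
  have "adele_at (det g) y \<otimes>\<^bsub>local_field y\<^esub> adele_at e y = \<one>\<^bsub>local_field y\<^esub>"
    by (metis assms times_adele.rep_eq one_adele.rep_eq)
  then have "inv\<^bsub>local_field y\<^esub> (adele_at (det g) y) = adele_at e y"
    by (intro comm_inv_char) auto
  moreover have "{local_abs y (adele_at (g $ i $ j) y) |i j. True} = range (\<lambda>(i, j). adele_norm y (g $ i $ j))"
    by (auto simp: adele_norm_def)
  ultimately show ?thesis by (simp add: local_height_def adele_norm_def)
qed

text \<open>
  If all entries and the inverse determinant had norm below \<open>1\<close>, so would the product of the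
  determinant and its inverse.
\<close>

lemma local_height_bounds:
  assumes e: "det g * e = 1"
  shows "adele_norm y (g $ i $ j) \<le> local_height y g" "adele_norm y e \<le> local_height y g" "local_height y g \<ge> 1"
proof -
  show 1: "adele_norm y (g $ i $ j) \<le> local_height y g" for i j
    unfolding local_height_eq[OF e] by (rule Max_ge) auto
  show 2: "adele_norm y e \<le> local_height y g"
    unfolding local_height_eq[OF e] by (rule Max_ge) auto
  show "local_height y g \<ge> 1"
  proof (rule ccontr)
    assume "\<not> ?thesis"
    then have lt: "adele_norm y (g $ i $ j) < 1" "adele_norm y e < 1" for i j
      using 1[of i j] 2 by linarith+
    have "adele_norm y (g $ i $ j * g $ k $ l) < 1" for i j k l
      using mult_strict_mono[of "adele_norm y (g $ i $ j)" 1 "adele_norm y (g $ k $ l)" 1] lt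
      by (simp add: adele_norm_mult)
    then have "adele_norm y (det g) < 1" unfolding det_2 by (intro adele_norm_diff_less)
    then have "adele_norm y (det g) * adele_norm y e < 1 * 1" using lt by (intro mult_strict_mono) auto
    then show False using e by (simp flip: adele_norm_mult)
  qed
qed

lemma finite_local_height:
  assumes e: "det g * e = 1"
  shows "finite {y. local_height y g \<noteq> 1}"
proof -
  have "{y. local_height y g \<noteq> 1} \<subseteq> {y. adele_norm y e > 1} \<union> (\<Union>i. \<Union>j. {y. adele_norm y (g $ i $ j) > 1})"
  proof
    fix y assume "y \<in> {y. local_height y g \<noteq> 1}"
    then have gt: "local_height y g > 1" using local_height_bounds(3)[OF e, of y] by auto
    have "local_height y g \<in> insert (adele_norm y e) (range (\<lambda>(i, j). adele_norm y (g $ i $ j)))"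
      unfolding local_height_eq[OF e] by (rule Max_in) auto
    with gt show "y \<in> {y. adele_norm y e > 1} \<union> (\<Union>i. \<Union>j. {y. adele_norm y (g $ i $ j) > 1})" by auto
  qed
  then show ?thesis by (rule finite_subset) (auto simp: finite_adele_norm_gt_1)
qed

lemma height_eq: "height g = (\<Prod>y. local_height y g)"
  by (simp add: height_def Prod_any.expand_set)

lemma height_ge_1:
  assumes "g \<in> GL2_adeles"
  shows "height g \<ge> 1"
proof -
  obtain e where e: "det g * e = 1" using assms unfolding GL2_adeles_iff by (metis dvdE)
  show ?thesis unfolding height_def using local_height_bounds(3)[OF e] by (intro prod_ge_1)
qed

lemma row_size_principal_vec_ge_1:
  assumes "v \<noteq> 0"
  shows "row_size (principal_vec v) \<ge> 1"
proof -
  obtain i where i: "v $ i \<noteq> 0" using assms by (auto simp: vec_eq_iff)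
  have "(\<Prod>y. place_abs y (v $ i)) \<le> row_size (principal_vec v)"
    unfolding row_size_def
  proof (rule Prod_any_mono)
    show "place_abs y (v $ i) \<le> row_norm y (principal_vec v)" for y
      using exhaust_2[of i] by (auto simp: row_norm_def principal_vec_def)
  qed (use place_abs_product_formula[OF i] row_norm_principal_vec(1)[OF assms] in auto)
  then show ?thesis by (simp add: place_abs_product_formula[OF i])
qed

text \<open>
  Recovering \<open>v\<close> from \<open>v g\<close> with the adjugate matrix costs a factor \<open>height g
  / idele_size (det g)\<close>, and \<open>v\<close> has size at least \<open>1\<close>. So \<open>row_size (v
  g)\<close> cannot be small, which bounds \<open>n\<close>.
\<close>

lemma destabilizes_le_height:
  fixes g :: "'k::{field,finite} adele_mat"
  assumes g: "g \<in> GL2_adeles" and d: "destabilizes n v g"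
  shows "real CARD('k) ^ n \<le> height g ^ 3"
proof -
  obtain e where e: "det g * e = 1" using g unfolding GL2_adeles_iff by (metis dvdE)
  have v: "v \<noteq> 0" and D: "real CARD('k) ^ n * row_size (principal_vec v v* g) ^ 2 = idele_size (det g)"
    using d by (auto simp: destabilizes_def)
  have units: "det g dvd 1" "e dvd 1" using e by (metis dvd_triv_left, metis dvd_triv_right)
  let ?w = "principal_vec v v* g"
  define A E H where "A = row_size ?w" and "E = idele_size e" and "H = height g"
  have DE: "idele_size (det g) * E = 1"
    using idele_size_mult[OF units] e by (simp add: E_def idele_size_def)
  have pos: "A > 0" "E > 0" "H \<ge> 1"
    unfolding A_def E_def H_def using row_size_pos[OF v g] idele_size_pos[OF units(2)] height_ge_1[OF g] by auto
  let ?h = "mat2 (g $ 2 $ 2 * e) (- g $ 1 $ 2 * e) (- g $ 2 $ 1 * e) (g $ 1 $ 1 * e)"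
  have "?w v* ?h = principal_vec v" unfolding vector_matrix_mul_assoc mat2_adjugate(1)[OF e] by simp
  moreover have "adele_norm y (?h $ i $ j) \<le> local_height y g * adele_norm y e" for y i j
    using exhaust_2[of i] exhaust_2[of j] local_height_bounds(1)[OF e]
    by (auto simp: adele_norm_mult intro!: mult_right_mono)
  ultimately have le: "row_norm y (principal_vec v) \<le> row_norm y ?w * (local_height y g * adele_norm y e)" for y
    using row_norm_mult_le[of y ?h "local_height y g * adele_norm y e" ?w] by simp
  have fin: "finite {y. local_height y g * adele_norm y e \<noteq> 1}"
    by (rule finite_subset[of _ "{y. local_height y g \<noteq> 1} \<union> {y. adele_norm y e \<noteq> 1}"])
       (use finite_local_height[OF e] adele_unit_norm(2)[OF units(2)] in auto)
  have fin2: "finite {y. row_norm y ?w * (local_height y g * adele_norm y e) \<noteq> 1}"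
    by (rule finite_subset[of _ "{y. row_norm y ?w \<noteq> 1} \<union> {y. local_height y g * adele_norm y e \<noteq> 1}"])
       (use fin row_norm_GL2(1)[OF v g] in auto)
  have "1 \<le> row_size (principal_vec v)" by (rule row_size_principal_vec_ge_1[OF v])
  also have "\<dots> \<le> (\<Prod>y. row_norm y ?w * (local_height y g * adele_norm y e))"
    unfolding row_size_def
    by (rule Prod_any_mono[OF row_norm_principal_vec(1)[OF v] fin2]) (simp_all add: le)
  also have "\<dots> = A * (H * E)"
    using Prod_any.distrib[OF row_norm_GL2(1)[OF v g] fin]
      Prod_any.distrib[OF finite_local_height[OF e] adele_unit_norm(2)[OF units(2)]]
    by (simp add: A_def H_def E_def row_size_def height_eq idele_size_def)
  finally have 1: "1 \<le> A * (H * E)" .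
  have "E \<le> H"
    unfolding E_def H_def height_eq idele_size_def
    by (rule Prod_any_mono) (use adele_unit_norm(2)[OF units(2)] finite_local_height[OF e] local_height_bounds(2)[OF e] in auto)
  have "1 * 1 \<le> (A * (H * E)) * (A * (H * E))" using 1 by (intro mult_mono) auto
  then have "real CARD('k) ^ n * 1 \<le> real CARD('k) ^ n * ((A * (H * E)) * (A * (H * E)))"
    by (intro mult_left_mono) auto
  also have "\<dots> = (real CARD('k) ^ n * A ^ 2 * E) * (H * H * E)" by (simp add: power2_eq_square)
  also have "real CARD('k) ^ n * A ^ 2 * E = 1" using D DE by (simp add: A_def)
  also have "1 * (H * H * E) \<le> H * H * H" using \<open>E \<le> H\<close> pos by (simp add: mult_left_mono)
  finally show ?thesis by (simp add: H_def power3_eq_cube)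
qed


section \<open>The eigenspace\<close>

text \<open>
  The value of the normalized eigenfunction on the flagged class with invariant \<open>n\<close>; on the other
  classes it is \<open>(q / l) ^ n\<close>. The recursion is the eigenvalue equation at a flagged vertex,
  whose neighbours are one flagged and \<open>q - 1\<close> unflagged vertices. Both values are
  \<open>1\<close> for \<open>n = 0\<close>, where each class has flagged and unflagged destabilizing vectors.
\<close>

primrec flagged_value :: "complex \<Rightarrow> complex \<Rightarrow> nat \<Rightarrow> complex" where
  "flagged_value q l 0 = 1"
| "flagged_value q l (Suc n) = l * flagged_value q l n - (q - 1) * (q / l) ^ Suc n"

definition eigenfunction :: "complex \<Rightarrow> ('k::{field,finite}) adele_mat \<Rightarrow> complex" where
  "eigenfunction l g =
    (if g \<in> GL2_adeles then
       let n = (THE n. \<exists>v. destabilizes n v g) in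
       if \<exists>v. destabilizes n v g \<and> flagged v g then flagged_value (of_nat CARD('k)) l n
       else (of_nat CARD('k) / l) ^ n
     else 0)"

text \<open>
  Any destabilizing vector may be used for the evaluation: for \<open>n > 0\<close> it is unique up to
  scaling, and for \<open>n = 0\<close> the two possible values agree.
\<close>

lemma eigenfunction_eq:
  fixes g :: "'k::{field,finite} adele_mat"
  assumes g: "g \<in> GL2_adeles" and d: "destabilizes n v g"
  shows "eigenfunction l g =
    (if flagged v g then flagged_value (of_nat CARD('k)) l n else (of_nat CARD('k) / l) ^ n)"
proof -
  have n: "(THE n. \<exists>v. destabilizes n v g) = n"
    by (rule the_equality) (use d destabilizes_unique(1)[OF g] in blast)+
  show ?thesis
  proof (cases n)
    case 0
    then show ?thesis using g by (simp add: eigenfunction_def n)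
  next
    case (Suc m)
    have "(\<exists>w. destabilizes n w g \<and> flagged w g) \<longleftrightarrow> flagged v g"
      using d destabilizes_unique(2)[OF g d] flagged_smult Suc by (metis zero_less_Suc)
    then show ?thesis using g by (simp add: eigenfunction_def n)
  qed
qed

lemma eigenfunction_eqI:
  fixes g h :: "'k::{field,finite} adele_mat"
  assumes "g \<in> GL2_adeles" "destabilizes n v g" "h \<in> GL2_adeles" "destabilizes n w h" "flagged v g \<longleftrightarrow> flagged w h"
  shows "eigenfunction l g = eigenfunction l h"
  using assms by (simp add: eigenfunction_eq)

text \<open>
  The recursion bounds the values by \<open>R ^ n\<close>, and \<open>q ^ n\<close> is at most the third power
  of the height.
\<close>

lemma eigenfunction_growth:
  fixes l :: complex
  assumes "l \<noteq> 0"
  obtains C N :: real where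
    "\<And>g :: 'k::{field,finite} adele_mat. g \<in> GL2_adeles \<Longrightarrow> cmod (eigenfunction l g) \<le> C * height g powr N"
proof -
  let ?q = "real CARD('k)" and ?c = "of_nat CARD('k) :: complex"
  have q: "?q > 1" by (rule card_gt_1)
  \<comment> \<open>Large enough for both recursions and for \<open>R \<ge> 1\<close>.\<close>
  define R where "R = cmod l + ?q * (?q / cmod l) + ?q + ?q / cmod l"
  have l: "cmod l > 0" using assms by simp
  have pos: "?q / cmod l > 0" "?q * (?q / cmod l) > 0" using q l by simp_all
  have R1: "R \<ge> 1" unfolding R_def using q l pos by linarith
  have R0: "R \<ge> 0" using R1 by simp
  have A: "cmod ((?c / l) ^ n) \<le> R ^ n" for n
    unfolding norm_power norm_divide using l q pos by (intro power_mono) (auto simp: R_def)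
  have B: "cmod (flagged_value ?c l n) \<le> R ^ n" for n
  proof (induction n)
    case (Suc n)
    have "?c - 1 = of_nat (CARD('k) - 1)" by (simp add: of_nat_diff Suc_leI)
    then have c1: "cmod (?c - 1) \<le> ?q" by (simp only: norm_of_nat)
    have "cmod (flagged_value ?c l (Suc n)) \<le> cmod l * cmod (flagged_value ?c l n) + cmod (?c - 1) * cmod ((?c / l) ^ Suc n)"
      by (simp add: norm_mult flip: norm_mult) (metis norm_triangle_ineq4 norm_mult)
    also have "\<dots> \<le> cmod l * R ^ n + ?q * (?q / cmod l * R ^ n)"
    proof (rule add_mono)
      show "cmod l * cmod (flagged_value ?c l n) \<le> cmod l * R ^ n" using Suc by (intro mult_left_mono) auto
      have "cmod ((?c / l) ^ Suc n) = ?q / cmod l * cmod ((?c / l) ^ n)" by (simp add: norm_mult norm_divide)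
      also have "\<dots> \<le> ?q / cmod l * R ^ n" using A pos by (intro mult_left_mono) auto
      finally show "cmod (?c - 1) * cmod ((?c / l) ^ Suc n) \<le> ?q * (?q / cmod l * R ^ n)"
        using c1 by (intro mult_mono) auto
    qed
    also have "\<dots> = (cmod l + ?q * (?q / cmod l)) * R ^ n" by (simp add: algebra_simps)
    also have "\<dots> \<le> R * R ^ n" using R0 q pos by (intro mult_right_mono) (auto simp: R_def)
    finally show ?case by simp
  qed simp
  define r where "r = log ?q R"
  have r: "r \<ge> 0" "?q powr r = R" using q R1 by (auto simp: r_def)
  show ?thesis
  proof (rule that[of 1 "3 * r"])
    fix g :: "'k adele_mat" assume g: "g \<in> GL2_adeles"
    obtain n v where d: "destabilizes n v g" using destabilizes_exists[OF g] by blast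
    have H: "height g > 0" using height_ge_1[OF g] by linarith
    have "cmod (eigenfunction l g) \<le> R ^ n" using A B by (simp add: eigenfunction_eq[OF g d])
    also have "R ^ n = (?q ^ n) powr r"
    proof -
      have "R ^ n = (?q powr r) powr real n" using R1 unfolding r(2) by (intro powr_realpow [symmetric]) simp
      also have "\<dots> = (?q powr real n) powr r" unfolding powr_powr by (simp only: mult.commute)
      also have "?q powr real n = ?q ^ n" using q by (intro powr_realpow) simp
      finally show ?thesis .
    qed
    also have "\<dots> \<le> (height g ^ 3) powr r"
      using destabilizes_le_height[OF g d] r(1) q by (intro powr_mono2) auto
    also have "height g ^ 3 = height g powr 3" using powr_realpow[OF H, of 3] by simp
    also have "(height g powr 3) powr r = height g powr (3 * r)" by (rule powr_powr)
    finally show "cmod (eigenfunction l g) \<le> 1 * height g powr (3 * r)" by simp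
  qed
qed

lemma GL2_adeles_center: "u dvd 1 \<Longrightarrow> scalar2 u \<in> GL2_adeles"
  using mult_dvd_mono[of u 1 u 1] by (simp add: GL2_adeles_iff)

lemma eigenfunction_automorphic:
  assumes "l \<noteq> 0"
  shows "eigenfunction l \<in> automorphic_K_prime"
  unfolding automorphic_K_prime_def mem_Collect_eq
proof (intro conjI allI impI ballI)
  fix g :: "'a adele_mat" assume "g \<notin> GL2_adeles"
  then show "eigenfunction l g = 0" by (simp add: eigenfunction_def)
next
  fix m :: "'a ratfun ^ 2 ^ 2" and g :: "'a adele_mat"
  assume m: "invertible m" and g: "g \<in> GL2_adeles"
  have mg: "principal_mat m ** g \<in> GL2_adeles" using principal_mat_GL2[OF m] g by (rule GL2_adeles_mult)
  obtain n v where d: "destabilizes n v (principal_mat m ** g)" using destabilizes_exists[OF mg] by blast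
  then have "destabilizes n (v v* m) g" using destabilizes_principal[OF m g] by simp
  then show "eigenfunction l (principal_mat m ** g) = eigenfunction l g"
    by (intro eigenfunction_eqI[OF mg d g]) (simp_all add: flagged_principal)
next
  fix z g :: "'a adele_mat" assume "z \<in> center_GL2" and g: "g \<in> GL2_adeles"
  then obtain u where u: "u dvd 1" "z = scalar2 u" unfolding center_GL2_iff by blast
  obtain n v where d: "destabilizes n v g" using destabilizes_exists[OF g] by blast
  have "z ** g = g ** scalar2 u" by (simp add: u scalar2_commute)
  then show "eigenfunction l (z ** g) = eigenfunction l g"
    using eigenfunction_eqI[of "g ** scalar2 u" n v g v l] u g d
    by (simp add: GL2_adeles_mult GL2_adeles_center destabilizes_scalar flagged_scalar)
next
  fix k g :: "'a adele_mat" assume k: "k \<in> K_prime" and g: "g \<in> GL2_adeles"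
  obtain n v where d: "destabilizes n v g" using destabilizes_exists[OF g] by blast
  have "k \<in> K_max" "k \<in> GL2_adeles" using k K_prime_subset_K_max K_max_subset_GL2 by auto
  then show "eigenfunction l (g ** k) = eigenfunction l g"
    using eigenfunction_eqI[of "g ** k" n v g v l] k g d
    by (simp add: GL2_adeles_mult destabilizes_K flagged_K_prime)
next
  show "\<exists>C N :: real. \<forall>g\<in>GL2_adeles :: 'a adele_mat set. cmod (eigenfunction l g) \<le> C * height g powr N"
    using eigenfunction_growth[OF assms] by metis
qed

lemma eigenfunction_one: "eigenfunction l (mat 1 :: 'k::{field,finite} adele_mat) = 1"
proof -
  have "destabilizes 0 (vector [0, 1]) (mat2 1 0 0 1 :: 'k adele_mat)"
    by (rule destabilizes_diagonal) simp_all
  then have "destabilizes 0 (vector [0, 1]) (mat 1 :: 'k adele_mat)" by (simp add: mat2_1)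
  then show ?thesis by (simp add: eigenfunction_eq[OF GL2_adeles_one])
qed

text \<open>
  At a flagged vertex the equation is the recursion for \<open>flagged_value\<close>, and at an unflagged one
  with invariant \<open>n > 0\<close> it is \<open>q (q / l) ^ (n - 1) = l (q / l) ^ n\<close>. With invariant
  \<open>0\<close> a flagged vector can be chosen.
\<close>

lemma eigenfunction_hecke:
  fixes g :: "'k::{field,finite} adele_mat"
  assumes l: "l \<noteq> 0" and g: "g \<in> GL2_adeles"
  shows "(\<Sum>b\<in>UNIV. eigenfunction l (g ** hecke_rep b)) = l * eigenfunction l g"
proof -
  let ?c = "of_nat CARD('k) :: complex"
  note gb = GL2_adeles_mult[OF g hecke_rep_GL2(1)]
  have main: "(\<Sum>b\<in>UNIV. eigenfunction l (g ** hecke_rep b)) = l * eigenfunction l g"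
    if d: "destabilizes n v g" and fl: "flagged v g" for n v
  proof -
    obtain b0 where b0: "\<And>b. flagged v (g ** hecke_rep b) \<longleftrightarrow> b = b0"
      using hecke_step_flagged(2)[OF g d fl] by blast
    have "eigenfunction l (g ** hecke_rep b) =
        (?c / l) ^ Suc n + (if b = b0 then flagged_value ?c l (Suc n) - (?c / l) ^ Suc n else 0)" for b
      using eigenfunction_eq[OF gb hecke_step_flagged(1)[OF g d fl], where l = l, of b] b0[of b] by simp
    then have "(\<Sum>b\<in>UNIV. eigenfunction l (g ** hecke_rep b)) =
        ?c * (?c / l) ^ Suc n + (flagged_value ?c l (Suc n) - (?c / l) ^ Suc n)"
      by (simp only: sum.distrib sum_constant sum.delta finite UNIV_I if_True)
    also have "\<dots> = l * flagged_value ?c l n"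
      unfolding flagged_value.simps by (simp add: left_diff_distrib del: power_Suc)
    also have "flagged_value ?c l n = eigenfunction l g" using fl by (simp add: eigenfunction_eq[OF g d])
    finally show ?thesis .
  qed
  obtain n v where d: "destabilizes n v g" using destabilizes_exists[OF g] by blast
  show ?thesis
  proof (cases n)
    case 0
    then obtain w where "destabilizes 0 w g" "flagged w g" using destabilizes_0_flagged[OF g] d by blast
    then show ?thesis by (rule main)
  next
    case (Suc m)
    show ?thesis
    proof (cases "flagged v g")
      case True
      with d show ?thesis by (rule main)
    next
      case False
      have d': "destabilizes (Suc m) v g" using d Suc by simp
      have "eigenfunction l (g ** hecke_rep b) = (?c / l) ^ m" for b
        using eigenfunction_eq[OF gb hecke_step_unflagged(1)[OF g d' False]] hecke_step_unflagged(2)[OF g d' False]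
        by simp
      then have "(\<Sum>b\<in>UNIV. eigenfunction l (g ** hecke_rep b)) = ?c * (?c / l) ^ m" by simp
      also have "\<dots> = l * (?c / l) ^ Suc m" using l by simp
      also have "(?c / l) ^ Suc m = eigenfunction l g" using False Suc by (simp add: eigenfunction_eq[OF g d])
      finally show ?thesis .
    qed
  qed
qed

text \<open>
  Induction on the invariant. All classes with invariant \<open>0\<close> are that of the identity. An
  unflagged vertex with invariant \<open>n + 1\<close> has only neighbours with invariant \<open>n\<close>, so
  its value vanishes as \<open>l \<noteq> 0\<close>. A flagged vertex with invariant \<open>n + 1\<close> is
  the only flagged neighbour of a vertex with invariant \<open>n\<close>, and the eigenvalue equation at the
  latter leaves no other value than \<open>0\<close>.
\<close>

lemma eigenfunction_unique:
  fixes f :: "'k::{field,finite} adele_mat \<Rightarrow> complex"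
  assumes l: "l \<noteq> 0" and f: "f \<in> automorphic_K_prime"
    and T: "\<And>g. g \<in> GL2_adeles \<Longrightarrow> (\<Sum>b\<in>UNIV. f (g ** hecke_rep b)) = l * f g" and f1: "f (mat 1) = 0"
  shows "f g = 0"
proof -
  have inv: "\<And>m g. invertible m \<Longrightarrow> g \<in> GL2_adeles \<Longrightarrow> f (principal_mat m ** g) = f g"
    "\<And>z g. z \<in> center_GL2 \<Longrightarrow> g \<in> GL2_adeles \<Longrightarrow> f (z ** g) = f g"
    "\<And>k g. k \<in> K_prime \<Longrightarrow> g \<in> GL2_adeles \<Longrightarrow> f (g ** k) = f g"
    using f unfolding automorphic_K_prime_def by blast+
  have "f g = 0" if "g \<in> GL2_adeles" "destabilizes n v g" for n v g
    using that
  proof (induction n arbitrary: v g)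
    case 0
    obtain \<gamma> k z where *: "invertible \<gamma>" "k \<in> K_prime" "z dvd 1" "principal_mat \<gamma> ** g = k ** scalar2 z"
      using destabilizes_0_reduction[OF 0] .
    have k: "k \<in> GL2_adeles" using *(2) K_prime_subset_K_max K_max_subset_GL2 by auto
    have "f g = f (scalar2 z ** k)" using inv(1)[OF *(1) 0(1)] *(4) by (simp add: scalar2_commute)
    also have "\<dots> = f k" using *(3) by (intro inv(2) k) (auto simp: center_GL2_iff)
    also have "\<dots> = f (mat 1)" using inv(3)[OF *(2) GL2_adeles_one] by simp
    finally show ?case using f1 by simp
  next
    case (Suc n)
    have unfl: "f g = 0" if g: "g \<in> GL2_adeles" "destabilizes (Suc n) v g" "\<not> flagged v g" for g v
    proof -
      have "f (g ** hecke_rep b) = 0" for b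
        using Suc.IH[OF GL2_adeles_mult[OF g(1) hecke_rep_GL2(1)] hecke_step_unflagged(1)[OF g]] .
      then show ?thesis using T[OF g(1)] l by simp
    qed
    show ?case
    proof (cases "flagged v g")
      case True
      define h where "h = g ** hecke_rep_inv 0"
      have h: "h \<in> GL2_adeles" unfolding h_def by (intro GL2_adeles_mult Suc.prems hecke_rep_GL2)
      have dh: "destabilizes n v h" "flagged v h"
        unfolding h_def using hecke_step_back[OF Suc.prems True] by simp_all
      have hg: "h ** hecke_rep 0 = g" by (simp add: h_def hecke_rep_inverse flip: matrix_mul_assoc)
      obtain b0 where b0: "\<And>b. flagged v (h ** hecke_rep b) \<longleftrightarrow> b = b0"
        using hecke_step_flagged(2)[OF h dh] by blast
      have "b0 = 0" using b0[of 0] True hg by simp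
      then have "f (h ** hecke_rep b) = (if b = 0 then f g else 0)" for b
        using unfl[OF GL2_adeles_mult[OF h hecke_rep_GL2(1)] hecke_step_flagged(1)[OF h dh]] b0 hg by auto
      then have "(\<Sum>b\<in>UNIV. f (h ** hecke_rep b)) = f g" by simp
      moreover have "f h = 0" using Suc.IH[OF h dh(1)] .
      ultimately show ?thesis using T[OF h] by simp
    qed (use unfl Suc.prems in blast)
  qed
  moreover have "f g = 0" if "g \<notin> GL2_adeles" using f that unfolding automorphic_K_prime_def by blast
  ultimately show ?thesis using destabilizes_exists by blast
qed

lemma hecke_eigenspace_iff:
  fixes \<mu> :: "('k::{field,finite}) adele_mat measure"
  assumes "haar_measure_GL2 \<mu>" "emeasure \<mu> K_max = 1"
  shows "f \<in> hecke_eigenspace \<mu> l \<longleftrightarrow> f \<in> automorphic_K_prime \<and>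
    (\<forall>g\<in>GL2_adeles. (\<Sum>b\<in>UNIV. f (g ** hecke_rep b)) = l * f g)"
proof (cases "f \<in> automorphic_K_prime")
  case True
  then have f: "\<And>k g. k \<in> K_prime \<Longrightarrow> g \<in> GL2_adeles \<Longrightarrow> f (g ** k) = f g"
    "\<And>g. g \<notin> GL2_adeles \<Longrightarrow> f g = 0"
    unfolding automorphic_K_prime_def by blast+
  have "hecke_operator \<mu> f g = (if g \<in> GL2_adeles then \<Sum>b\<in>UNIV. f (g ** hecke_rep b) else 0)" for g
    using hecke_operator_eq_sum[where f = f, OF assms f(1)] by (simp add: hecke_operator_def)
  then show ?thesis using True f(2) by (auto simp: hecke_eigenspace_def fun_scale_def fun_eq_iff)
qed (simp add: hecke_eigenspace_def)

lemma automorphic_add: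
  assumes "f \<in> automorphic_K_prime" "h \<in> automorphic_K_prime"
  shows "f + h \<in> automorphic_K_prime"
proof -
  obtain C N where 1: "\<And>g. g \<in> GL2_adeles \<Longrightarrow> cmod (f g) \<le> C * height g powr N"
    using assms(1) unfolding automorphic_K_prime_def by blast
  obtain C' N' where 2: "\<And>g. g \<in> GL2_adeles \<Longrightarrow> cmod (h g) \<le> C' * height g powr N'"
    using assms(2) unfolding automorphic_K_prime_def by blast
  have le: "c * height g powr a \<le> \<bar>c\<bar> * height g powr max N N'"
    if "g \<in> GL2_adeles" "a \<le> max N N'" for c a and g :: "'a adele_mat"
    using height_ge_1[OF that(1)] that(2) by (intro mult_mono powr_mono) auto
  have "cmod (f g + h g) \<le> (\<bar>C\<bar> + \<bar>C'\<bar>) * height g powr max N N'" if "g \<in> GL2_adeles" for g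
    using norm_triangle_ineq[of "f g" "h g"] 1[OF that] 2[OF that] le[OF that, of N C] le[OF that, of N' C']
    by (simp add: distrib_right)
  then show ?thesis using assms unfolding automorphic_K_prime_def by (simp add: plus_fun_def) blast
qed

lemma automorphic_scale:
  assumes "f \<in> automorphic_K_prime"
  shows "fun_scale c f \<in> automorphic_K_prime"
proof -
  obtain C N where 1: "\<And>g. g \<in> GL2_adeles \<Longrightarrow> cmod (f g) \<le> C * height g powr N"
    using assms(1) unfolding automorphic_K_prime_def by blast
  have "cmod (c * f g) \<le> (cmod c * C) * height g powr N" if "g \<in> GL2_adeles" for g
    using mult_left_mono[OF 1[OF that], of "cmod c"] by (simp add: norm_mult mult.assoc)
  then show ?thesis using assms unfolding automorphic_K_prime_def by (simp add: fun_scale_def) blast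
qed

theorem theorem4p12:
  fixes \<mu> :: "('k::{field,finite}) adele_mat measure" and l :: complex
  assumes "haar_measure_GL2 \<mu>" and "emeasure \<mu> K_max = 1" and "l \<noteq> 0"
  shows "module.subspace fun_scale (hecke_eigenspace \<mu> l) \<and>
    Vector_Spaces.linear fun_scale (*) (\<lambda>f :: 'k adele_mat \<Rightarrow> complex. f (mat 1)) \<and>
    bij_betw (\<lambda>f. f (mat 1)) (hecke_eigenspace \<mu> l) UNIV \<and>
    vector_space.dim fun_scale (hecke_eigenspace \<mu> l) = 1"
proof -
  interpret V: vector_space "fun_scale :: complex \<Rightarrow> ('k adele_mat \<Rightarrow> complex) \<Rightarrow> _"
    by (rule vector_space_fun_scale)
  note iff = hecke_eigenspace_iff[OF assms(1,2)]
  let ?E = "hecke_eigenspace \<mu> l" and ?F = "eigenfunction l :: 'k adele_mat \<Rightarrow> complex"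
  have F: "?F \<in> ?E" using assms(3) by (simp add: iff eigenfunction_automorphic eigenfunction_hecke)
  have scale: "fun_scale c f \<in> ?E" if "f \<in> ?E" for c f
    using that automorphic_scale[of f c] unfolding iff by (auto simp: fun_scale_def simp flip: sum_distrib_left)
  have add: "f + h \<in> ?E" if "f \<in> ?E" "h \<in> ?E" for f h
    using that unfolding iff by (auto simp: automorphic_add sum.distrib distrib_left)
  have sub: "V.subspace ?E"
  proof (rule V.subspaceI)
    have "fun_scale 0 ?F \<in> ?E" by (rule scale[OF F])
    then show "0 \<in> ?E" by simp
  qed (auto intro: scale add)
  have zero: "h g = 0" if "h \<in> ?E" "h (mat 1) = 0" for h g
    by (rule eigenfunction_unique[OF assms(3)]) (use that in \<open>auto simp: iff\<close>)
  have eq: "f = fun_scale (f (mat 1)) ?F" if f: "f \<in> ?E" for f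
  proof -
    have "f + fun_scale (- f (mat 1)) ?F \<in> ?E" by (rule add[OF f scale[OF F]])
    moreover have "(f + fun_scale (- f (mat 1)) ?F) (mat 1) = 0"
      by (simp add: fun_scale_def eigenfunction_one)
    ultimately have "(f + fun_scale (- f (mat 1)) ?F) g = 0" for g by (rule zero)
    then have "f g + - f (mat 1) * ?F g = 0" for g unfolding plus_fun_def fun_scale_def .
    then have "f g = f (mat 1) * ?F g" for g by (metis eq_neg_iff_add_eq_0 minus_mult_left minus_minus)
    then show ?thesis unfolding fun_scale_def by (rule ext)
  qed
  have lin: "Vector_Spaces.linear fun_scale (*) (\<lambda>f :: 'k adele_mat \<Rightarrow> complex. f (mat 1))"
    unfolding Vector_Spaces.linear_iff
  proof (intro conjI allI)
    show "vector_space (fun_scale :: complex \<Rightarrow> ('k adele_mat \<Rightarrow> complex) \<Rightarrow> _)"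
      by (rule vector_space_fun_scale)
    show "vector_space ((*) :: complex \<Rightarrow> complex \<Rightarrow> complex)"
      by unfold_locales (simp_all add: algebra_simps)
  qed (simp_all add: fun_scale_def)
  have bij: "bij_betw (\<lambda>f. f (mat 1)) ?E UNIV"
  proof (rule bij_betwI[where g = "\<lambda>c. fun_scale c ?F"])
    show "(\<lambda>c. fun_scale c ?F) \<in> UNIV \<rightarrow> ?E" using scale[OF F] by simp
    show "fun_scale (f (mat 1)) ?F = f" if "f \<in> ?E" for f using eq[OF that] by simp
  qed (simp_all add: fun_scale_def eigenfunction_one)
  have "V.dim ?E = 1"
  proof (rule V.dim_unique)
    show "{?F} \<subseteq> ?E" using F by simp
    show "?E \<subseteq> V.span {?F}" using eq by (metis V.span_base V.span_scale singletonI subsetI)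
    have "?F \<noteq> 0" using eigenfunction_one[where 'k = 'k, of l] by (metis zero_fun_def zero_neq_one)
    then show "V.independent {?F}" by simp
  qed simp
  with sub lin bij show ?thesis by blast
qed

end
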